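(* Let $d\ge 4$ and let $C: f=0$ be an arrangement of $d$ lines in $\mathbb{P}^2$ which is not free, and suppose that $r=mdr(f)\ge 2$. Put $\tau(d,r)_{min}=(d-1)(d-r-1)$. Then the following hold. (i) One has $$\tau(C)\ \ge\ \tau(d,r)_{min}+\binom{r}{2}+\binom{n(C)}{2}+1 .$$ (ii) If $r\neq d-m(C)$, then $$\tau(C)\ \ge\ \tau(d,r)_{min}+\binom{r}{2}+\binom{m(C)}{2}+1 .$$
   Context: Let $S=\mathbb{C}[x,y,z]$ with its standard grading, with $S_m$ the space of homogeneous polynomials of degree $m$. An arrangement of $d$ lines in the complex projective plane $\mathbb{P}^2$ is a reduced curve $C:f=0$, where $f\in S_d$ is a product of $d$ pairwise non-proportional linear forms. Write $f_x,f_y,f_z$ for the partial derivatives of $f$. $AR(f)\subset S^3$ is the graded $S$-module of Jacobian syzygies: its degree $q$ part $AR(f)_q$ consists of the triples $(a,b,c)\in S_q^3$ with $af_x+bf_y+cf_z=0$. The integer $mdr(f)$ is the smallest $m\ge 0$ such that $AR(f)_m\ne 0$. The curve $C$ is free if $AR(f)$ is a free graded $S$-module (of rank 2). $\tau(C)$ is the global Tjurina number of $C$, i.e. the sum of the Tjurina numbers of the singular points of $C$. For a line arrangement, $\tau(C)=\sum_p (n(p)-1)^2$, the sum being over all multiple points $p$ of $C$, where $n(p)$ is the multiplicity of $C$ at $p$ (the number of lines of $C$ through $p$). $m(C)$ is the maximal multiplicity of a point of $C$, and $n(C)$ is the maximal multiplicity of a point in $C\setminus\{p\}$, where $p$ is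 any point of $C$ of multiplicity $m(C)$. *)

theory Defs
  imports
    Complex_Main
    "HOL-Library.Product_Plus"
    "HOL-Computational_Algebra.Polynomial_Factorial"
begin

section \<open>The polynomial ring in three variables\<close>

text \<open>
  The ring of polynomials in \<open>x\<close>, \<open>y\<close>, \<open>z\<close> over the complex numbers is represented by iterated
  univariate polynomials.  The outermost variable is \<open>x\<close> and the innermost one is \<open>z\<close>: the
  coefficient of \<open>x^i y^j z^k\<close> in \<open>f\<close> is \<open>coeff (coeff (coeff f i) j) k\<close>.
\<close>

type_synonym poly3 = "complex poly poly poly"

definition homogeneous :: "nat \<Rightarrow> poly3 \<Rightarrow> bool" where
  "homogeneous m f \<longleftrightarrow> (\<forall>i j k. coeff (coeff (coeff f i) j) k \<noteq> 0 \<longrightarrow> i + j + k = m)"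

definition deriv_x :: "poly3 \<Rightarrow> poly3" where
  "deriv_x f = pderiv f"

definition deriv_y :: "poly3 \<Rightarrow> poly3" where
  "deriv_y f = map_poly pderiv f"

definition deriv_z :: "poly3 \<Rightarrow> poly3" where
  "deriv_z f = map_poly (map_poly pderiv) f"

text \<open>
  The value \<open>f(a, b, c)\<close> in a commutative ring that receives the complex numbers through \<open>\<kappa>\<close>.
\<close>

definition subst3 :: "(complex \<Rightarrow> 'a::comm_ring_1) \<Rightarrow> poly3 \<Rightarrow> 'a \<Rightarrow> 'a \<Rightarrow> 'a \<Rightarrow> 'a" where
  "subst3 \<kappa> f a b c =
     poly (map_poly (\<lambda>p. poly (map_poly (\<lambda>q. poly (map_poly \<kappa> q) c) p) b) f) a"

lemma deriv_x_coeff: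
  "coeff (coeff (coeff (deriv_x f) i) j) k = of_nat (Suc i) * coeff (coeff (coeff f (Suc i)) j) k"
  by (simp add: deriv_x_def coeff_pderiv of_nat_poly)

lemma deriv_y_coeff:
  "coeff (coeff (coeff (deriv_y f) i) j) k = of_nat (Suc j) * coeff (coeff (coeff f i) (Suc j)) k"
  by (simp add: deriv_y_def coeff_map_poly coeff_pderiv of_nat_poly)

lemma deriv_z_coeff:
  "coeff (coeff (coeff (deriv_z f) i) j) k = of_nat (Suc k) * coeff (coeff (coeff f i) j) (Suc k)"
  by (simp add: deriv_z_def coeff_map_poly coeff_pderiv)

lemma subst3_eq_sum:
  assumes "\<kappa> 0 = 0"
  shows "subst3 \<kappa> f a b c =
    (\<Sum>i\<le>degree f. (\<Sum>j\<le>degree (coeff f i). (\<Sum>k\<le>degree (coeff (coeff f i) j).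
       \<kappa> (coeff (coeff (coeff f i) j) k) * c ^ k) * b ^ j) * a ^ i)"
proof -
  have *: "poly (map_poly h p) u = (\<Sum>i\<le>degree p. h (coeff p i) * u ^ i)"
    if "h 0 = 0" for h :: "'c::zero \<Rightarrow> 'a" and p u
  proof -
    have "poly (map_poly h p) u = (\<Sum>i\<le>degree (map_poly h p). coeff (map_poly h p) i * u ^ i)"
      by (rule poly_altdef)
    also have "\<dots> = (\<Sum>i\<le>degree p. coeff (map_poly h p) i * u ^ i)"
    proof (rule sum.mono_neutral_left)
      have "degree (map_poly h p) \<le> degree p"
        using that by (intro degree_le) (simp add: coeff_map_poly coeff_eq_0)
      then show "{..degree (map_poly h p)} \<subseteq> {..degree p}" by auto
    qed (auto simp: coeff_eq_0)
    finally show ?thesis using that by (simp add: coeff_map_poly)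
  qed
  show ?thesis using assms by (simp add: subst3_def *)
qed


section \<open>Jacobian syzygies\<close>

type_synonym triple = "poly3 \<times> poly3 \<times> poly3"

fun scale3 :: "poly3 \<Rightarrow> triple \<Rightarrow> triple" where
  "scale3 s (a, b, c) = (s * a, s * b, s * c)"

interpretation S3: module scale3
  by unfold_locales (auto simp: algebra_simps)

definition AR :: "poly3 \<Rightarrow> triple set" where
  "AR f = {(a, b, c). a * deriv_x f + b * deriv_y f + c * deriv_z f = 0}"

definition AR_graded :: "poly3 \<Rightarrow> nat \<Rightarrow> triple set" where
  "AR_graded f q =
     {(a, b, c) \<in> AR f. homogeneous q a \<and> homogeneous q b \<and> homogeneous q c}"

definition mdr :: "poly3 \<Rightarrow> nat" where
  "mdr f = (LEAST m. AR_graded f m \<noteq> {0})"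

text \<open>
  The curve \<open>f = 0\<close> is free if its module of syzygies has a homogeneous basis; such a basis
  has two elements.
\<close>

definition free_curve :: "poly3 \<Rightarrow> bool" where
  "free_curve f \<longleftrightarrow>
     (\<exists>B \<subseteq> (\<Union>q. AR_graded f q). card B = 2 \<and> S3.independent B \<and> S3.span B = AR f)"


section \<open>The projective plane\<close>

definition proportional ::
  "complex \<times> complex \<times> complex \<Rightarrow> complex \<times> complex \<times> complex \<Rightarrow> bool" where
  "proportional = (\<lambda>(x, y, z) w.
     (x, y, z) \<noteq> (0, 0, 0) \<and> (\<exists>c. c \<noteq> 0 \<and> w = (c * x, c * y, c * z)))"

quotient_type proj_plane = "complex \<times> complex \<times> complex" / partial: proportional
proof (rule part_equivpI)
  show "\<exists>v. proportional v v"
    by (rule exI [of _ "(1, 0, 0)"]) (auto simp: proportional_def intro: exI [of _ 1])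
  show "symp proportional"
  proof (rule sympI)
    fix v w assume "proportional v w"
    then obtain x y z c where "v = (x, y, z)" "v \<noteq> (0, 0, 0)" "c \<noteq> 0"
      "w = (c * x, c * y, c * z)"
      by (cases v) (auto simp: proportional_def)
    then show "proportional w v"
      by (auto simp: proportional_def intro!: exI [of _ "inverse c"])
  qed
  show "transp proportional"
  proof (rule transpI)
    fix u v w assume "proportional u v" "proportional v w"
    then obtain x y z c c' where "u = (x, y, z)" "u \<noteq> (0, 0, 0)" "c \<noteq> 0" "c' \<noteq> 0"
      "w = (c' * (c * x), c' * (c * y), c' * (c * z))"
      by (cases u) (auto simp: proportional_def)
    then show "proportional u w"
      by (auto simp: proportional_def intro!: exI [of _ "c' * c"])
  qed
qed

text \<open>
  Vanishing is required at all homogeneous coordinates of the point; for homogeneous \<open>f\<close> it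
  suffices to test one of them.
\<close>

lift_definition vanishes_at :: "poly3 \<Rightarrow> proj_plane \<Rightarrow> bool" is
  "\<lambda>f (x, y, z). \<forall>c. c \<noteq> 0 \<longrightarrow> subst3 (\<lambda>u. u) f (c * x) (c * y) (c * z) = 0"
proof -
  fix f v w assume "proportional v w"
  then obtain x y z c where v: "v = (x, y, z)" and c: "c \<noteq> 0" and w: "w = (c * x, c * y, c * z)"
    by (cases v) (auto simp: proportional_def)
  let ?P = "\<lambda>e. subst3 (\<lambda>u. u) f (e * x) (e * y) (e * z) = 0"
  have "(\<forall>e. e \<noteq> 0 \<longrightarrow> ?P e) \<longleftrightarrow> (\<forall>e. e \<noteq> 0 \<longrightarrow> ?P (e * c))"
  proof (intro iffI allI impI)
    fix e :: complex assume "\<forall>e. e \<noteq> 0 \<longrightarrow> ?P e" "e \<noteq> 0"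
    then show "?P (e * c)" using c by simp
  next
    fix e :: complex assume "\<forall>e. e \<noteq> 0 \<longrightarrow> ?P (e * c)" "e \<noteq> 0"
    then have "?P (e / c * c)" using c by (metis divide_eq_0_iff)
    then show "?P e" using c by simp
  qed
  then show "(case v of (x, y, z) \<Rightarrow>
        \<forall>c. c \<noteq> 0 \<longrightarrow> subst3 (\<lambda>u. u) f (c * x) (c * y) (c * z) = 0) =
      (case w of (x, y, z) \<Rightarrow>
        \<forall>c. c \<noteq> 0 \<longrightarrow> subst3 (\<lambda>u. u) f (c * x) (c * y) (c * z) = 0)"
    by (simp add: v w mult.assoc)
qed

definition curve :: "poly3 \<Rightarrow> proj_plane set" where
  "curve f = {p. vanishes_at f p}"

definition singular_points :: "poly3 \<Rightarrow> proj_plane set" where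
  "singular_points f =
     {p \<in> curve f. vanishes_at (deriv_x f) p \<and> vanishes_at (deriv_y f) p \<and> vanishes_at (deriv_z f) p}"


section \<open>Tjurina numbers\<close>

text \<open>
  The local equation \<open>g(s, t)\<close> of \<open>f = 0\<close> at a point, in the coordinates of a standard affine
  chart translated so that the point becomes the origin: for \<open>x \<noteq> 0\<close> it is
  \<open>f(1, y/x + s, z/x + t)\<close>.  The outer variable of \<open>g\<close> is \<open>s\<close> and the inner one is \<open>t\<close>.
\<close>

type_synonym poly2 = "complex poly poly"

definition const2 :: "complex \<Rightarrow> poly2" where
  "const2 c = [:[:c:]:]"

definition var_s :: poly2 where
  "var_s = [:0, 1:]"

definition var_t :: poly2 where
  "var_t = [:[:0, 1:]:]"

lift_definition local_equation :: "poly3 \<Rightarrow> proj_plane \<Rightarrow> poly2" is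
  "\<lambda>f (x, y, z).
     if x \<noteq> 0 then subst3 const2 f 1 (const2 (y / x) + var_s) (const2 (z / x) + var_t)
     else if y \<noteq> 0 then subst3 const2 f (const2 (x / y) + var_s) 1 (const2 (z / y) + var_t)
     else subst3 const2 f (const2 (x / z) + var_s) (const2 (y / z) + var_t) 1"
  by (auto simp: proportional_def)

text \<open>
  The local ring of the affine plane at the origin, as a subring of the field of rational
  functions, and its ideal generated by \<open>g\<close> and the two partial derivatives of \<open>g\<close>.
\<close>

definition local_ring :: "poly2 fract set" where
  "local_ring = {Fract a b |a b. poly (poly b 0) 0 \<noteq> 0}"

definition tjurina_ideal :: "poly2 \<Rightarrow> poly2 fract set" where
  "tjurina_ideal g =
     {u * to_fract g + v * to_fract (pderiv g) + w * to_fract (map_poly pderiv g) |u v w.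
       u \<in> local_ring \<and> v \<in> local_ring \<and> w \<in> local_ring}"

definition scale_fract :: "complex \<Rightarrow> poly2 fract \<Rightarrow> poly2 fract" where
  "scale_fract c q = to_fract (const2 c) * q"

interpretation rat_fun: vector_space scale_fract
proof
  have "const2 (a + b) = const2 a + const2 b" "const2 (a * b) = const2 a * const2 b"
    "const2 1 = 1" for a b
    by (simp_all add: const2_def one_pCons)
  then show "scale_fract a (x + y) = scale_fract a x + scale_fract a y"
    "scale_fract (a + b) x = scale_fract a x + scale_fract b x"
    "scale_fract a (scale_fract b x) = scale_fract (a * b) x"
    "scale_fract 1 x = x" for a b x y
    by (simp_all add: scale_fract_def algebra_simps)
qed

text \<open>
  The dimension of \<open>V / I\<close> is the size of a basis of a complement of \<open>I\<close> in \<open>V\<close>.  It is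
  only meaningful if the quotient is finite-dimensional, as it is for the local algebra of an
  isolated singularity.
\<close>

definition quotient_dim :: "poly2 fract set \<Rightarrow> poly2 fract set \<Rightarrow> nat" where
  "quotient_dim V I =
     (THE n. \<exists>B \<subseteq> V. finite B \<and> card B = n \<and> rat_fun.independent B \<and>
        rat_fun.span B \<inter> I = {0} \<and> rat_fun.span (B \<union> I) = V)"

lemma complement_card_le:
  assumes I: "rat_fun.subspace I"
    and B: "finite B" "rat_fun.span (B \<union> I) = V"
    and B': "B' \<subseteq> V" "rat_fun.independent B'" "rat_fun.span B' \<inter> I = {0}" "finite B'"
  shows "card B' \<le> card B"
proof -
  have "\<exists>c. c \<in> rat_fun.span B \<and> b - c \<in> I" if "b \<in> B'" for b
  proof -
    have "b \<in> rat_fun.span (B \<union> I)" using that B' B by auto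
    then obtain u v where "u \<in> rat_fun.span B" "v \<in> rat_fun.span I" "b = u + v"
      unfolding rat_fun.span_Un by auto
    moreover have "rat_fun.span I = I" using I by (rule rat_fun.span_eq_iff [THEN iffD2])
    ultimately show ?thesis by auto
  qed
  then obtain c where c: "\<And>b. b \<in> B' \<Longrightarrow> c b \<in> rat_fun.span B" "\<And>b. b \<in> B' \<Longrightarrow> b - c b \<in> I"
    by metis
  have key: "u b = 0" if "(\<Sum>b\<in>B'. scale_fract (u b) (c b)) = 0" "b \<in> B'" for u b
  proof -
    have "(\<Sum>b\<in>B'. scale_fract (u b) (b - c b)) \<in> I"
      using c I by (intro rat_fun.subspace_sum rat_fun.subspace_scale) auto
    then have "(\<Sum>b\<in>B'. scale_fract (u b) b) \<in> I"
      using that by (simp add: rat_fun.scale_right_diff_distrib sum_subtractf)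
    moreover have "(\<Sum>b\<in>B'. scale_fract (u b) b) \<in> rat_fun.span B'"
      by (intro rat_fun.span_sum rat_fun.span_scale rat_fun.span_base)
    ultimately have "(\<Sum>b\<in>B'. scale_fract (u b) b) = 0" using B' by blast
    then show ?thesis
      using B' that rat_fun.independentD [of B' B' u b] by auto
  qed
  have inj: "inj_on c B'"
  proof (rule inj_onI, rule ccontr)
    fix a b assume ab: "a \<in> B'" "b \<in> B'" "c a = c b" "a \<noteq> b"
    let ?u = "\<lambda>x. if x = a then 1 else if x = b then - 1 else (0::complex)"
    have "(\<Sum>x\<in>B'. scale_fract (?u x) (c x)) = (\<Sum>x\<in>{a, b}. scale_fract (?u x) (c x))"
      using ab B' by (intro sum.mono_neutral_right) auto
    also have "\<dots> = 0" using ab by simp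
    finally have "?u a = 0" using ab by (intro key)
    then show False by simp
  qed
  have "rat_fun.independent (c ` B')"
  proof (rule rat_fun.independent_if_scalars_zero)
    fix f x assume *: "(\<Sum>x\<in>c ` B'. scale_fract (f x) x) = 0" "x \<in> c ` B'"
    then obtain b where b: "b \<in> B'" "x = c b" by auto
    have "(\<Sum>b\<in>B'. scale_fract (f (c b)) (c b)) = 0"
      using * inj by (simp add: sum.reindex)
    then show "f x = 0" using key [of "\<lambda>b. f (c b)" b] b by simp
  qed (use B' in auto)
  then have "card (c ` B') \<le> card B"
    using B c by (intro conjunct2 [OF rat_fun.independent_span_bound]) auto
  then show ?thesis using inj by (simp add: card_image)
qed

lemma quotient_dim_eq:
  assumes "rat_fun.subspace I" "B \<subseteq> V" "finite B" "rat_fun.independent B"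
    "rat_fun.span B \<inter> I = {0}" "rat_fun.span (B \<union> I) = V"
  shows "quotient_dim V I = card B"
  unfolding quotient_dim_def
proof (rule the_equality)
  fix n
  assume "\<exists>B\<subseteq>V. finite B \<and> card B = n \<and> rat_fun.independent B \<and>
    rat_fun.span B \<inter> I = {0} \<and> rat_fun.span (B \<union> I) = V"
  then obtain B' where "B' \<subseteq> V" "finite B'" "card B' = n" "rat_fun.independent B'"
    "rat_fun.span B' \<inter> I = {0}" "rat_fun.span (B' \<union> I) = V" by blast
  then show "n = card B"
    using complement_card_le [of I B V B'] complement_card_le [of I B' V B] assms by simp
qed (use assms in auto)

definition tjurina_number :: "poly3 \<Rightarrow> proj_plane \<Rightarrow> nat" where
  "tjurina_number f p = quotient_dim local_ring (tjurina_ideal (local_equation f p))"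

definition global_tjurina :: "poly3 \<Rightarrow> nat" where
  "global_tjurina f = (\<Sum>p\<in>singular_points f. tjurina_number f p)"


section \<open>Line arrangements\<close>

definition line_arrangement :: "nat \<Rightarrow> (nat \<Rightarrow> poly3) \<Rightarrow> bool" where
  "line_arrangement d L \<longleftrightarrow>
     (\<forall>i<d. homogeneous 1 (L i) \<and> L i \<noteq> 0) \<and>
     (\<forall>i<d. \<forall>j<d. i \<noteq> j \<longrightarrow> \<not> (\<exists>c. L i = [:[:[:c:]:]:] * L j))"

definition arrangement_poly :: "nat \<Rightarrow> (nat \<Rightarrow> poly3) \<Rightarrow> poly3" where
  "arrangement_poly d L = (\<Prod>i<d. L i)"

definition multiplicity_at :: "nat \<Rightarrow> (nat \<Rightarrow> poly3) \<Rightarrow> proj_plane \<Rightarrow> nat" where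
  "multiplicity_at d L p = card {i. i < d \<and> vanishes_at (L i) p}"

definition max_mult :: "nat \<Rightarrow> (nat \<Rightarrow> poly3) \<Rightarrow> nat" where
  "max_mult d L = Max (multiplicity_at d L ` curve (arrangement_poly d L))"

text \<open>
  The value does not depend on the choice of the point of maximal multiplicity that is removed.
\<close>

definition second_mult :: "nat \<Rightarrow> (nat \<Rightarrow> poly3) \<Rightarrow> nat" where
  "second_mult d L =
     (let p = (SOME p. p \<in> curve (arrangement_poly d L) \<and> multiplicity_at d L p = max_mult d L)
      in Max (multiplicity_at d L ` (curve (arrangement_poly d L) - {p})))"

end

theory Submission
  imports Defs
begin

text \<open>
  Let \<open>n\<^sub>p\<close> be the number of lines through a point \<open>p\<close> and let \<open>T\<close> be the sum of
  \<open>(n\<^sub>p - 1)\<^sup>2\<close> over the singular points, which is at most the global Tjurina number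
  (\<open>tjurina_number_ge\<close>).  The proof bounds the dimension of one vector space from both sides: the
  space \<open>D\<close> of polynomial vector fields of degree \<open>d - 3\<close> that are tangent to all \<open>d\<close> lines.

  From above: restrict a tangent field to one of the lines \<open>H\<close>.  A field that vanishes on \<open>H\<close> is
  the product of the equation of \<open>H\<close> with a field that is tangent to the other lines, and a count
  of zeros on \<open>H\<close> bounds the number of linear conditions that force a field to vanish there.  Induction
  on the number of lines gives \<open>dim D \<le> T - (2 * d - 3)\<close> (\<open>tangent_fields_add_line\<close>,
  \<open>sum_mult_add_line\<close>, \<open>tangent_fields_bound\<close>).

  From below: \<open>D\<close> contains the multiples of the Euler field and of two Jacobian syzygies.  One has
  the minimal degree \<open>r\<close>.  The other belongs to a point \<open>Q\<close>: if \<open>n\<close> lines pass through \<open>Q\<close>, the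
  derivative in the direction of \<open>Q\<close>, multiplied by the product of the \<open>d - n\<close> lines that avoid \<open>Q\<close>,
  becomes a syzygy of degree \<open>d - n\<close> after subtraction of a multiple of the Euler field.  If these three
  fields are linearly independent, then
  \<open>dim D \<ge> ((d - 2) choose 2) + ((d - r - 1) choose 2) + ((n - 1) choose 2)\<close>
  (\<open>tangent_fields_dim_ge\<close>).  Saito's criterion (\<open>saito\<close>) turns the failure of freeness into \<open>n \<le> r\<close>.
  Together, the two estimates exceed the assertion by exactly \<open>r - n\<close> (\<open>tjurina_bound\<close>).

  Independence can fail only if \<open>r = d - n\<close> (\<open>det_small_syzygy_ne\<close>), which yields the second
  assertion at a point of maximal multiplicity \<open>m\<close>, and the first one as well when \<open>r \<noteq> d - m\<close>.  If
  \<open>r = d - m\<close>, the syzygy of that point is itself of minimal degree, and it is independent of the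
  syzygy of every other point (\<open>det_point_syzygy_ne\<close>), which yields the first assertion.
\<close>

section \<open>Ring homomorphisms out of the polynomial ring\<close>

definition rhom :: "('a::comm_ring_1 \<Rightarrow> 'b::comm_ring_1) \<Rightarrow> bool" where
  "rhom h \<longleftrightarrow> h 1 = 1 \<and> (\<forall>a b. h (a + b) = h a + h b) \<and> (\<forall>a b. h (a * b) = h a * h b)"

lemma rhomD:
  assumes "rhom h"
  shows "h 1 = 1" "h (a + b) = h a + h b" "h (a * b) = h a * h b" "h 0 = 0" "h (- a) = - h a"
    "h (a - b) = h a - h b" "h (a ^ n) = h a ^ n" "h (sum u A) = (\<Sum>i\<in>A. h (u i))"
    "h (prod u A) = (\<Prod>i\<in>A. h (u i))"
proof -
  show 1: "h 1 = 1" and add: "\<And>a b. h (a + b) = h a + h b" and mult: "\<And>a b. h (a * b) = h a * h b"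
    using assms by (auto simp: rhom_def)
  show 0: "h 0 = 0" using add [of 0 0] by simp
  show minus: "\<And>a. h (- a) = - h a" using add [of "- a" a for a] 0
    by (metis add.right_inverse add_eq_0_iff2)
  show "h (a - b) = h a - h b" using add [of a "- b"] minus by simp
  show "h (a ^ n) = h a ^ n" by (induction n) (simp_all add: 1 mult)
  show "h (sum u A) = (\<Sum>i\<in>A. h (u i))" by (induction A rule: infinite_finite_induct) (simp_all add: 0 add)
  show "h (prod u A) = (\<Prod>i\<in>A. h (u i))" by (induction A rule: infinite_finite_induct) (simp_all add: 1 mult)
qed

lemma rhom_comp: "rhom g \<Longrightarrow> rhom h \<Longrightarrow> rhom (\<lambda>x. g (h x))"
  by (simp add: rhom_def)

lemma rhom_poly_map_poly:
  assumes h: "rhom h"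
  shows "rhom (\<lambda>p. poly (map_poly h p) c)"
proof -
  note [simp] = rhomD [OF h]
  have add: "map_poly h (p + q) = map_poly h p + map_poly h q" for p q
    by (rule poly_eqI) (simp add: coeff_map_poly)
  have smult: "map_poly h (smult a p) = smult (h a) (map_poly h p)" for a p
    by (rule poly_eqI) (simp add: coeff_map_poly)
  have pCons: "map_poly h (pCons a p) = pCons (h a) (map_poly h p)" for a p
    by (rule poly_eqI) (simp add: coeff_map_poly coeff_pCons split: nat.splits)
  have "map_poly h (p * q) = map_poly h p * map_poly h q" for p q
    by (induction p) (simp_all add: add smult pCons)
  then show ?thesis using add by (simp add: rhom_def map_poly_1)
qed

lemma poly_map_poly_pCons:
  "h 0 = 0 \<Longrightarrow> poly (map_poly h (pCons a p)) c = h a + c * poly (map_poly h p) c"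
  by (cases "a = 0 \<and> p = 0") (auto simp: map_poly_pCons)

lemma rhom_subst3:
  assumes "rhom \<kappa>"
  shows "rhom (\<lambda>f. subst3 \<kappa> f a b c)"
  unfolding subst3_def by (intro rhom_poly_map_poly assms)

definition C3 :: "complex \<Rightarrow> poly3" where "C3 c = [:[:[:c:]:]:]"
definition X3 :: poly3 where "X3 = [:0, 1:]"
definition Y3 :: poly3 where "Y3 = [:[:0, 1:]:]"
definition Z3 :: poly3 where "Z3 = [:[:[:0, 1:]:]:]"

lemma rhom_C3: "rhom C3"
  by (simp add: rhom_def C3_def one_pCons)

lemma C3_eq_0_iff [simp]: "C3 a = 0 \<longleftrightarrow> a = 0"
  by (simp add: C3_def)

lemma subst3_simps:
  assumes "rhom \<kappa>"
  shows "subst3 \<kappa> (C3 t) a b c = \<kappa> t" "subst3 \<kappa> X3 a b c = a" "subst3 \<kappa> Y3 a b c = b"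
    "subst3 \<kappa> Z3 a b c = c"
proof -
  note [simp] = rhomD [OF assms]
  have 2: "rhom (\<lambda>q. poly (map_poly \<kappa> q) c)" by (intro rhom_poly_map_poly assms)
  have 3: "rhom (\<lambda>p. poly (map_poly (\<lambda>q. poly (map_poly \<kappa> q) c) p) b)"
    by (intro rhom_poly_map_poly 2)
  note [simp] = rhomD(1,4) [OF 2] rhomD(1,4) [OF 3]
  show "subst3 \<kappa> (C3 t) a b c = \<kappa> t" "subst3 \<kappa> X3 a b c = a" "subst3 \<kappa> Y3 a b c = b"
    "subst3 \<kappa> Z3 a b c = c"
    by (simp_all add: subst3_def C3_def X3_def Y3_def Z3_def poly_map_poly_pCons)
qed

lemma poly_hom_eqI:
  assumes h: "rhom h" "rhom g" and c: "\<And>a. h [:a:] = g [:a:]" and x: "h [:0, 1:] = g [:0, 1:]"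
  shows "h p = g p"
proof (induction p)
  case 0 then show ?case using c [of 0] by simp
next
  case (pCons a p)
  have e: "pCons a p = [:a:] + [:0, 1:] * p" by simp
  show ?case unfolding e rhomD(2,3) [OF h(1)] rhomD(2,3) [OF h(2)] by (simp only: pCons c x)
qed

text \<open>
  All identities between substitutions below are instances of this; none of them is computed on
  coefficients.
\<close>

lemma poly3_hom_eqI:
  assumes h: "rhom h" "rhom g" and c: "\<And>a. h (C3 a) = g (C3 a)"
    and "h X3 = g X3" "h Y3 = g Y3" "h Z3 = g Z3"
  shows "h p = g p"
proof -
  have e: "rhom (\<lambda>q::complex poly. [:q:])" "rhom (\<lambda>q::complex poly poly. [:q:])"
    by (simp_all add: rhom_def one_pCons)
  have 1: "h [:[:q:]:] = g [:[:q:]:]" for q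
  proof (rule poly_hom_eqI [where h = "\<lambda>q. h [:[:q:]:]" and g = "\<lambda>q. g [:[:q:]:]"])
    show "rhom (\<lambda>q. h [:[:q:]:])" "rhom (\<lambda>q. g [:[:q:]:])"
      by (rule rhom_comp [OF _ rhom_comp [OF e(2) e(1)]], fact)+
  qed (use assms in \<open>simp_all only: C3_def Z3_def\<close>)
  have 2: "h [:q:] = g [:q:]" for q
  proof (rule poly_hom_eqI [where h = "\<lambda>q. h [:q:]" and g = "\<lambda>q. g [:q:]"])
    show "rhom (\<lambda>q. h [:q:])" "rhom (\<lambda>q. g [:q:])"
      by (rule rhom_comp [OF _ e(2)], fact)+
  qed (use assms 1 in \<open>simp_all only: Y3_def\<close>)
  show ?thesis using h by (rule poly_hom_eqI) (use assms 2 in \<open>simp_all only: X3_def\<close>)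
qed

lemma rhom_id: "rhom (\<lambda>x. x)" by (simp add: rhom_def)

lemma rhom_const_poly: "rhom (\<lambda>c::'a::comm_ring_1. [:c:])"
  by (simp add: rhom_def one_pCons)

lemma subst3_C3_id: "subst3 C3 f X3 Y3 Z3 = f"
  by (rule poly3_hom_eqI [OF rhom_subst3 [OF rhom_C3] rhom_id]) (simp_all add: subst3_simps rhom_C3)


section \<open>Vectors with three entries\<close>

fun smul :: "'a::comm_ring_1 \<Rightarrow> 'a \<times> 'a \<times> 'a \<Rightarrow> 'a \<times> 'a \<times> 'a" where
  "smul s (a, b, c) = (s * a, s * b, s * c)"

fun dot :: "'a::comm_ring_1 \<times> 'a \<times> 'a \<Rightarrow> 'a \<times> 'a \<times> 'a \<Rightarrow> 'a" where
  "dot (a, b, c) (x, y, z) = a * x + b * y + c * z"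

fun cross :: "'a::comm_ring_1 \<times> 'a \<times> 'a \<Rightarrow> 'a \<times> 'a \<times> 'a \<Rightarrow> 'a \<times> 'a \<times> 'a" where
  "cross (a, b, c) (x, y, z) = (b * z - c * y, c * x - a * z, a * y - b * x)"

definition det3 where "det3 u v w = dot u (cross v w)"

fun vmap :: "('a \<Rightarrow> 'b) \<Rightarrow> 'a \<times> 'a \<times> 'a \<Rightarrow> 'b \<times> 'b \<times> 'b" where
  "vmap h (a, b, c) = (h a, h b, h c)"

lemma vmap_hom:
  assumes "rhom h"
  shows "h (dot u v) = dot (vmap h u) (vmap h v)" "vmap h (cross u v) = cross (vmap h u) (vmap h v)"
    "h (det3 u v w) = det3 (vmap h u) (vmap h v) (vmap h w)"
    "vmap h (smul s u) = smul (h s) (vmap h u)" "vmap h (u + v) = vmap h u + vmap h v"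
    "vmap h (u - v) = vmap h u - vmap h v"
  by (cases u; cases v; cases w; simp add: det3_def rhomD [OF assms])+

lemma zero_triple: "(0::'a::comm_ring_1 \<times> 'a \<times> 'a) = (0, 0, 0)" by (simp add: zero_prod_def)

lemma smul_zero [simp]: "smul 0 v = 0" "smul s 0 = 0"
  by (cases v) (simp_all add: zero_triple)

lemma dot_linear:
  "dot (u + v) w = dot u w + dot v w" "dot (smul s u) w = s * dot u w"
  "dot (u - v) w = dot u w - dot v w" "dot (0::'a::comm_ring_1 \<times> 'a \<times> 'a) w = 0"
  "dot w (u + v) = dot w u + dot w v" "dot w (smul s u) = s * dot w u"
  "dot w (u - v) = dot w u - dot w v" "dot w 0 = 0"
  by (cases u; cases v; cases w; simp add: algebra_simps zero_triple)+

lemma det3_linear: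
  "det3 (u + u') v w = det3 u v w + det3 u' v w" "det3 (smul s u) v w = s * det3 u v w"
  "det3 u (v + v') w = det3 u v w + det3 u v' w" "det3 u (smul s v) w = s * det3 u v w"
  "det3 u v (w + w') = det3 u v w + det3 u v w'" "det3 u v (smul s w) = s * det3 u v w"
  "det3 (u - u') v w = det3 u v w - det3 u' v w" "det3 u (v - v') w = det3 u v w - det3 u v' w"
  "det3 u v (w - w') = det3 u v w - det3 u v w'"
  "det3 u u w = 0" "det3 u v u = 0" "det3 v u u = 0"
  by (cases u; cases v; cases w; cases u'; cases v'; cases w'; simp add: det3_def algebra_simps)+

lemma smul_eq_0_iff: "smul (s::'a::idom) v = 0 \<longleftrightarrow> s = 0 \<or> v = 0"
  by (cases v) (auto simp: zero_triple)

lemma cramer: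
  "smul (det3 u v w) x = smul (det3 x v w) u + smul (det3 u x w) v + smul (det3 u v x) w"
  by (cases u; cases v; cases w; cases x; simp add: det3_def algebra_simps)

text \<open>
  Cramer's rule for a linear form \<open>l\<close>.  It makes the determinant divisible by whatever divides the
  three values of \<open>l\<close>, and it relates the cross products when the determinant vanishes.
\<close>

lemma dual_cramer:
  "smul (dot l u) (cross v w) + smul (dot l v) (cross w u) + smul (dot l w) (cross u v)
    = smul (det3 u v w) l"
  by (cases u; cases v; cases w; cases l; simp add: det3_def algebra_simps)

lemma det3_cyclic: "det3 u v w = det3 v w u"
  by (cases u; cases v; cases w; simp add: det3_def algebra_simps)

lemma det3_eq_dot_cross: "det3 u v w = dot (cross u v) w" "det3 u v w = dot u (cross v w)"
  by (cases u; cases v; cases w; simp add: det3_def algebra_simps)+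

lemma cross_cross: "cross g (cross u v) = smul (dot v g) u - smul (dot u g) v"
  by (cases g; cases u; cases v; simp add: algebra_simps)

lemma dot_commute: "dot u v = dot v u"
  by (cases u; cases v; simp add: mult.commute)

lemma smul_add_left: "smul (s + t) v = smul s v + smul t v"
  by (cases v) (simp add: algebra_simps)

lemma smul_sum: "smul (sum u A) v = (\<Sum>i\<in>A. smul (u i) v)"
  by (induction A rule: infinite_finite_induct) (simp_all add: smul_add_left)

lemma cross_cross_left: "cross (cross u v) g = smul (dot g u) v - smul (dot g v) u"
  by (cases g; cases u; cases v; simp add: algebra_simps)

lemma dot_cross_self: "dot (cross u v) u = 0" "dot (cross u v) v = 0"
  by (cases u; cases v; simp add: algebra_simps)+

lemma cross_eq_0_imp_proportional:
  fixes u v :: "complex \<times> complex \<times> complex"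
  assumes "cross u v = 0" "v \<noteq> 0"
  shows "\<exists>c. u = smul c v"
proof -
  obtain a b c x y z where [simp]: "u = (a, b, c)" "v = (x, y, z)" by (cases u; cases v)
  from assms have *: "b * z = c * y" "c * x = a * z" "a * y = b * x" and "x \<noteq> 0 \<or> y \<noteq> 0 \<or> z \<noteq> 0"
    by (auto simp: zero_triple)
  then consider "x \<noteq> 0" | "y \<noteq> 0" | "z \<noteq> 0" by blast
  then show ?thesis
  proof cases
    case 1 then show ?thesis using * by (intro exI [of _ "a / x"]) (auto simp: field_simps)
  next
    case 2 then show ?thesis using * by (intro exI [of _ "b / y"]) (auto simp: field_simps)
  next
    case 3 then show ?thesis using * by (intro exI [of _ "c / z"]) (auto simp: field_simps)
  qed
qed

lemma cross_self [simp]: "cross u u = 0" and cross_smul: "cross (smul c u) v = smul c (cross u v)"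
  "cross u (smul c v) = smul c (cross u v)"
  by (cases u; cases v; simp add: zero_triple algebra_simps)+

lemma exists_cross_eq:
  fixes l :: "complex \<times> complex \<times> complex"
  assumes "l \<noteq> 0"
  shows "\<exists>a b. cross a b = l"
proof -
  obtain x y z where [simp]: "l = (x, y, z)" by (cases l)
  from assms consider "x \<noteq> 0" | "y \<noteq> 0" | "z \<noteq> 0" by (auto simp: zero_triple)
  then show ?thesis
  proof cases
    case 1 then show ?thesis
      by (intro exI [of _ "(- y / x, 1, 0)"] exI [of _ "(- z, 0, x)"]) simp
  next
    case 2 then show ?thesis
      by (intro exI [of _ "(0, - z / y, 1)"] exI [of _ "(y, - x, 0)"]) simp
  next
    case 3 then show ?thesis
      by (intro exI [of _ "(1, 0, - x / z)"] exI [of _ "(0, z, - y)"]) simp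
  qed
qed

lemma exists_dot_eq_1:
  fixes l :: "complex \<times> complex \<times> complex"
  assumes "l \<noteq> 0"
  shows "\<exists>e. dot l e = 1"
proof -
  obtain x y z where [simp]: "l = (x, y, z)" by (cases l)
  from assms consider "x \<noteq> 0" | "y \<noteq> 0" | "z \<noteq> 0" by (auto simp: zero_triple)
  then show ?thesis
  proof cases
    case 1 then show ?thesis by (intro exI [of _ "(1 / x, 0, 0)"]) simp
  next
    case 2 then show ?thesis by (intro exI [of _ "(0, 1 / y, 0)"]) simp
  next
    case 3 then show ?thesis by (intro exI [of _ "(0, 0, 1 / z)"]) simp
  qed
qed


section \<open>Evaluation at points\<close>

fun ev :: "complex \<times> complex \<times> complex \<Rightarrow> poly3 \<Rightarrow> complex" where
  "ev (a, b, c) f = subst3 (\<lambda>u. u) f a b c"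

declare ev.simps [simp del]

lemma rhom_ev: "rhom (ev P)"
proof (cases P)
  case (fields a b c)
  then have "ev P = (\<lambda>f. subst3 (\<lambda>u. u) f a b c)" by (auto simp: ev.simps)
  then show ?thesis by (simp add: rhom_subst3 [OF rhom_id])
qed

lemmas ev_hom [simp] = rhomD [OF rhom_ev]

lemma ev_C3 [simp]: "ev P (C3 c) = c"
  by (cases P) (simp add: ev.simps subst3_simps rhom_id)

definition Evec :: triple where "Evec = (X3, Y3, Z3)"

lemma ev_vars [simp]: "vmap (ev P) Evec = P" "vmap (ev P) (vmap C3 Q) = Q"
  by (cases P; cases Q; simp add: Evec_def ev.simps subst3_simps rhom_id)+

text \<open>
  A univariate polynomial over an infinite domain with all values zero is zero; this is applied to a
  leading coefficient in each variable in turn.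
\<close>

lemma eq_0_if_ev_eq_0:
  assumes "\<And>P. ev P f = 0"
  shows "f = 0"
proof (rule ccontr)
  assume "f \<noteq> 0"
  have 1: "rhom (\<lambda>q::complex poly. poly q c)" for c by (simp add: rhom_def)
  have 2: "rhom (\<lambda>p::complex poly poly. poly (map_poly (\<lambda>q. poly q c) p) b)" for b c
    by (intro rhom_poly_map_poly 1)
  have e: "ev (a, b, c) f = poly (map_poly (\<lambda>p. poly (map_poly (\<lambda>q. poly q c) p) b) f) a" for a b c
    by (simp add: ev.simps subst3_def map_poly_id')
  define i where "i = degree f"
  have "coeff f i \<noteq> 0" using \<open>f \<noteq> 0\<close> by (simp add: i_def)
  then obtain j where "coeff (coeff f i) j \<noteq> 0" by (auto simp: poly_eq_iff)
  then obtain c where "poly (coeff (coeff f i) j) c \<noteq> 0" using poly_all_0_iff_0 by blast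
  then have "coeff (map_poly (\<lambda>q. poly q c) (coeff f i)) j \<noteq> 0" by (simp add: coeff_map_poly)
  then have "map_poly (\<lambda>q. poly q c) (coeff f i) \<noteq> 0" by fastforce
  then obtain b where b: "poly (map_poly (\<lambda>q. poly q c) (coeff f i)) b \<noteq> 0"
    using poly_all_0_iff_0 by blast
  have "coeff (map_poly (\<lambda>p. poly (map_poly (\<lambda>q. poly q c) p) b) f) i \<noteq> 0"
    using b by (simp add: coeff_map_poly)
  then have "map_poly (\<lambda>p. poly (map_poly (\<lambda>q. poly q c) p) b) f \<noteq> 0" by fastforce
  then obtain a where "poly (map_poly (\<lambda>p. poly (map_poly (\<lambda>q. poly q c) p) b) f) a \<noteq> 0"
    using poly_all_0_iff_0 by blast
  with e assms show False by metis
qed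


section \<open>Linear forms\<close>

definition lin :: "complex \<times> complex \<times> complex \<Rightarrow> poly3" where
  "lin l = dot (vmap C3 l) Evec"

lemma ev_lin [simp]: "ev P (lin l) = dot l P"
  by (simp add: lin_def vmap_hom [OF rhom_ev])

lemma lin_eq_0_iff: "lin l = 0 \<longleftrightarrow> l = 0"
proof
  assume "lin l = 0"
  then have "dot l e = 0" for e using ev_lin [of e l] by simp
  then show "l = 0" using exists_dot_eq_1 by fastforce
qed (simp add: lin_def zero_triple Evec_def rhomD [OF rhom_C3])

text \<open>
  Substitution of the projection along a vector \<open>e\<close> with \<open>l(e) = 1\<close> onto the plane
  \<open>l = 0\<close>.  Its kernel consists of the multiples of \<open>l\<close>; as the target is a domain, this shows
  that \<open>l\<close> is prime.
\<close>

definition plane_proj where "plane_proj l = Evec - smul (lin l) (vmap C3 (SOME e. dot l e = 1))"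

definition restr :: "complex \<times> complex \<times> complex \<Rightarrow> poly3 \<Rightarrow> poly3" where
  "restr l f = (case plane_proj l of (a, b, c) \<Rightarrow> subst3 C3 f a b c)"

lemma rhom_restr: "rhom (restr l)"
  unfolding restr_def by (cases "plane_proj l") (simp add: rhom_subst3 rhom_C3)

lemma ev_subst3: "ev P (subst3 C3 f a b c) = ev (vmap (ev P) (a, b, c)) f"
proof (rule poly3_hom_eqI [where h = "\<lambda>f. ev P (subst3 C3 f a b c)" and g = "ev (vmap (ev P) (a, b, c))"])
  show "rhom (\<lambda>f. ev P (subst3 C3 f a b c))" by (intro rhom_comp [OF rhom_ev] rhom_subst3 rhom_C3)
qed (rule rhom_ev, simp_all add: subst3_simps rhom_C3, simp_all add: ev.simps subst3_simps rhom_id)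

lemma ev_restr_eq: "ev P (restr l f) = ev (vmap (ev P) (plane_proj l)) f"
  by (cases "plane_proj l") (simp add: restr_def ev_subst3)

lemma ev_restr_proj:
  assumes "l \<noteq> 0"
  shows "\<exists>Q. dot l Q = 0 \<and> ev P (restr l f) = ev Q f"
proof -
  have "dot l (vmap (ev P) (plane_proj l)) = 0"
    using someI_ex [OF exists_dot_eq_1 [OF assms]]
    unfolding plane_proj_def by (simp add: vmap_hom [OF rhom_ev] dot_linear)
  then show ?thesis by (metis ev_restr_eq)
qed

text \<open>
  The substituted linear forms are congruent to the variables modulo \<open>l\<close>, and substitution respects
  congruences.
\<close>

lemma lin_dvd_diff_restr: "lin l dvd f - restr l f"
proof -
  obtain a b c where abc: "plane_proj l = (a, b, c)" by (cases "plane_proj l")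
  obtain e1 e2 e3 where "(SOME e. dot l e = 1) = (e1, e2, e3)" by (cases "SOME e. dot l e = 1")
  with abc have "a = X3 - lin l * C3 e1" "b = Y3 - lin l * C3 e2" "c = Z3 - lin l * C3 e3"
    by (auto simp: plane_proj_def Evec_def)
  then have "lin l dvd X3 - a" "lin l dvd Y3 - b" "lin l dvd Z3 - c" by simp_all
  moreover have "lin l dvd subst3 C3 f X Y Z - subst3 C3 f X' Y' Z'"
    if d: "lin l dvd X - X'" "lin l dvd Y - Y'" "lin l dvd Z - Z'" for X Y Z X' Y' Z'
  proof -
    have mult: "lin l dvd u * v - u' * v'" if "lin l dvd u - u'" "lin l dvd v - v'" for u v u' v'
    proof -
      have "u * v - u' * v' = u * (v - v') + (u - u') * v'" by (simp add: algebra_simps)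
      then show ?thesis using that by simp
    qed
    have pow: "lin l dvd u ^ n - u' ^ n" if "lin l dvd u - u'" for u u' n
      by (induction n) (use that in \<open>auto intro: mult\<close>)
    have sm: "lin l dvd sum u A - sum u' A" if "\<And>i. lin l dvd u i - u' i"
      for u u' and A :: "nat set"
      by (simp add: sum_subtractf [symmetric] dvd_sum that)
    show ?thesis unfolding subst3_eq_sum [of C3, OF rhomD(4) [OF rhom_C3]]
      using d by (intro sm mult pow) auto
  qed
  ultimately show ?thesis using subst3_C3_id [of f] by (metis abc case_prod_conv restr_def)
qed

lemma lin_dvd_iff:
  assumes "l \<noteq> 0"
  shows "lin l dvd f \<longleftrightarrow> restr l f = 0"
proof
  assume "restr l f = 0"
  then show "lin l dvd f" using lin_dvd_diff_restr [of l f] by simp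
next
  assume "lin l dvd f"
  then obtain g where g: "f = lin l * g" ..
  show "restr l f = 0"
  proof (rule eq_0_if_ev_eq_0)
    fix P
    obtain Q where "dot l Q = 0" "ev P (restr l f) = ev Q f" using ev_restr_proj [OF assms] by blast
    then show "ev P (restr l f) = 0" by (simp add: g)
  qed
qed

lemma lin_dvd_if_vanishes:
  assumes "l \<noteq> 0" "\<And>P. dot l P = 0 \<Longrightarrow> ev P f = 0"
  shows "lin l dvd f"
  using assms ev_restr_proj [OF assms(1)] by (metis eq_0_if_ev_eq_0 lin_dvd_iff)

lemma ev_eq_0_if_lin_dvd: "lin l dvd f \<Longrightarrow> dot l P = 0 \<Longrightarrow> ev P f = 0"
  by (auto elim!: dvdE)

lemma lin_dvd_mult_iff:
  assumes "l \<noteq> 0"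
  shows "lin l dvd f * g \<longleftrightarrow> lin l dvd f \<or> lin l dvd g"
  using assms by (simp add: lin_dvd_iff rhomD [OF rhom_restr])

lemma lin_dvd_lin_iff:
  assumes "l \<noteq> 0"
  shows "lin l dvd lin m \<longleftrightarrow> cross l m = 0"
proof
  assume *: "lin l dvd lin m"
  obtain a b where ab: "cross a b = l" using exists_cross_eq [OF assms] by blast
  have "dot l a = 0" "dot l b = 0" unfolding ab [symmetric] by (rule dot_cross_self)+
  then have "dot m a = 0" "dot m b = 0" using ev_eq_0_if_lin_dvd [OF *] by simp_all
  then show "cross l m = 0" using cross_cross_left [of a b m] by (simp add: ab)
next
  assume "cross l m = 0"
  then have "cross m l = 0" by (cases l; cases m; simp add: zero_triple mult.commute)
  then obtain c where "m = smul c l" using cross_eq_0_imp_proportional assms by blast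
  then have "lin m = C3 c * lin l"
    by (cases l; simp add: lin_def Evec_def rhomD [OF rhom_C3] algebra_simps)
  then show "lin l dvd lin m" by simp
qed

lemma lin_not_dvd_prod:
  fixes \<nu> :: "nat \<Rightarrow> complex \<times> complex \<times> complex"
  assumes "l \<noteq> 0" "finite B" "\<And>i. i \<in> B \<Longrightarrow> cross l (\<nu> i) \<noteq> 0"
  shows "\<not> lin l dvd (\<Prod>i\<in>B. lin (\<nu> i))"
  using assms(2,3)
proof (induction B rule: finite_induct)
  case empty
  show ?case using lin_dvd_iff [OF assms(1), of 1] rhomD(1) [OF rhom_restr] by simp
next
  case (insert i B)
  then show ?case using assms(1) by (simp add: lin_dvd_mult_iff lin_dvd_lin_iff)
qed

text \<open>
  Pairwise non-proportional linear forms are non-associated primes.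
\<close>

lemma prod_lin_dvd:
  fixes \<nu> :: "nat \<Rightarrow> complex \<times> complex \<times> complex"
  assumes "finite A" "\<And>i. i \<in> A \<Longrightarrow> \<nu> i \<noteq> 0"
    and "\<And>i j. i \<in> A \<Longrightarrow> j \<in> A \<Longrightarrow> i \<noteq> j \<Longrightarrow> cross (\<nu> i) (\<nu> j) \<noteq> 0"
    and "\<And>i. i \<in> A \<Longrightarrow> lin (\<nu> i) dvd f"
  shows "(\<Prod>i\<in>A. lin (\<nu> i)) dvd f"
  using assms
proof (induction A)
  case (insert j A)
  then obtain g where g: "f = (\<Prod>i\<in>A. lin (\<nu> i)) * g" by (auto elim!: dvdE)
  have nj: "\<nu> j \<noteq> 0" using insert by auto
  have "\<not> lin (\<nu> j) dvd (\<Prod>i\<in>A. lin (\<nu> i))"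
    using nj insert by (intro lin_not_dvd_prod) auto
  then have "lin (\<nu> j) dvd g" using insert.prems(3) [of j] nj by (auto simp: g lin_dvd_mult_iff)
  then show ?case using insert.hyps by (auto simp: g mult.commute intro: mult_dvd_mono)
qed simp

section \<open>Derivations\<close>

definition derivation :: "('a::comm_ring_1 \<Rightarrow> 'a) \<Rightarrow> bool" where
  "derivation \<delta> \<longleftrightarrow> (\<forall>p q. \<delta> (p + q) = \<delta> p + \<delta> q) \<and> (\<forall>p q. \<delta> (p * q) = p * \<delta> q + q * \<delta> p)"

lemma derivationD:
  assumes "derivation \<delta>"
  shows "\<delta> (p + q) = \<delta> p + \<delta> q" "\<delta> (p * q) = p * \<delta> q + q * \<delta> p" "\<delta> 0 = 0" "\<delta> 1 = 0"
    "\<delta> (sum u A) = (\<Sum>i\<in>A. \<delta> (u i))"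
proof -
  show add: "\<And>p q. \<delta> (p + q) = \<delta> p + \<delta> q" and mult: "\<And>p q. \<delta> (p * q) = p * \<delta> q + q * \<delta> p"
    using assms by (auto simp: derivation_def)
  show 0: "\<delta> 0 = 0" using add [of 0 0] by simp
  show "\<delta> 1 = 0" using mult [of 1 1] by simp
  show "\<delta> (sum u A) = (\<Sum>i\<in>A. \<delta> (u i))"
    by (induction A rule: infinite_finite_induct) (simp_all add: 0 add)
qed

lemma derivation_prod:
  assumes "derivation \<delta>" "finite A"
  shows "\<delta> (\<Prod>i\<in>A. u i) = (\<Sum>i\<in>A. \<delta> (u i) * (\<Prod>j\<in>A - {i}. u j))"
  using assms(2)
proof (induction A)
  case (insert k A)
  have "(\<Prod>j\<in>insert k A - {i}. u j) = u k * (\<Prod>j\<in>A - {i}. u j)" if "i \<in> A" for i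
  proof -
    have "insert k A - {i} = insert k (A - {i})" using that insert by auto
    then show ?thesis using insert by simp
  qed
  then have "(\<Sum>i\<in>A. \<delta> (u i) * (\<Prod>j\<in>insert k A - {i}. u j)) =
      u k * (\<Sum>i\<in>A. \<delta> (u i) * (\<Prod>j\<in>A - {i}. u j))"
    by (simp add: sum_distrib_left mult_ac)
  then show ?case using insert
    by (simp add: derivationD [OF assms(1)] mult_ac)
qed (simp add: derivationD [OF assms(1)])

lemma derivation_pderiv: "derivation (pderiv :: 'a::idom poly \<Rightarrow> _)"
  by (simp add: derivation_def pderiv_add pderiv_mult)

text \<open>
  Applied to \<open>pderiv\<close>, this covers the derivatives with respect to the inner variables.
\<close>

lemma derivation_map_poly:
  assumes "derivation \<delta>"
  shows "derivation (map_poly \<delta>)"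
  unfolding derivation_def
proof (intro conjI allI poly_eqI)
  fix p q :: "'a poly" and n
  note [simp] = derivationD [OF assms] coeff_map_poly
  show "coeff (map_poly \<delta> (p + q)) n = coeff (map_poly \<delta> p + map_poly \<delta> q) n" by simp
  have "coeff (map_poly \<delta> (p * q)) n = coeff (p * map_poly \<delta> q + map_poly \<delta> p * q) n"
    unfolding coeff_add coeff_mult by (simp add: coeff_mult sum.distrib mult.commute [of "coeff q _"])
  then show "coeff (map_poly \<delta> (p * q)) n = coeff (p * map_poly \<delta> q + q * map_poly \<delta> p) n"
    by (simp only: mult.commute [of q])
qed


section \<open>Polynomials in two variables\<close>

abbreviation c2 :: "poly2 \<Rightarrow> nat \<Rightarrow> nat \<Rightarrow> complex" where
  "c2 p i j \<equiv> coeff (coeff p i) j"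

lemma c2_mult: "c2 (p * q) i j = (\<Sum>(a, b)\<in>{..i} \<times> {..j}. c2 p a b * c2 q (i - a) (j - b))"
  by (simp add: coeff_mult coeff_sum sum.cartesian_product)

lemma poly2_eqI: "(\<And>i j. c2 p i j = c2 q i j) \<Longrightarrow> p = q"
  by (intro poly_eqI) 

definition ordge :: "nat \<Rightarrow> poly2 \<Rightarrow> bool" where
  "ordge K p \<longleftrightarrow> (\<forall>i j. i + j < K \<longrightarrow> c2 p i j = 0)"

definition deglt :: "nat \<Rightarrow> poly2 \<Rightarrow> bool" where
  "deglt K p \<longleftrightarrow> (\<forall>i j. K \<le> i + j \<longrightarrow> c2 p i j = 0)"

definition hom2 :: "nat \<Rightarrow> poly2 \<Rightarrow> bool" where
  "hom2 N p \<longleftrightarrow> (\<forall>i j. i + j \<noteq> N \<longrightarrow> c2 p i j = 0)"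

definition mon2 :: "nat \<Rightarrow> nat \<Rightarrow> poly2" where
  "mon2 a b = monom (monom 1 b) a"

lemma ordge_mult:
  assumes "ordge K p" "ordge M q"
  shows "ordge (K + M) (p * q)"
  unfolding ordge_def
proof (intro allI impI)
  fix i j assume ij: "i + j < K + M"
  have "c2 p a b * c2 q (i - a) (j - b) = 0" if "a \<le> i" "b \<le> j" for a b
  proof (cases "a + b < K")
    case False
    then have "(i - a) + (j - b) < M" using ij that by linarith
    then show ?thesis using assms(2) by (simp add: ordge_def)
  qed (use assms(1) in \<open>simp add: ordge_def\<close>)
  then show "c2 (p * q) i j = 0" unfolding c2_mult by (intro sum.neutral) auto
qed

lemma hom2_mult:
  assumes "hom2 K p" "hom2 M q"
  shows "hom2 (K + M) (p * q)"
  unfolding hom2_def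
proof (intro allI impI)
  fix i j assume ij: "i + j \<noteq> K + M"
  have "c2 p a b * c2 q (i - a) (j - b) = 0" if "a \<le> i" "b \<le> j" for a b
  proof (cases "a + b = K")
    case True
    then have "(i - a) + (j - b) \<noteq> M" using ij that by linarith
    then show ?thesis using assms(2) by (simp add: hom2_def)
  qed (use assms(1) in \<open>simp add: hom2_def\<close>)
  then show "c2 (p * q) i j = 0" unfolding c2_mult by (intro sum.neutral) auto
qed

text \<open>
  Multiplication by a unit of the local ring multiplies the terms of lowest degree by a nonzero
  constant.
\<close>

lemma ordge_cancel:
  assumes "ordge K (p * b)" "c2 b 0 0 \<noteq> 0"
  shows "ordge K p"
proof -
  have "c2 p i j = 0" if "i + j < K" for i j
    using that
  proof (induction "i + j" arbitrary: i j rule: less_induct)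
    case less
    have "c2 p x y * c2 b (i - x) (j - y) = 0"
      if "x \<le> i" "y \<le> j" "(x, y) \<noteq> (i, j)" for x y
      using less(1) [of x y] less(2) that by (cases "x + y < i + j") auto
    then have "c2 (p * b) i j = (\<Sum>(x, y)\<in>{(i, j)}. c2 p x y * c2 b (i - x) (j - y))"
      unfolding c2_mult by (intro sum.mono_neutral_right) fastforce+
    moreover have "c2 (p * b) i j = 0" using assms(1) less(2) by (simp add: ordge_def)
    ultimately show ?case using assms(2) by simp
  qed
  then show ?thesis by (simp add: ordge_def)
qed

lemma c2_mon2: "c2 (mon2 a b) i j = (if i = a \<and> j = b then 1 else 0)"
  by (auto simp: mon2_def)

lemma c2_const_mult: "c2 (const2 c * p) i j = c * c2 p i j"
  by (simp add: const2_def)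

lemma mon2_mult: "mon2 a b * mon2 c d = mon2 (a + c) (b + d)"
  by (simp add: mon2_def mult_monom)

lemma mon2_Suc: "mon2 (Suc a) b = var_s * mon2 a b" "mon2 a (Suc b) = var_t * mon2 a b"
  by (simp_all add: mon2_def var_s_def var_t_def monom_Suc smult_monom)

lemma mon2_0: "mon2 0 0 = 1" by (simp add: mon2_def)

lemma rhom_const2: "rhom const2" by (simp add: rhom_def const2_def one_pCons)

lemma hom2_mon2: "hom2 (a + b) (mon2 a b)"
  by (auto simp: hom2_def c2_mon2)

lemma finite_pairs_less [simp]: "finite {(i, j). i + j < (K::nat)}"
  by (rule finite_subset [of _ "{..<K} \<times> {..<K}"]) auto

lemma card_pairs_less: "2 * card {(i, j). i + j < (K::nat)} = K * (K + 1)"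
proof (induction K)
  case (Suc K)
  have "{(i, j). i + j < Suc K} = {(i, j). i + j < K} \<union> (\<lambda>i. (i, K - i)) ` {..K}"
    by (auto simp: image_iff)
  moreover have "{(i, j). i + j < K} \<inter> (\<lambda>i. (i, K - i)) ` {..K} = {}" by auto
  moreover have "card ((\<lambda>i. (i, K - i)) ` {..K}) = Suc K"
    by (subst card_image) (auto simp: inj_on_def)
  ultimately have "card {(i, j). i + j < Suc K} = card {(i, j). i + j < K} + Suc K"
    by (simp add: card_Un_disjoint)
  with Suc show ?case by simp
qed simp

lemma deglt_expand:
  assumes "deglt K p"
  shows "p = (\<Sum>(a, b)\<in>{(i, j). i + j < K}. const2 (c2 p a b) * mon2 a b)"
proof (rule poly2_eqI)
  fix i j
  let ?t = "\<lambda>(a, b). c2 p a b * (if i = a \<and> j = b then 1 else 0)"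
  have "c2 (\<Sum>(a, b)\<in>{(i, j). i + j < K}. const2 (c2 p a b) * mon2 a b) i j
      = (\<Sum>x\<in>{(i, j). i + j < K}. ?t x)"
    by (simp add: coeff_sum case_prod_unfold c2_const_mult c2_mon2)
  also have "\<dots> = (\<Sum>x\<in>{(i, j). i + j < K}. if x = (i, j) then c2 p i j else 0)"
    by (rule sum.cong) (auto split: if_splits)
  also have "\<dots> = c2 p i j" using assms by (simp add: deglt_def)
  finally show "c2 p i j = c2 (\<Sum>(a, b)\<in>{(i, j). i + j < K}. const2 (c2 p a b) * mon2 a b) i j" ..
qed


section \<open>The local ring of the plane at the origin\<close>

text \<open>The powers of the maximal ideal.\<close>

definition max_power :: "nat \<Rightarrow> poly2 fract set" where
  "max_power K = {Fract a b |a b. ordge K a \<and> c2 b 0 0 \<noteq> 0}"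

lemma local_ring_eq: "local_ring = max_power 0"
  by (auto simp: local_ring_def max_power_def ordge_def poly_0_coeff_0)

lemma c2_00_mult: "c2 (a * b) 0 0 = c2 a 0 0 * c2 b 0 0"
  by (simp add: coeff_mult)

lemma max_power_mult: 
  assumes "u \<in> max_power K" "v \<in> max_power M"
  shows "u * v \<in> max_power (K + M)"
proof -
  obtain a b c d where "u = Fract a b" "ordge K a" "c2 b 0 0 \<noteq> 0" "v = Fract c d" "ordge M c" "c2 d 0 0 \<noteq> 0"
    using assms by (auto simp: max_power_def)
  then show ?thesis unfolding max_power_def
    by (intro CollectI exI [of _ "a * c"] exI [of _ "b * d"]) (auto simp: ordge_mult c2_00_mult)
qed

lemma ordge_add: "ordge K a \<Longrightarrow> ordge K b \<Longrightarrow> ordge K (a + b)"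
  by (simp add: ordge_def)

lemma ordge_0: "ordge 0 a" by (simp add: ordge_def)

lemma max_power_add:
  assumes "u \<in> max_power K" "v \<in> max_power K"
  shows "u + v \<in> max_power K"
proof -
  obtain a b c d where *: "u = Fract a b" "ordge K a" "c2 b 0 0 \<noteq> 0" "v = Fract c d" "ordge K c" "c2 d 0 0 \<noteq> 0"
    using assms by (auto simp: max_power_def)
  then have "b \<noteq> 0" "d \<noteq> 0" by auto
  with * show ?thesis unfolding max_power_def
    by (intro CollectI exI [of _ "a * d + c * b"] exI [of _ "b * d"])
      (use ordge_mult [of K _ 0] in \<open>auto simp: c2_00_mult ordge_0 intro!: ordge_add\<close>)
qed

lemma to_fract_in_max_power_iff: "to_fract p \<in> max_power K \<longleftrightarrow> ordge K p"
proof
  assume "to_fract p \<in> max_power K"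
  then obtain a b where *: "Fract p 1 = Fract a b" "ordge K a" "c2 b 0 0 \<noteq> 0"
    by (auto simp: max_power_def to_fract_def)
  then have "p * b = a" using eq_fract(1) [of 1 b p a] by force
  then show "ordge K p" using * ordge_cancel by metis
next
  assume "ordge K p"
  then show "to_fract p \<in> max_power K" unfolding max_power_def to_fract_def
    by (intro CollectI exI [of _ p] exI [of _ 1]) simp
qed

lemma local_ring_closed [simp, intro]:
  "u \<in> local_ring \<Longrightarrow> v \<in> local_ring \<Longrightarrow> u + v \<in> local_ring"
  "u \<in> local_ring \<Longrightarrow> v \<in> local_ring \<Longrightarrow> u * v \<in> local_ring"
  "to_fract p \<in> local_ring" "0 \<in> local_ring" "1 \<in> local_ring"
  using max_power_add [of u 0 v] max_power_mult [of u 0 v 0] to_fract_in_max_power_iff [of p 0]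
    to_fract_in_max_power_iff [of 0 0] to_fract_in_max_power_iff [of 1 0]
  by (simp_all add: local_ring_eq ordge_0)

lemma scale_fract_local [simp, intro]: "u \<in> local_ring \<Longrightarrow> scale_fract c u \<in> local_ring"
  by (simp add: scale_fract_def)

lemma subspace_local_ring: "rat_fun.subspace local_ring"
  by (rule rat_fun.subspaceI) auto

lemma scale_fract_max_power: "u \<in> max_power K \<Longrightarrow> scale_fract c u \<in> max_power K"
  using max_power_mult [of "to_fract (const2 c)" 0 u K]
  by (simp add: scale_fract_def to_fract_in_max_power_iff ordge_0)

lemma max_power_0: "0 \<in> max_power K"
  using to_fract_in_max_power_iff [of 0 K] by (simp add: ordge_def)

lemma inverse_in_local_ring:
  assumes "c2 b 0 0 \<noteq> 0"
  shows "\<exists>v\<in>local_ring. v * to_fract b = 1"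
proof (intro bexI)
  show "Fract 1 b \<in> local_ring" using assms
    by (auto simp: local_ring_eq max_power_def ordge_0)
  have "b \<noteq> 0" using assms by auto
  then show "Fract 1 b * to_fract b = 1"
    by (simp add: to_fract_def One_fract_def eq_fract)
qed

lemma local_ring_decompose:
  assumes "u \<in> local_ring"
  shows "\<exists>c. \<exists>v\<in>local_ring. \<exists>w\<in>local_ring.
    u = to_fract (const2 c) + to_fract var_s * v + to_fract var_t * w"
proof -
  obtain a b where u: "u = Fract a b" and b: "c2 b 0 0 \<noteq> 0"
    using assms by (auto simp: local_ring_eq max_power_def)
  then have "b \<noteq> 0" by auto
  define c where "c = c2 a 0 0 / c2 b 0 0"
  define r where "r = a - const2 c * b"
  have r0: "c2 r 0 0 = 0" using b by (simp add: r_def c_def c2_const_mult)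
  obtain r0 r1 where r: "r = pCons r0 r1" by (cases r)
  obtain z r2 where r': "r0 = pCons z r2" by (cases r0)
  have "z = 0" using r0 by (simp add: r r')
  then have req: "r = var_s * r1 + var_t * [:r2:]" by (simp add: r r' var_s_def var_t_def)
  have e: "Fract p b = to_fract p * Fract 1 b" for p by (simp add: to_fract_def)
  have "Fract a b = Fract (const2 c * b) b + Fract r b"
    using \<open>b \<noteq> 0\<close> by (simp add: eq_fract r_def algebra_simps)
  also have "Fract (const2 c * b) b = to_fract (const2 c)"
    using \<open>b \<noteq> 0\<close> by (simp add: to_fract_def eq_fract)
  also have "Fract r b = to_fract var_s * Fract r1 b + to_fract var_t * Fract [:r2:] b"
    unfolding e [of r] e [of r1] e [of "[:r2:]"] unfolding req
    by (simp only: to_fract_add to_fract_mult distrib_right mult.assoc)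
  finally have "u = to_fract (const2 c) + to_fract var_s * Fract r1 b + to_fract var_t * Fract [:r2:] b"
    by (simp add: u add.assoc)
  moreover have "Fract p b \<in> local_ring" for p
    using b by (auto simp: local_ring_eq max_power_def ordge_0)
  ultimately show ?thesis by blast
qed

text \<open>
  Every element of the local ring is a constant plus an element of the maximal ideal; iterating
  this expansion \<open>K\<close> times leaves monomials of degree less than \<open>K\<close> and multiples of monomials of
  degree \<open>K\<close>.
\<close>

lemma local_ring_subset:
  assumes V: "rat_fun.subspace V"
    and low: "\<And>a b. a + b < K \<Longrightarrow> to_fract (mon2 a b) \<in> V"
    and high: "\<And>a b u. a + b = K \<Longrightarrow> u \<in> local_ring \<Longrightarrow> to_fract (mon2 a b) * u \<in> V"
  shows "local_ring \<subseteq> V"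
proof -
  have "to_fract (mon2 a b) * u \<in> V" if "a + b \<le> K" "u \<in> local_ring" for a b u
    using that
  proof (induction "K - (a + b)" arbitrary: a b u)
    case 0
    then show ?case by (intro high) auto
  next
    case (Suc n)
    obtain c v w where vw: "v \<in> local_ring" "w \<in> local_ring" and
      u: "u = to_fract (const2 c) + to_fract var_s * v + to_fract var_t * w"
      using local_ring_decompose [OF Suc(4)] by blast
    have "to_fract (mon2 a b) * u = scale_fract c (to_fract (mon2 a b)) +
        to_fract (mon2 (Suc a) b) * v + to_fract (mon2 a (Suc b)) * w"
      by (simp add: u mon2_Suc scale_fract_def algebra_simps)
    moreover have "scale_fract c (to_fract (mon2 a b)) \<in> V"
      using Suc by (intro rat_fun.subspace_scale V low) auto
    moreover have "to_fract (mon2 (Suc a) b) * v \<in> V" "to_fract (mon2 a (Suc b)) * w \<in> V"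
      using Suc.hyps vw by (intro Suc.hyps(1); simp)+
    ultimately show ?case using V by (auto intro: rat_fun.subspace_add)
  qed
  from this [of 0 0] show ?thesis by (auto simp: mon2_0)
qed

lemma to_fract_sum': "to_fract (sum u A) = (\<Sum>i\<in>A. to_fract (u i))"
  by (induction A rule: infinite_finite_induct) simp_all

text \<open>
  The elements of the local ring whose Taylor polynomial below degree \<open>K\<close> lies in \<open>V\<close>.
\<close>

lemma subspace_jets:
  assumes V: "rat_fun.subspace V"
  shows "rat_fun.subspace {u. \<exists>p. to_fract p \<in> V \<and> deglt K p \<and> u - to_fract p \<in> max_power K}"
proof (rule rat_fun.subspaceI; clarify?)
  show "\<exists>p. to_fract p \<in> V \<and> deglt K p \<and> 0 - to_fract p \<in> max_power K"
    using V max_power_0 by (intro exI [of _ 0]) (simp add: deglt_def rat_fun.subspace_0)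
next
  fix x y p q
  assume *: "to_fract p \<in> V" "deglt K p" "x - to_fract p \<in> max_power K"
    "to_fract q \<in> V" "deglt K q" "y - to_fract q \<in> max_power K"
  have "x + y - to_fract (p + q) = (x - to_fract p) + (y - to_fract q)" by simp
  then have "x + y - to_fract (p + q) \<in> max_power K" using * max_power_add by metis
  then show "\<exists>p. to_fract p \<in> V \<and> deglt K p \<and> x + y - to_fract p \<in> max_power K"
    using * V by (intro exI [of _ "p + q"]) (simp add: deglt_def rat_fun.subspace_add)
next
  fix c x p
  assume *: "to_fract p \<in> V" "deglt K p" "x - to_fract p \<in> max_power K"
  have e: "to_fract (const2 c * p) = scale_fract c (to_fract p)" by (simp add: scale_fract_def)
  then have "scale_fract c x - to_fract (const2 c * p) = scale_fract c (x - to_fract p)"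
    by (simp add: rat_fun.scale_right_diff_distrib)
  then have "scale_fract c x - to_fract (const2 c * p) \<in> max_power K"
    using * scale_fract_max_power by metis
  then show "\<exists>p. to_fract p \<in> V \<and> deglt K p \<and> scale_fract c x - to_fract p \<in> max_power K"
    using * V e by (intro exI [of _ "const2 c * p"])
      (auto simp: deglt_def c2_const_mult rat_fun.subspace_scale)
qed

lemma local_ring_truncate:
  assumes "u \<in> local_ring"
  shows "\<exists>p. deglt K p \<and> u - to_fract p \<in> max_power K"
proof -
  have "local_ring \<subseteq> {u. \<exists>p. to_fract p \<in> UNIV \<and> deglt K p \<and> u - to_fract p \<in> max_power K}"
  proof (rule local_ring_subset [where K = K])
    show "rat_fun.subspace {u. \<exists>p. to_fract p \<in> UNIV \<and> deglt K p \<and> u - to_fract p \<in> max_power K}"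
      by (rule subspace_jets) simp
  next
    fix a b assume "a + b < K"
    then show "to_fract (mon2 a b) \<in> {u. \<exists>p. to_fract p \<in> UNIV \<and> deglt K p \<and> u - to_fract p \<in> max_power K}"
      using max_power_0 by (intro CollectI exI [of _ "mon2 a b"]) (auto simp: deglt_def c2_mon2)
  next
    fix a b u assume *: "a + b = K" "u \<in> local_ring"
    have "to_fract (mon2 a b) \<in> max_power K"
      using *(1) by (simp add: to_fract_in_max_power_iff ordge_def c2_mon2)
    then have "to_fract (mon2 a b) * u \<in> max_power K"
      using * max_power_mult [of _ K u 0] by (simp add: local_ring_eq)
    then show "to_fract (mon2 a b) * u \<in> {u. \<exists>p. to_fract p \<in> UNIV \<and> deglt K p \<and> u - to_fract p \<in> max_power K}"
      by (intro CollectI exI [of _ 0]) (simp add: deglt_def)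
  qed
  then show ?thesis using assms by auto
qed


section \<open>The Tjurina number of a union of lines through a point\<close>

lemma subspace_combination:
  "rat_fun.subspace {u * f + v * g |u v. u \<in> local_ring \<and> v \<in> local_ring}"
proof (rule rat_fun.subspaceI; clarify?)
  show "\<exists>u v. 0 = u * f + v * g \<and> u \<in> local_ring \<and> v \<in> local_ring"
    by (intro exI [of _ 0]) auto
next
  fix u v u' v' assume "u \<in> local_ring" "v \<in> local_ring" "u' \<in> local_ring" "v' \<in> local_ring"
  then show "\<exists>a b. u * f + v * g + (u' * f + v' * g) = a * f + b * g \<and> a \<in> local_ring \<and> b \<in> local_ring"
    by (intro exI [of _ "u + u'"] exI [of _ "v + v'"]) (auto simp: algebra_simps)
next
  fix c u v assume "u \<in> local_ring" "v \<in> local_ring"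
  then show "\<exists>a b. scale_fract c (u * f + v * g) = a * f + b * g \<and> a \<in> local_ring \<and> b \<in> local_ring"
    by (intro exI [of _ "scale_fract c u"] exI [of _ "scale_fract c v"])
      (auto simp: algebra_simps scale_fract_def)
qed

lemma independent_mon2: "rat_fun.independent ((\<lambda>(a, b). to_fract (mon2 a b)) ` {(i, j). i + j < K})"
  (is "rat_fun.independent (?m ` ?A)")
  and inj_on_mon2: "inj_on (\<lambda>(a, b). to_fract (mon2 a b)) {(i, j). i + j < K}"
proof -
  show inj: "inj_on ?m ?A"
  proof (rule inj_onI, clarify)
    fix a b c d assume "to_fract (mon2 a b) = to_fract (mon2 c d)"
    then have "c2 (mon2 a b) a b = c2 (mon2 c d) a b" by simp
    then show "a = c \<and> b = d" by (simp add: c2_mon2 split: if_splits)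
  qed
  show "rat_fun.independent (?m ` ?A)"
  proof (rule rat_fun.independent_if_scalars_zero)
    fix f x assume 0: "(\<Sum>x\<in>?m ` ?A. scale_fract (f x) x) = 0" and x: "x \<in> ?m ` ?A"
    then obtain a b where ab: "a + b < K" "x = ?m (a, b)" by auto
    define p where "p = (\<Sum>y\<in>?A. const2 (f (?m y)) * mon2 (fst y) (snd y))"
    have "to_fract p = (\<Sum>y\<in>?A. scale_fract (f (?m y)) (?m y))"
      unfolding p_def to_fract_sum' by (rule sum.cong) (auto simp: scale_fract_def)
    also have "\<dots> = 0" using 0 inj by (simp add: sum.reindex)
    finally have "c2 p a b = 0" by simp
    moreover have "c2 p a b = (\<Sum>y\<in>?A. if y = (a, b) then f (?m (a, b)) else 0)"
      unfolding p_def coeff_sum c2_const_mult c2_mon2 by (rule sum.cong) auto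
    ultimately show "f x = 0" using ab by simp
  qed simp
qed

text \<open>
  Modulo terms of degree at least \<open>2 * N - 1\<close>, the ideal generated by the two forms is spanned by
  their products with monomials of degree less than \<open>N - 1\<close>, which are \<open>N * (N - 1)\<close> in number.  As there
  are \<open>N * (2 * N - 1)\<close> monomials of degree less than \<open>2 * N - 1\<close>, at least \<open>N\<^sup>2\<close> further elements are
  needed.
\<close>

lemma codim_two_forms_ge:
  assumes F: "hom2 N F" and G: "hom2 N G" and N: "N \<ge> 1"
    and I: "I \<subseteq> {u * to_fract F + v * to_fract G |u v. u \<in> local_ring \<and> v \<in> local_ring}"
    and sI: "rat_fun.subspace I"
    and B: "finite B" "B \<subseteq> local_ring" "local_ring \<subseteq> rat_fun.span (B \<union> I)"
  shows "N\<^sup>2 \<le> card B"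
proof -
  define K where "K = 2 * N - 1"
  let ?A = "\<lambda>K. {(i, j). i + j < (K::nat)}"
  have "\<forall>b\<in>B. \<exists>p. deglt K p \<and> b - to_fract p \<in> max_power K"
    using local_ring_truncate B(2) by blast
  then obtain tb where tb: "\<And>b. b \<in> B \<Longrightarrow> deglt K (tb b) \<and> b - to_fract (tb b) \<in> max_power K"
    by (auto dest!: bchoice)
  define mF where "mF F = (\<lambda>(a, b). to_fract (mon2 a b * F)) ` ?A (N - 1)" for F
  define S where "S = (\<lambda>b. to_fract (tb b)) ` B \<union> (mF F \<union> mF G)"
  define V where "V = {u. \<exists>p. to_fract p \<in> rat_fun.span S \<and> deglt K p \<and> u - to_fract p \<in> max_power K}"
  have V: "rat_fun.subspace V" unfolding V_def by (rule subspace_jets) (rule rat_fun.subspace_span)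
  have form: "u * to_fract H \<in> V" if H: "hom2 N H" "mF H \<subseteq> S" and u: "u \<in> local_ring" for u H
  proof -
    obtain p where p: "deglt (N - 1) p" "u - to_fract p \<in> max_power (N - 1)"
      using local_ring_truncate [OF u] by blast
    have "ordge N H" using H(1) by (simp add: ordge_def hom2_def)
    then have "(u - to_fract p) * to_fract H \<in> max_power (N - 1 + N)"
      using p(2) by (intro max_power_mult) (simp_all add: to_fract_in_max_power_iff)
    moreover have "N - 1 + N = K" using N by (simp add: K_def)
    ultimately have "u * to_fract H - to_fract (p * H) \<in> max_power K" by (simp add: algebra_simps)
    moreover have pH: "p * H = (\<Sum>(a, b)\<in>?A (N - 1). const2 (c2 p a b) * (mon2 a b * H))"
      by (subst deglt_expand [OF p(1)]) (simp add: sum_distrib_right case_prod_unfold mult.assoc)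
    have "to_fract (p * H) \<in> rat_fun.span S"
      unfolding pH to_fract_sum'
    proof (rule rat_fun.span_sum, clarify)
      fix a b assume "a + b < N - 1"
      then have "to_fract (mon2 a b * H) \<in> S" using H(2) by (auto simp: mF_def)
      then have "scale_fract (c2 p a b) (to_fract (mon2 a b * H)) \<in> rat_fun.span S"
        by (intro rat_fun.span_scale rat_fun.span_base)
      then show "to_fract (const2 (c2 p a b) * (mon2 a b * H)) \<in> rat_fun.span S"
        by (simp add: scale_fract_def)
    qed
    moreover have "deglt K (p * H)"
      unfolding pH deglt_def
    proof (intro allI impI)
      fix i j assume "K \<le> i + j"
      then have "c2 (mon2 a b * H) i j = 0" if "a + b < N - 1" for a b
      proof -
        have "i + j \<noteq> a + b + N" using \<open>K \<le> i + j\<close> that unfolding K_def by linarith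
        then show ?thesis using hom2_mult [OF hom2_mon2 H(1), of a b] by (simp add: hom2_def)
      qed
      then show "c2 (\<Sum>(a, b)\<in>?A (N - 1). const2 (c2 p a b) * (mon2 a b * H)) i j = 0"
        by (simp add: coeff_sum case_prod_unfold c2_const_mult sum.neutral)
    qed
    ultimately show ?thesis unfolding V_def by blast
  qed
  have "I \<subseteq> V"
  proof
    fix x assume "x \<in> I"
    then obtain u v where "x = u * to_fract F + v * to_fract G" "u \<in> local_ring" "v \<in> local_ring"
      using I by blast
    then show "x \<in> V" using F G
      by (auto intro!: rat_fun.subspace_add [OF V] form simp: S_def)
  qed
  moreover have "B \<subseteq> V"
  proof
    fix b assume b: "b \<in> B"
    then have "to_fract (tb b) \<in> rat_fun.span S" by (intro rat_fun.span_base) (simp add: S_def)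
    then show "b \<in> V" using tb [OF b] by (auto simp: V_def)
  qed
  ultimately have LV: "local_ring \<subseteq> V"
    using B(3) rat_fun.span_minimal [OF _ V, of "B \<union> I"] by blast
  have sub: "(\<lambda>(a, b). to_fract (mon2 a b)) ` ?A K \<subseteq> rat_fun.span S"
  proof clarify
    fix a b assume ab: "a + b < K"
    have "to_fract (mon2 a b) \<in> V" using LV by auto
    then obtain p where p: "to_fract p \<in> rat_fun.span S" "deglt K p"
      "to_fract (mon2 a b) - to_fract p \<in> max_power K" by (auto simp: V_def)
    then have o: "ordge K (mon2 a b - p)" using to_fract_in_max_power_iff [of "mon2 a b - p" K] by simp
    have "mon2 a b = p"
    proof (rule poly2_eqI)
      fix i j
      show "c2 (mon2 a b) i j = c2 p i j"
        using o p(2) ab by (cases "i + j < K") (auto simp: ordge_def deglt_def c2_mon2)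
    qed
    then show "to_fract (mon2 a b) \<in> rat_fun.span S" using p(1) by simp
  qed
  have "finite S" using B(1) by (simp add: S_def mF_def)
  then have "card ((\<lambda>(a, b). to_fract (mon2 a b)) ` ?A K) \<le> card S"
    using rat_fun.independent_span_bound [OF _ independent_mon2 sub] by blast
  then have 1: "card (?A K) \<le> card S" by (simp add: card_image inj_on_mon2)
  have "card S \<le> card ((\<lambda>b. to_fract (tb b)) ` B) + (card (mF F) + card (mF G))"
    unfolding S_def by (meson add_left_mono card_Un_le order_trans)
  also have "\<dots> \<le> card B + (card (?A (N - 1)) + card (?A (N - 1)))"
    unfolding mF_def by (intro add_mono card_image_le B(1) finite_pairs_less)
  finally have "card (?A K) \<le> card B + 2 * card (?A (N - 1))" using 1 by simp
  then have "K * (K + 1) \<le> 2 * card B + 2 * ((N - 1) * N)"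
    using card_pairs_less [of K] card_pairs_less [of "N - 1"] N by simp
  moreover obtain n where "N = Suc n" using N by (cases N) auto
  ultimately show ?thesis by (simp add: K_def power2_eq_square algebra_simps)
qed

text \<open>The complement is spanned by a set of minimal size among those that span \<open>V\<close> modulo \<open>I\<close>.\<close>

lemma complement_exists:
  assumes "rat_fun.subspace V" "rat_fun.subspace I" "I \<subseteq> V" "finite W" "W \<subseteq> V" "V \<subseteq> rat_fun.span (W \<union> I)"
  shows "\<exists>B\<subseteq>V. finite B \<and> rat_fun.independent B \<and> rat_fun.span B \<inter> I = {0} \<and> rat_fun.span (B \<union> I) = V"
proof -
  let ?P = "\<lambda>B. finite B \<and> B \<subseteq> V \<and> V \<subseteq> rat_fun.span (B \<union> I)"
  obtain B where B: "?P B" and min: "\<And>B'. ?P B' \<Longrightarrow> card B \<le> card B'"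
    using assms ex_has_least_nat [of ?P W card] by blast
  have sI: "rat_fun.span I = I" using assms(2) by (simp add: rat_fun.span_eq_iff)
  \<comment> \<open>Minimality: a combination of \<open>B\<close> in \<open>I\<close> with a nonzero coefficient at \<open>b\<close> makes \<open>b\<close> redundant.\<close>
  have key: "u b = 0" if u: "(\<Sum>b\<in>B. scale_fract (u b) b) \<in> I" and b: "b \<in> B" for u b
  proof (rule ccontr)
    assume nz: "u b \<noteq> 0"
    let ?S = "rat_fun.span ((B - {b}) \<union> I)"
    have "(\<Sum>b\<in>B. scale_fract (u b) b) = scale_fract (u b) b + (\<Sum>b\<in>B - {b}. scale_fract (u b) b)"
      using B b by (simp add: sum.remove)
    then have e: "scale_fract (u b) b = (\<Sum>b\<in>B. scale_fract (u b) b) - (\<Sum>b\<in>B - {b}. scale_fract (u b) b)"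
      by simp
    have "(\<Sum>b\<in>B. scale_fract (u b) b) \<in> ?S" using u by (intro rat_fun.span_base) auto
    moreover have "(\<Sum>b\<in>B - {b}. scale_fract (u b) b) \<in> ?S"
      by (intro rat_fun.span_sum rat_fun.span_scale rat_fun.span_base) auto
    ultimately have "scale_fract (u b) b \<in> ?S" unfolding e by (rule rat_fun.span_diff)
    then have "scale_fract (inverse (u b)) (scale_fract (u b) b) \<in> ?S" by (rule rat_fun.span_scale)
    then have "b \<in> ?S" using nz by simp
    then have "B \<union> I \<subseteq> ?S" using rat_fun.span_superset [of "(B - {b}) \<union> I"] by blast
    then have "rat_fun.span (B \<union> I) \<subseteq> ?S" by (rule rat_fun.span_minimal) simp
    then have "?P (B - {b})" using B by auto
    then have "card B \<le> card (B - {b})" by (rule min)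
    then show False using B b card_Diff1_less [of B b] by linarith
  qed
  have "rat_fun.independent B"
    by (rule rat_fun.independent_if_scalars_zero) (use B key assms(2) rat_fun.subspace_0 in auto)
  moreover have "rat_fun.span B \<inter> I = {0}"
  proof -
    have "x = 0" if x: "x \<in> rat_fun.span B" "x \<in> I" for x
    proof -
      obtain u where u: "x = (\<Sum>b\<in>B. scale_fract (u b) b)"
        using x(1) B rat_fun.span_finite [of B] by auto
      then have "\<forall>b\<in>B. u b = 0" using key x(2) by auto
      then show ?thesis by (simp add: u)
    qed
    then show ?thesis using assms(2) rat_fun.subspace_0 rat_fun.span_zero by auto
  qed
  moreover have "rat_fun.span (B \<union> I) = V"
    using B assms by (intro equalityI rat_fun.span_minimal) auto
  ultimately show ?thesis using B by blast
qed

definition lin2 :: "complex \<Rightarrow> complex \<Rightarrow> poly2" where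
  "lin2 b c = const2 b * var_s + const2 c * var_t"

abbreviation "deriv_s \<equiv> (pderiv :: poly2 \<Rightarrow> poly2)"
abbreviation "deriv_t \<equiv> (map_poly pderiv :: poly2 \<Rightarrow> poly2)"

lemma derivations2: "derivation deriv_s" "derivation deriv_t"
  by (intro derivation_pderiv derivation_map_poly)+

lemma deriv_lin2: "deriv_s (lin2 b c) = const2 b" "deriv_t (lin2 b c) = const2 c"
  by (simp_all add: lin2_def const2_def var_s_def var_t_def pderiv_pCons map_poly_pCons)

lemma hom2_const_var: "hom2 0 (const2 c)" "hom2 1 var_s" "hom2 1 var_t" "hom2 1 (lin2 b c)"
  by (auto simp: hom2_def const2_def var_s_def var_t_def lin2_def coeff_pCons split: nat.splits)

lemma hom2_sum: "(\<And>i. i \<in> A \<Longrightarrow> hom2 N (u i)) \<Longrightarrow> hom2 N (sum u A)"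
  by (auto simp: hom2_def coeff_sum intro!: sum.neutral)

lemma hom2_prod: "finite A \<Longrightarrow> (\<And>i. i \<in> A \<Longrightarrow> hom2 1 (u i)) \<Longrightarrow> hom2 (card A) (prod u A)"
proof (induction A rule: finite_induct)
  case empty
  show ?case using hom2_const_var(1) [of 1] rhomD(1) [OF rhom_const2] by simp
next
  case (insert x A)
  then show ?case using hom2_mult [of 1 "u x" "card A" "prod u A"] by simp
qed

text \<open>
  The lines through the origin of an affine chart.  The polynomial \<open>h\<close> below is their product, and \<open>P i\<close>
  is the product of all of them but \<open>i\<close>.
\<close>

locale concurrent_lines =
  fixes A :: "nat set" and \<beta> \<gamma> :: "nat \<Rightarrow> complex"
  assumes fin: "finite A" and two: "card A \<ge> 2"
    and indep: "\<And>i j. i \<in> A \<Longrightarrow> j \<in> A \<Longrightarrow> i \<noteq> j \<Longrightarrow> \<beta> i * \<gamma> j \<noteq> \<beta> j * \<gamma> i"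
begin

abbreviation "l i \<equiv> lin2 (\<beta> i) (\<gamma> i)"
definition h :: poly2 where "h = (\<Prod>i\<in>A. l i)"
definition P :: "nat \<Rightarrow> poly2" where "P i = (\<Prod>j\<in>A - {i}. l j)"

lemma h_eq: "i \<in> A \<Longrightarrow> h = l i * P i"
  unfolding h_def P_def using fin by (simp add: prod.remove)

lemma deriv_h: "deriv_s h = (\<Sum>i\<in>A. const2 (\<beta> i) * P i)" "deriv_t h = (\<Sum>i\<in>A. const2 (\<gamma> i) * P i)"
  unfolding h_def P_def by (simp_all add: derivation_prod derivations2 fin deriv_lin2)

lemma hom2_P: "i \<in> A \<Longrightarrow> hom2 (card A - 1) (P i)"
  using hom2_prod [of "A - {i}" l] fin by (simp only: P_def hom2_const_var card_Diff_singleton finite_Diff)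

lemma hom2_deriv_h: "hom2 (card A - 1) (deriv_s h)" "hom2 (card A - 1) (deriv_t h)"
  unfolding deriv_h using hom2_mult [OF hom2_const_var(1) hom2_P] by (auto intro!: hom2_sum)

lemma euler_h: "const2 (of_nat (card A)) * h = var_s * deriv_s h + var_t * deriv_t h"
proof -
  have "var_s * deriv_s h + var_t * deriv_t h = (\<Sum>i\<in>A. l i * P i)"
    unfolding deriv_h by (simp add: sum_distrib_left sum.distrib lin2_def algebra_simps)
  also have "\<dots> = (\<Sum>i\<in>A. h)" by (intro sum.cong) (simp_all add: h_eq)
  finally show ?thesis by (simp add: of_nat_poly const2_def)
qed

definition combos :: "poly2 set" where "combos = {\<Sum>i\<in>A. const2 (c i) * P i |c. True}"

lemma combos_closed: "x \<in> combos \<Longrightarrow> y \<in> combos \<Longrightarrow> const2 a * x + const2 b * y \<in> combos"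
proof -
  assume "x \<in> combos" "y \<in> combos"
  then obtain c d where "x = (\<Sum>i\<in>A. const2 (c i) * P i)" "y = (\<Sum>i\<in>A. const2 (d i) * P i)"
    by (auto simp: combos_def)
  then have "const2 a * x + const2 b * y = (\<Sum>i\<in>A. const2 (a * c i + b * d i) * P i)"
    by (simp add: sum_distrib_left sum.distrib rhomD [OF rhom_const2] algebra_simps)
  then show ?thesis by (auto simp: combos_def)
qed

lemma P_combos: "i \<in> A \<Longrightarrow> P i \<in> combos"
  unfolding combos_def using fin
  by (intro CollectI exI [of _ "\<lambda>j. if j = i then 1 else 0"])
    (auto simp: if_distrib [of const2] rhomD [OF rhom_const2] if_distrib [of "\<lambda>x. x * _"] cong: if_cong)

text \<open>
  Two lines outside \<open>T\<close> span all linear forms, so that a variable can be traded for one of these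
  lines until only one line is missing and the product is some \<open>P i\<close>.
\<close>

lemma mon2_combos_aux:
  assumes "T \<subseteq> A" "a + b + card T + 1 = card A"
  shows "(\<Prod>i\<in>T. l i) * mon2 a b \<in> combos"
  using assms
proof (induction "a + b" arbitrary: a b T)
  case 0
  then have "card (A - T) = 1" using fin by (simp add: card_Diff_subset finite_subset)
  then obtain i where "A - T = {i}" by (auto simp: card_1_singleton_iff)
  then have "T = A - {i}" "i \<in> A" using 0 by auto
  then show ?case using 0 P_combos [of i] by (simp add: P_def mon2_0)
next
  case (Suc n)
  then have "card (A - T) \<ge> 2" using fin by (simp add: card_Diff_subset finite_subset)
  then obtain S where "S \<subseteq> A - T" "card S = 2" using obtain_subset_with_card_n by metis
  then obtain i j where ij: "i \<in> A" "j \<in> A" "i \<notin> T" "j \<notin> T" "i \<noteq> j" by (auto simp: card_2_iff)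
  have fT: "finite T" using Suc(3) fin finite_subset by blast
  define D where "D = \<beta> i * \<gamma> j - \<beta> j * \<gamma> i"
  have D: "D \<noteq> 0" using indep ij by (simp add: D_def)
  have lij: "const2 p * l i + const2 q * l j = const2 (p * \<beta> i + q * \<beta> j) * var_s + const2 (p * \<gamma> i + q * \<gamma> j) * var_t" for p q
    by (simp add: lin2_def rhomD [OF rhom_const2] algebra_simps)
  have s: "var_s = const2 (\<gamma> j / D) * l i + const2 (- \<gamma> i / D) * l j"
  proof -
    have "\<gamma> j * \<beta> i - \<gamma> i * \<beta> j = D" by (simp add: D_def)
    then have "\<gamma> j / D * \<beta> i + - \<gamma> i / D * \<beta> j = 1" using D by (simp add: field_simps)
    moreover have "\<gamma> j / D * \<gamma> i + - \<gamma> i / D * \<gamma> j = 0" by simp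
    ultimately show ?thesis unfolding lij by (simp only: rhomD(1,4) [OF rhom_const2]) simp
  qed
  have t: "var_t = const2 (- \<beta> j / D) * l i + const2 (\<beta> i / D) * l j"
  proof -
    have "\<beta> i * \<gamma> j - \<beta> j * \<gamma> i = D" by (simp add: D_def)
    then have "- \<beta> j / D * \<gamma> i + \<beta> i / D * \<gamma> j = 1" using D by (simp add: field_simps)
    moreover have "- \<beta> j / D * \<beta> i + \<beta> i / D * \<beta> j = 0" by simp
    ultimately show ?thesis unfolding lij by (simp only: rhomD(1,4) [OF rhom_const2]) simp
  qed
  have step: "(\<Prod>i\<in>T. l i) * ((const2 p * l i + const2 q * l j) * mon2 a' b') \<in> combos"
    if "n = a' + b'" for p q a' b'
  proof -
    have "(\<Prod>i\<in>insert i T. l i) * mon2 a' b' \<in> combos" "(\<Prod>i\<in>insert j T. l i) * mon2 a' b' \<in> combos"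
      using Suc.prems Suc.hyps(2) ij fT that by (intro Suc.hyps(1); simp)+
    then have "const2 p * ((\<Prod>i\<in>insert i T. l i) * mon2 a' b') + const2 q * ((\<Prod>i\<in>insert j T. l i) * mon2 a' b') \<in> combos"
      by (rule combos_closed)
    then show ?thesis using ij fT by (simp add: algebra_simps)
  qed
  show ?case
  proof (cases a)
    case a: (Suc a')
    then have "n = a' + b" using Suc.hyps(2) by simp
    from step [OF this] show ?thesis unfolding a mon2_Suc(1) by (subst s)
  next
    case 0
    then obtain b' where b: "b = Suc b'" using Suc.hyps(2) by (cases b) auto
    then have "n = a + b'" using Suc.hyps(2) by simp
    from step [OF this] show ?thesis unfolding b mon2_Suc(2) by (subst t)
  qed
qed

lemma mon2_combos: "a + b + 1 = card A \<Longrightarrow> mon2 a b \<in> combos"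
  using mon2_combos_aux [of "{}" a b] by simp

end

lemma tjurina_ideal_subspace: "rat_fun.subspace (tjurina_ideal g)"
proof (rule rat_fun.subspaceI)
  show "0 \<in> tjurina_ideal g" unfolding tjurina_ideal_def by (intro CollectI exI [of _ 0]) auto
next
  fix x y assume "x \<in> tjurina_ideal g" "y \<in> tjurina_ideal g"
  then obtain u v w u' v' w' where
    "x = u * to_fract g + v * to_fract (deriv_s g) + w * to_fract (deriv_t g)"
    "y = u' * to_fract g + v' * to_fract (deriv_s g) + w' * to_fract (deriv_t g)"
    "u \<in> local_ring" "v \<in> local_ring" "w \<in> local_ring" "u' \<in> local_ring" "v' \<in> local_ring" "w' \<in> local_ring"
    by (auto simp: tjurina_ideal_def)
  then show "x + y \<in> tjurina_ideal g" unfolding tjurina_ideal_def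
    by (intro CollectI exI [of _ "u + u'"] exI [of _ "v + v'"] exI [of _ "w + w'"])
      (auto simp: algebra_simps)
next
  fix c x assume "x \<in> tjurina_ideal g"
  then obtain u v w where
    "x = u * to_fract g + v * to_fract (deriv_s g) + w * to_fract (deriv_t g)"
    "u \<in> local_ring" "v \<in> local_ring" "w \<in> local_ring"
    by (auto simp: tjurina_ideal_def)
  then show "scale_fract c x \<in> tjurina_ideal g" unfolding tjurina_ideal_def
    by (intro CollectI exI [of _ "scale_fract c u"] exI [of _ "scale_fract c v"] exI [of _ "scale_fract c w"])
      (auto simp: scale_fract_def algebra_simps)
qed

lemma tjurina_ideal_mult:
  assumes "a \<in> local_ring" "x \<in> tjurina_ideal g"
  shows "a * x \<in> tjurina_ideal g"
proof -
  obtain u v w where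
    "x = u * to_fract g + v * to_fract (deriv_s g) + w * to_fract (deriv_t g)"
    "u \<in> local_ring" "v \<in> local_ring" "w \<in> local_ring"
    using assms(2) by (auto simp: tjurina_ideal_def)
  then show "a * x \<in> tjurina_ideal g" unfolding tjurina_ideal_def using assms(1)
    by (intro CollectI exI [of _ "a * u"] exI [of _ "a * v"] exI [of _ "a * w"])
      (auto simp: algebra_simps)
qed

lemma tjurina_ideal_gens:
  "to_fract g \<in> tjurina_ideal g" "to_fract (deriv_s g) \<in> tjurina_ideal g"
  "to_fract (deriv_t g) \<in> tjurina_ideal g"
  unfolding tjurina_ideal_def
  by (intro CollectI exI [of _ 1] exI [of _ 0]; simp)
    (intro CollectI exI [of _ 0] exI [of _ 1]; simp;
     rule exI [of _ 0]; rule exI [of _ 1]; simp)+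

lemma tjurina_ideal_local: "tjurina_ideal g \<subseteq> local_ring"
  by (auto simp: tjurina_ideal_def)

context concurrent_lines
begin

lemma P_mult_P:
  assumes "i \<in> A" "j \<in> A" "i \<noteq> j"
  shows "\<exists>Q. P i * P j = Q * h"
proof -
  have "P i = l j * (\<Prod>k\<in>A - {i} - {j}. l k)"
    unfolding P_def using assms fin by (subst prod.remove [of _ j]) auto
  then have "P i * P j = (\<Prod>k\<in>A - {i} - {j}. l k) * h"
    using h_eq [OF assms(2)] by (simp add: mult_ac)
  then show ?thesis ..
qed

text \<open>
  For \<open>i \<noteq> j\<close> the product is a multiple of \<open>h\<close>.  Up to such multiples, \<open>P i\<close> times a derivative of \<open>h\<close> is
  \<open>\<beta> i\<close> or \<open>\<gamma> i\<close> times the square of \<open>P i\<close>, and one of these two coefficients is not zero.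
\<close>

lemma P_mult_P_in_ideal:
  assumes I: "rat_fun.subspace I" and mult: "\<And>u x. u \<in> local_ring \<Longrightarrow> x \<in> I \<Longrightarrow> u * x \<in> I"
    and h: "to_fract h \<in> I" "to_fract (deriv_s h) \<in> I" "to_fract (deriv_t h) \<in> I"
    and i: "i \<in> A" and j: "j \<in> A"
  shows "to_fract (P i * P j) \<in> I"
proof -
  have ne: "to_fract (P i * P j) \<in> I" if "i \<in> A" "j \<in> A" "i \<noteq> j" for i j
  proof -
    obtain Q where "P i * P j = Q * h" using P_mult_P [OF \<open>i \<in> A\<close> \<open>j \<in> A\<close> \<open>i \<noteq> j\<close>] by blast
    then show ?thesis using h(1) mult [of "to_fract Q" "to_fract h"] by simp
  qed
  have sq: "to_fract (P i * P i) \<in> I"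
    if c: "c i \<noteq> 0" "to_fract (\<Sum>j\<in>A. const2 (c j) * P j) \<in> I" for c :: "nat \<Rightarrow> complex"
  proof -
    let ?r = "\<Sum>j\<in>A - {i}. scale_fract (c j) (to_fract (P i * P j))"
    have "to_fract (P i) * to_fract (\<Sum>j\<in>A. const2 (c j) * P j) = (\<Sum>j\<in>A. scale_fract (c j) (to_fract (P i * P j)))"
      by (simp add: to_fract_sum' sum_distrib_left scale_fract_def mult_ac)
    also have "\<dots> = scale_fract (c i) (to_fract (P i * P i)) + ?r"
      using i fin by (simp add: sum.remove)
    finally have e: "scale_fract (c i) (to_fract (P i * P i)) = to_fract (P i) * to_fract (\<Sum>j\<in>A. const2 (c j) * P j) - ?r"
      by simp
    have "?r \<in> I" using i by (intro rat_fun.subspace_sum I rat_fun.subspace_scale ne) auto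
    then have "scale_fract (c i) (to_fract (P i * P i)) \<in> I"
      unfolding e by (intro rat_fun.subspace_diff I mult c) auto
    then have "scale_fract (inverse (c i)) (scale_fract (c i) (to_fract (P i * P i))) \<in> I"
      by (rule rat_fun.subspace_scale [OF I])
    then show ?thesis using c(1) by simp
  qed
  have "A \<noteq> {i}" using two by auto
  then obtain k where "k \<in> A" "k \<noteq> i" using i by auto
  then have "\<beta> i \<noteq> 0 \<or> \<gamma> i \<noteq> 0" using indep [OF i] by fastforce
  then have "to_fract (P i * P i) \<in> I" using sq [of \<beta>] sq [of \<gamma>] h(2,3) unfolding deriv_h by blast
  then show ?thesis using ne [OF i j] by (cases "i = j") auto
qed

text \<open>
  A monomial of degree \<open>2 * (card A - 1)\<close> is a product of two monomials of degree \<open>card A - 1\<close>, each of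
  which is a combination of the \<open>P i\<close>.
\<close>

lemma mon2_in_ideal:
  assumes I: "rat_fun.subspace I" and mult: "\<And>u x. u \<in> local_ring \<Longrightarrow> x \<in> I \<Longrightarrow> u * x \<in> I"
    and h: "to_fract h \<in> I" "to_fract (deriv_s h) \<in> I" "to_fract (deriv_t h) \<in> I"
    and ab: "a + b = 2 * (card A - 1)"
  shows "to_fract (mon2 a b) \<in> I"
proof -
  have "\<exists>a1 b1 a2 b2. a = a1 + a2 \<and> b = b1 + b2 \<and> a1 + b1 + 1 = card A \<and> a2 + b2 + 1 = card A"
  proof (cases "a \<le> card A - 1")
    case True
    then show ?thesis using ab two
      by (intro exI [of _ a] exI [of _ "card A - 1 - a"] exI [of _ 0] exI [of _ "card A - 1"]) auto
  next
    case False
    then show ?thesis using ab two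
      by (intro exI [of _ "card A - 1"] exI [of _ 0] exI [of _ "a - (card A - 1)"] exI [of _ b]) auto
  qed
  then obtain a1 b1 a2 b2 where e: "mon2 a b = mon2 a1 b1 * mon2 a2 b2"
    and "mon2 a1 b1 \<in> combos" "mon2 a2 b2 \<in> combos"
    using mon2_combos by (metis mon2_mult)
  then obtain c d where cd: "mon2 a1 b1 = (\<Sum>i\<in>A. const2 (c i) * P i)" "mon2 a2 b2 = (\<Sum>j\<in>A. const2 (d j) * P j)"
    by (auto simp: combos_def)
  have "to_fract (mon2 a b) = (\<Sum>i\<in>A. \<Sum>j\<in>A. scale_fract (c i * d j) (to_fract (P i * P j)))"
    unfolding e cd sum_product
    by (simp add: to_fract_sum' scale_fract_def rhomD [OF rhom_const2] mult_ac)
  then show ?thesis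
    using P_mult_P_in_ideal [OF I mult h] by (auto intro!: rat_fun.subspace_sum I rat_fun.subspace_scale)
qed

text \<open>
  The previous lemma makes the quotient finite-dimensional, so that \<open>quotient_dim\<close> is the size of a
  complement.  As \<open>U\<close> is a unit, Euler's formula shows that the ideal is generated by the two
  derivatives of \<open>h\<close>, which are forms of degree \<open>card A - 1\<close>.
\<close>

lemma quotient_dim_ge:
  assumes U: "c2 U 0 0 \<noteq> 0"
  shows "(card A - 1)\<^sup>2 \<le> quotient_dim local_ring (tjurina_ideal (U * h))"
proof -
  define g where "g = U * h"
  define I where "I = tjurina_ideal g"
  define C where "C = {u * to_fract (deriv_s h) + v * to_fract (deriv_t h) |u v. u \<in> local_ring \<and> v \<in> local_ring}"
  have I: "rat_fun.subspace I" "I \<subseteq> local_ring" "\<And>u x. u \<in> local_ring \<Longrightarrow> x \<in> I \<Longrightarrow> u * x \<in> I"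
    unfolding I_def by (simp_all add: tjurina_ideal_subspace tjurina_ideal_local tjurina_ideal_mult)
  have C: "rat_fun.subspace C" unfolding C_def by (rule subspace_combination)
  have Cm: "u * x \<in> C" if u: "u \<in> local_ring" and x: "x \<in> C" for u x
  proof -
    obtain a b where "x = a * to_fract (deriv_s h) + b * to_fract (deriv_t h)" "a \<in> local_ring" "b \<in> local_ring"
      using x by (auto simp: C_def)
    then show ?thesis unfolding C_def using u
      by (intro CollectI exI [of _ "u * a"] exI [of _ "u * b"]) (auto simp: algebra_simps)
  qed
  have dg: "deriv_s g = U * deriv_s h + h * deriv_s U" "deriv_t g = U * deriv_t h + h * deriv_t U"
    unfolding g_def by (simp_all add: derivationD(2) derivations2)
  obtain v where v: "v \<in> local_ring" "v * to_fract U = 1" using inverse_in_local_ring [OF U] by blast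
  have hI: "to_fract h \<in> I"
  proof -
    have "to_fract h = v * to_fract g" using v(2) by (simp add: g_def flip: mult.assoc)
    then show ?thesis using I(3) [OF v(1)] tjurina_ideal_gens(1) [of g] by (simp add: I_def)
  qed
  have dI: "to_fract w \<in> I" if "to_fract (U * w + h * w') \<in> I" for w w'
  proof -
    have "v * (to_fract (U * w + h * w') - to_fract w' * to_fract h) = (v * to_fract U) * to_fract w"
      by (simp add: algebra_simps)
    also have "\<dots> = to_fract w" by (simp add: v(2))
    finally have e: "to_fract w = v * (to_fract (U * w + h * w') - to_fract w' * to_fract h)" ..
    show ?thesis unfolding e by (intro I(3) rat_fun.subspace_diff I(1) v that hI) auto
  qed
  have dhI: "to_fract (deriv_s h) \<in> I" "to_fract (deriv_t h) \<in> I"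
    using tjurina_ideal_gens(2,3) [of g] dI unfolding dg I_def by blast+
  define K where "K = 2 * (card A - 1)"
  define W where "W = (\<lambda>(a, b). to_fract (mon2 a b)) ` {(i, j). i + j < K}"
  have W: "finite W" "W \<subseteq> local_ring" by (auto simp: W_def)
  have "local_ring \<subseteq> rat_fun.span (W \<union> I)"
  proof (rule local_ring_subset [where K = K])
    fix a b assume "a + b < K"
    then show "to_fract (mon2 a b) \<in> rat_fun.span (W \<union> I)"
      by (intro rat_fun.span_base) (auto simp: W_def)
  next
    fix a b u assume "a + b = K" "u \<in> local_ring"
    then have "u * to_fract (mon2 a b) \<in> I"
      using mon2_in_ideal [OF I(1,3) hI dhI, of a b] I(3) by (simp add: K_def)
    then show "to_fract (mon2 a b) * u \<in> rat_fun.span (W \<union> I)"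
      by (intro rat_fun.span_base) (simp add: mult.commute)
  qed simp
  then obtain B where B: "B \<subseteq> local_ring" "finite B" "rat_fun.independent B" "rat_fun.span B \<inter> I = {0}"
    "rat_fun.span (B \<union> I) = local_ring"
    using complement_exists [OF subspace_local_ring I(1,2) W] by blast
  then have "quotient_dim local_ring I = card B" by (intro quotient_dim_eq I)
  moreover have "(card A - 1)\<^sup>2 \<le> card B"
  proof (rule codim_two_forms_ge [OF hom2_deriv_h])
    have dC: "to_fract (deriv_s h) \<in> C" "to_fract (deriv_t h) \<in> C" unfolding C_def
      by (intro CollectI exI [of _ 1] exI [of _ 0]; simp) (intro CollectI exI [of _ 0] exI [of _ 1]; simp)
    have "to_fract h = scale_fract (1 / of_nat (card A)) (to_fract (const2 (of_nat (card A)) * h))"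
      using two by (simp add: scale_fract_def flip: mult.assoc to_fract_mult)
        (simp add: rhomD [OF rhom_const2] flip: rhomD(3) [OF rhom_const2])
    also have "\<dots> \<in> C" unfolding euler_h to_fract_add to_fract_mult
      by (intro rat_fun.subspace_scale rat_fun.subspace_add C Cm dC) auto
    finally have hC: "to_fract h \<in> C" .
    have "to_fract g \<in> C" "to_fract (deriv_s g) \<in> C" "to_fract (deriv_t g) \<in> C"
      unfolding dg unfolding g_def to_fract_add to_fract_mult mult.commute [of "to_fract h"]
      by (intro rat_fun.subspace_add C Cm dC hC; simp)+
    then have "I \<subseteq> C" unfolding I_def tjurina_ideal_def
      by (auto intro!: rat_fun.subspace_add C Cm)
    then show "I \<subseteq> {u * to_fract (deriv_s h) + v * to_fract (deriv_t h) |u v. u \<in> local_ring \<and> v \<in> local_ring}"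
      unfolding C_def .
  qed (use two B I in auto)
  ultimately show ?thesis by (simp add: I_def g_def)
qed

end


section \<open>Points of the projective plane\<close>

definition loc :: "poly2 \<times> poly2 \<times> poly2 \<Rightarrow> poly3 \<Rightarrow> poly2" where
  "loc v f = (case v of (a, b, c) \<Rightarrow> subst3 const2 f a b c)"

lemma rhom_loc: "rhom (loc v)"
  unfolding loc_def by (cases v) (simp add: rhom_subst3 rhom_const2)

lemma loc_lin: "loc v (lin l) = dot (vmap const2 l) v"
  by (cases v; cases l) (simp add: lin_def Evec_def rhomD [OF rhom_loc],
      simp add: loc_def subst3_simps rhom_const2)

abbreviation point :: "complex \<times> complex \<times> complex \<Rightarrow> proj_plane" where
  "point \<equiv> abs_proj_plane"

lemma proportional_refl_iff: "proportional P P \<longleftrightarrow> P \<noteq> 0"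
  by (cases P) (auto simp: proportional_def zero_triple intro: exI [of _ 1])

lemma proportional_iff: "proportional P Q \<longleftrightarrow> P \<noteq> 0 \<and> (\<exists>c. c \<noteq> 0 \<and> Q = smul c P)"
  by (cases P) (auto simp: proportional_def zero_triple)

lemma point_cases: "\<exists>P. P \<noteq> 0 \<and> p = point P"
  using Quotient_abs_rep [OF Quotient_proj_plane] Quotient_rep_reflp [OF Quotient_proj_plane]
  by (metis proportional_refl_iff)

lemma point_eq_iff:
  assumes "P \<noteq> 0" "Q \<noteq> 0"
  shows "point P = point Q \<longleftrightarrow> cross P Q = 0"
proof -
  have "point P = point Q \<longleftrightarrow> proportional P Q"
    using Quotient_rel [OF Quotient_proj_plane, of P Q] assms by (simp add: proportional_refl_iff)
  also have "\<dots> \<longleftrightarrow> cross P Q = 0"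
  proof
    assume "cross P Q = 0"
    then have "cross Q P = 0" by (cases P; cases Q; simp add: zero_triple mult.commute)
    then obtain c where "Q = smul c P" using cross_eq_0_imp_proportional assms by blast
    moreover have "c \<noteq> 0" using calculation assms by auto
    ultimately show "proportional P Q" using assms by (auto simp: proportional_iff)
  qed (auto simp: proportional_iff cross_smul)
  finally show ?thesis .
qed

lemma vanishes_at_point:
  assumes "P \<noteq> 0"
  shows "vanishes_at f (point P) \<longleftrightarrow> (\<forall>c. c \<noteq> 0 \<longrightarrow> ev (smul c P) f = 0)"
  using vanishes_at.abs_eq [of P f] assms
  by (cases P) (simp add: proportional_refl_iff ev.simps)

lemma vanishes_at_lin: "P \<noteq> 0 \<Longrightarrow> vanishes_at (lin l) (point P) \<longleftrightarrow> dot l P = 0"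
  by (auto simp: vanishes_at_point dot_linear) 

text \<open>
  All three charts have the same shape: an affine plane through a multiple of \<open>P\<close>, spanned by two
  vectors that are independent of \<open>P\<close>.
\<close>

lemma local_equation_point:
  assumes "P \<noteq> 0"
  shows "\<exists>c e1 e2. c \<noteq> 0 \<and> det3 P e1 e2 \<noteq> 0 \<and>
    (\<forall>f. local_equation f (point P) =
       loc (vmap const2 (smul c P) + smul var_s (vmap const2 e1) + smul var_t (vmap const2 e2)) f)"
proof -
  obtain x y z where [simp]: "P = (x, y, z)" by (cases P)
  have le: "local_equation f (point (x, y, z)) = (if x \<noteq> 0 then subst3 const2 f 1 (const2 (y / x) + var_s) (const2 (z / x) + var_t)
     else if y \<noteq> 0 then subst3 const2 f (const2 (x / y) + var_s) 1 (const2 (z / y) + var_t)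
     else subst3 const2 f (const2 (x / z) + var_s) (const2 (y / z) + var_t) 1)" for f
    using local_equation.abs_eq [of P f] assms by (simp add: proportional_refl_iff)
  note [simp] = rhomD(1,4) [OF rhom_const2]
  consider "x \<noteq> 0" | "x = 0" "y \<noteq> 0" | "x = 0" "y = 0" "z \<noteq> 0" using assms by (auto simp: zero_triple)
  then show ?thesis
  proof cases
    case 1
    show ?thesis
      by (rule exI [of _ "1 / x"], rule exI [of _ "(0, 1, 0)"], rule exI [of _ "(0, 0, 1)"])
        (use 1 le in \<open>simp add: loc_def det3_def\<close>)
  next
    case 2
    show ?thesis
      by (rule exI [of _ "1 / y"], rule exI [of _ "(1, 0, 0)"], rule exI [of _ "(0, 0, 1)"])
        (use 2 le in \<open>simp add: loc_def det3_def\<close>)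
  next
    case 3
    show ?thesis
      by (rule exI [of _ "1 / z"], rule exI [of _ "(1, 0, 0)"], rule exI [of _ "(0, 1, 0)"])
        (use 3 le in \<open>simp add: loc_def det3_def\<close>)
  qed
qed

text \<open>
  In an affine chart, the lines that avoid the point have nonzero constant terms and form the unit
  factor \<open>U\<close>.
\<close>

lemma tjurina_number_ge:
  fixes A :: "nat set"
  assumes P: "P \<noteq> 0" and finA: "finite A"
    and ind: "\<And>i j. i \<in> A \<Longrightarrow> j \<in> A \<Longrightarrow> i \<noteq> j \<Longrightarrow> cross (\<nu> i) (\<nu> j) \<noteq> 0"
    and two: "2 \<le> card {i \<in> A. dot (\<nu> i) P = 0}"
  shows "(card {i \<in> A. dot (\<nu> i) P = 0} - 1)\<^sup>2 \<le> tjurina_number (\<Prod>i\<in>A. lin (\<nu> i)) (point P)"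
proof -
  let ?B = "{i \<in> A. dot (\<nu> i) P = 0}"
  obtain c e1 e2 where c: "c \<noteq> 0" and e: "det3 P e1 e2 \<noteq> 0"
    and le: "\<And>f. local_equation f (point P) =
       loc (vmap const2 (smul c P) + smul var_s (vmap const2 e1) + smul var_t (vmap const2 e2)) f"
    using local_equation_point [OF P] by blast
  define \<beta> where "\<beta> i = dot (\<nu> i) e1" for i
  define \<gamma> where "\<gamma> i = dot (\<nu> i) e2" for i
  interpret concurrent_lines ?B \<beta> \<gamma>
  proof
    fix i j assume ij: "i \<in> ?B" "j \<in> ?B" "i \<noteq> j"
    show "\<beta> i * \<gamma> j \<noteq> \<beta> j * \<gamma> i"
    proof
      assume eq: "\<beta> i * \<gamma> j = \<beta> j * \<gamma> i"
      have "smul (det3 P e1 e2) (cross (\<nu> i) (\<nu> j)) = smul (\<beta> i * \<gamma> j - \<beta> j * \<gamma> i) P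
          + smul (dot (\<nu> i) e2 * dot (\<nu> j) P - dot (\<nu> j) e2 * dot (\<nu> i) P) e1
          + smul (dot (\<nu> i) P * dot (\<nu> j) e1 - dot (\<nu> j) P * dot (\<nu> i) e1) e2"
        unfolding \<beta>_def \<gamma>_def
        by (cases P; cases e1; cases e2; cases "\<nu> i"; cases "\<nu> j"; simp add: det3_def algebra_simps)
      also have "\<dots> = 0" using ij eq by simp
      finally have "cross (\<nu> i) (\<nu> j) = 0" using e by (simp add: smul_eq_0_iff)
      then show False using ind ij by simp
    qed
  qed (use finA two in auto)
  define a where "a i = c * dot (\<nu> i) P" for i
  have li: "local_equation (lin (\<nu> i)) (point P) = const2 (a i) + lin2 (\<beta> i) (\<gamma> i)" for i
  proof -
    have "dot (vmap const2 (\<nu> i)) (vmap const2 v) = const2 (dot (\<nu> i) v)" for v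
      by (simp add: vmap_hom [OF rhom_const2])
    then show ?thesis unfolding le loc_lin
      by (simp add: dot_linear a_def \<beta>_def \<gamma>_def lin2_def mult.commute)
  qed
  define U where "U = (\<Prod>i\<in>A - ?B. const2 (a i) + lin2 (\<beta> i) (\<gamma> i))"
  have "c2 U 0 0 \<noteq> 0"
  proof -
    have hc: "rhom (\<lambda>p. c2 p 0 0)" by (simp add: rhom_def c2_00_mult)
    have l0: "c2 (lin2 b d) 0 0 = 0" for b d using hom2_const_var(4) [of b d] by (simp add: hom2_def)
    have "c2 U 0 0 = (\<Prod>i\<in>A - ?B. c2 (const2 (a i) + lin2 (\<beta> i) (\<gamma> i)) 0 0)"
      unfolding U_def by (rule rhomD(9) [OF hc])
    also have "\<dots> = (\<Prod>i\<in>A - ?B. a i)" by (simp add: l0) (simp add: const2_def)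
    also have "\<dots> \<noteq> 0" using finA c by (auto simp: a_def)
    finally show ?thesis .
  qed
  moreover have "local_equation (\<Prod>i\<in>A. lin (\<nu> i)) (point P) = U * h"
  proof -
    have "local_equation (\<Prod>i\<in>A. lin (\<nu> i)) (point P) = (\<Prod>i\<in>A. const2 (a i) + lin2 (\<beta> i) (\<gamma> i))"
      unfolding li [symmetric] unfolding le by (rule rhomD(9) [OF rhom_loc])
    also have "\<dots> = U * (\<Prod>i\<in>?B. const2 (a i) + lin2 (\<beta> i) (\<gamma> i))"
      unfolding U_def by (rule prod.subset_diff) (use finA in auto)
    also have "(\<Prod>i\<in>?B. const2 (a i) + lin2 (\<beta> i) (\<gamma> i)) = h"
      unfolding h_def by (rule prod.cong) (auto simp: a_def rhomD [OF rhom_const2])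
    finally show ?thesis .
  qed
  ultimately show ?thesis using quotient_dim_ge [of U] by (simp add: tjurina_number_def)
qed

section \<open>Homogeneous polynomials\<close>

abbreviation c3 :: "poly3 \<Rightarrow> nat \<Rightarrow> nat \<Rightarrow> nat \<Rightarrow> complex" where
  "c3 f i j k \<equiv> coeff (coeff (coeff f i) j) k"

definition mon3 :: "nat \<Rightarrow> nat \<Rightarrow> nat \<Rightarrow> complex \<Rightarrow> poly3" where
  "mon3 i j k c = monom (monom (monom c k) j) i"

lemma c3_mon3: "c3 (mon3 a b c u) i j k = (if i = a \<and> j = b \<and> k = c then u else 0)"
  by (auto simp: mon3_def)

lemma poly_monom_induct:
  assumes "\<And>p q. Q p \<Longrightarrow> Q q \<Longrightarrow> Q (p + q)" "\<And>n a. Q (monom a n)"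
  shows "Q p"
proof -
  have "Q (\<Sum>i\<in>A. monom (u i) i)" for A :: "nat set" and u
    by (induction A rule: infinite_finite_induct) (use assms assms(2) [of 0 0] in auto)
  from this [of "coeff p" "{..degree p}"] show ?thesis by (simp add: poly_as_sum_of_monoms)
qed

lemma poly3_induct:
  assumes add: "\<And>p q. Q p \<Longrightarrow> Q q \<Longrightarrow> Q (p + q)" and mon: "\<And>i j k c. Q (mon3 i j k c)"
  shows "Q (p :: poly3)"
proof (rule poly_monom_induct [where Q = Q])
  fix n and a :: "complex poly poly"
  show "Q (monom a n)"
  proof (rule poly_monom_induct [where Q = "\<lambda>a. Q (monom a n)"])
    fix m and b :: "complex poly"
    show "Q (monom (monom b m) n)"
      by (rule poly_monom_induct [where Q = "\<lambda>b. Q (monom (monom b m) n)"])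
        (use add mon in \<open>auto simp: mon3_def simp flip: add_monom\<close>)
  qed (use add in \<open>auto simp flip: add_monom\<close>)
qed (rule add)

lemma mon3_eq: "mon3 i j k c = C3 c * X3 ^ i * Y3 ^ j * Z3 ^ k"
proof -
  have X: "X3 ^ i = monom 1 i" by (simp add: X3_def monom_altdef)
  have Y: "Y3 ^ j = [:monom 1 j:]" by (simp add: Y3_def monom_altdef poly_const_pow)
  have Z: "Z3 ^ k = [:[:monom 1 k:]:]" by (simp add: Z3_def monom_altdef poly_const_pow)
  show ?thesis unfolding X Y Z by (simp add: C3_def mon3_def smult_monom)
qed

text \<open>
  The polynomial \<open>f(u x, u y, u z)\<close> in a new variable \<open>u\<close>.  A polynomial is homogeneous of
  degree \<open>m\<close> if and only if this is \<open>f u^m\<close>, which reduces degree arguments to cancellation.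
\<close>

definition scl :: "poly3 \<Rightarrow> poly3 poly" where
  "scl f = subst3 (\<lambda>c. [:C3 c:]) f [:0, X3:] [:0, Y3:] [:0, Z3:]"

lemma rhom_scl: "rhom scl"
  unfolding scl_def by (intro rhom_subst3 rhom_comp [OF rhom_const_poly rhom_C3])

lemma scl_mon3: "scl (mon3 i j k c) = monom (mon3 i j k c) (i + j + k)"
proof -
  have p: "[:0, p:] ^ n = monom (p ^ n) n" for p :: poly3 and n
    by (induction n) (simp_all add: monom_Suc smult_monom)
  have "scl (mon3 i j k c) = [:C3 c:] * [:0, X3:] ^ i * [:0, Y3:] ^ j * [:0, Z3:] ^ k"
    unfolding mon3_eq rhomD(3,7) [OF rhom_scl]
    by (simp add: scl_def subst3_simps rhom_comp [OF rhom_const_poly rhom_C3])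
  also have "\<dots> = monom (mon3 i j k c) (i + j + k)"
    unfolding p mon3_eq by (simp add: mult_monom smult_monom mult.assoc)
  finally show ?thesis .
qed

text \<open>
  The coefficients of \<open>scl f\<close> are the homogeneous components of \<open>f\<close>.
\<close>

lemma c3_coeff_scl: "c3 (coeff (scl f) n) i j k = (if i + j + k = n then c3 f i j k else 0)"
  by (induction f rule: poly3_induct) (auto simp: rhomD [OF rhom_scl] scl_mon3 c3_mon3)

text \<open>
  Homogeneous of degree \<open>d - s\<close>, where a negative degree is allowed and forces the polynomial
  to vanish.
\<close>

definition hg :: "nat \<Rightarrow> nat \<Rightarrow> poly3 \<Rightarrow> bool" where
  "hg s d f \<longleftrightarrow> (\<forall>i j k. c3 f i j k \<noteq> 0 \<longrightarrow> i + j + k + s = d)"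

lemma homogeneous_iff_hg: "homogeneous m f \<longleftrightarrow> hg 0 m f"
  by (simp add: homogeneous_def hg_def)

lemma hg_shift: "hg (s + t) (d + t) f \<longleftrightarrow> hg s d f"
  by (simp add: hg_def flip: add.assoc)

lemma hg_iff: "hg s d f \<longleftrightarrow> monom 1 s * scl f = monom f d"
proof
  assume h: "hg s d f"
  show "monom 1 s * scl f = monom f d"
  proof (intro poly_eqI)
    fix n i j k
    show "c3 (coeff (monom 1 s * scl f) n) i j k = c3 (coeff (monom f d) n) i j k"
    proof (cases "c3 f i j k = 0")
      case False
      then have "i + j + k + s = d" using h by (simp add: hg_def)
      then show ?thesis by (auto simp: coeff_monom_mult c3_coeff_scl)
    qed (simp add: coeff_monom_mult c3_coeff_scl)
  qed
next
  assume e: "monom 1 s * scl f = monom f d"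
  show "hg s d f" unfolding hg_def
  proof (intro allI impI)
    fix i j k assume nz: "c3 f i j k \<noteq> 0"
    have "c3 (coeff (monom 1 s * scl f) (i + j + k + s)) i j k = c3 f i j k"
      by (simp add: coeff_monom_mult c3_coeff_scl)
    then show "i + j + k + s = d" using nz unfolding e by (auto split: if_splits)
  qed
qed

lemma hg_mult:
  assumes "hg s d f" "hg s' d' g"
  shows "hg (s + s') (d + d') (f * g)"
proof -
  have "monom 1 (s + s') * scl (f * g) = (monom 1 s * scl f) * (monom 1 s' * scl g)"
    using mult_monom [of "1::poly3" s 1 s'] by (simp add: rhomD [OF rhom_scl] mult_ac)
  then show ?thesis using assms by (simp add: hg_iff mult_monom)
qed

lemma hg_cancel:
  assumes "hg s d f" "f \<noteq> 0" "hg (s + s') (d + d') (f * g)"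
  shows "hg s' d' g"
proof -
  have "monom f d * (monom 1 s' * scl g) = (monom 1 s * scl f) * (monom 1 s' * scl g)"
    using assms(1) by (simp add: hg_iff)
  also have "\<dots> = monom 1 (s + s') * scl (f * g)"
    using mult_monom [of "1::poly3" s 1 s'] by (simp add: rhomD [OF rhom_scl] mult_ac)
  also have "\<dots> = monom f d * monom g d'" using assms(3) by (simp add: hg_iff mult_monom)
  finally show ?thesis using assms(2) by (simp add: hg_iff)
qed

lemma hg_0 [simp]: "hg s d 0" by (simp add: hg_def)

lemma hg_add: "hg s d f \<Longrightarrow> hg s d g \<Longrightarrow> hg s d (f + g)"
  unfolding hg_def by (metis add_0 coeff_add)

lemma hg_minus: "hg s d f \<Longrightarrow> hg s d (- f)"
  by (simp add: hg_def)

lemma hg_diff: "hg s d f \<Longrightarrow> hg s d g \<Longrightarrow> hg s d (f - g)"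
  using hg_add [of s d f "- g"] by (simp add: hg_minus)

lemma hg_sum: "(\<And>i. i \<in> A \<Longrightarrow> hg s d (u i)) \<Longrightarrow> hg s d (sum u A)"
  by (induction A rule: infinite_finite_induct) (auto intro: hg_add)

lemma hg_C3: "hg 0 0 (C3 c)" and hg_vars: "hg 0 1 X3" "hg 0 1 Y3" "hg 0 1 Z3"
  by (auto simp: hg_def C3_def X3_def Y3_def Z3_def coeff_pCons split: nat.splits)

lemma hg_C3_mult: "hg s d f \<Longrightarrow> hg s d (C3 c * f)"
  using hg_mult [OF hg_C3, of s d f c] by simp

lemma hg_lin: "hg 0 1 (lin l)"
  using hg_vars by (cases l) (auto simp: lin_def Evec_def intro!: hg_add hg_C3_mult)

lemma hg_prod_lin: "finite A \<Longrightarrow> hg 0 (card A) (\<Prod>i\<in>A. lin (\<nu> i))"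
proof (induction A rule: finite_induct)
  case empty
  show ?case using hg_C3 [of 1] rhomD(1) [OF rhom_C3] by simp
next
  case (insert x A)
  then show ?case using hg_mult [OF hg_lin [of "\<nu> x"] insert.IH] by simp
qed

lemma hg_negative: "hg s d f \<Longrightarrow> d < s \<Longrightarrow> f = 0"
  by (force simp: hg_def poly_eq_iff)

lemma hg_constant:
  assumes "hg s s f"
  shows "\<exists>c. f = C3 c"
proof
  show "f = C3 (c3 f 0 0 0)"
  proof (intro poly_eqI)
    fix i j k
    show "c3 f i j k = c3 (C3 (c3 f 0 0 0)) i j k"
      using assms by (auto simp: hg_def C3_def coeff_pCons split: nat.splits)
  qed
qed

lemma linear_form_exists:
  assumes "homogeneous 1 f"
  shows "\<exists>l. f = lin l"
proof
  let ?l = "(c3 f 1 0 0, c3 f 0 1 0, c3 f 0 0 1)"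
  show "f = lin ?l"
  proof (intro poly_eqI)
    fix i j k
    have "c3 f i j k = 0" if "i + j + k \<noteq> 1" using assms that by (auto simp: homogeneous_def)
    moreover consider "i + j + k \<noteq> 1" | "i = 1" "j = 0" "k = 0" | "i = 0" "j = 1" "k = 0"
      | "i = 0" "j = 0" "k = 1" by linarith
    ultimately show "c3 f i j k = c3 (lin ?l) i j k"
      by cases (auto simp: lin_def Evec_def C3_def X3_def Y3_def Z3_def coeff_pCons split: nat.splits)
  qed
qed

text \<open>
  Stated without division, so that it includes the case of negative degree.
\<close>

lemma ev_scale:
  assumes "hg s d f"
  shows "u ^ s * ev (smul u P) f = u ^ d * ev P f"
proof -
  let ?h = "\<lambda>p. poly (map_poly (ev P) p) u"
  have h: "rhom ?h" by (intro rhom_poly_map_poly rhom_ev)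
  have hm: "?h (monom p n) = u ^ n * ev P p" for p n
    by (simp add: map_poly_monom poly_monom)
  have hp: "?h [:p, q:] = ev P p + u * ev P q" for p q
    by (simp add: poly_map_poly_pCons)
  have "?h (scl f) = ev (smul u P) f"
  proof (rule poly3_hom_eqI [where h = "\<lambda>f. ?h (scl f)" and g = "ev (smul u P)"])
    show "rhom (\<lambda>f. ?h (scl f))" by (rule rhom_comp [OF h rhom_scl])
    have c: "rhom (\<lambda>c. [:C3 c:])" by (rule rhom_comp [OF rhom_const_poly rhom_C3])
    show "?h (scl (C3 a)) = ev (smul u P) (C3 a)" for a
      using hp [of "C3 a" 0] by (simp add: scl_def subst3_simps c)
    show "?h (scl X3) = ev (smul u P) X3" "?h (scl Y3) = ev (smul u P) Y3" "?h (scl Z3) = ev (smul u P) Z3"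
      unfolding scl_def subst3_simps [OF c] hp
      by (cases P; simp add: ev.simps subst3_simps rhom_id)+
  qed (rule rhom_ev)
  moreover have "?h (monom 1 s * scl f) = ?h (monom f d)" using assms by (simp add: hg_iff)
  ultimately show ?thesis unfolding rhomD(3) [OF h] hm by simp
qed

lemma finite_triples [simp]: "finite {(i, j, k). i + j + k + s = (e::nat)}"
  by (rule finite_subset [of _ "{..e} \<times> {..e} \<times> {..e}"]) auto

lemma card_triples: "card {(i, j, k). i + j + k + 3 = (e::nat)} = (e - 1) choose 2"
proof (cases "e < 3")
  case True
  then have e: "{(i, j, k). i + j + k + 3 = e} = {}" by auto
  have "(e - 1) choose 2 = 0" using True by (simp add: binomial_eq_0)
  then show ?thesis unfolding e by simp
next
  case False
  have "{(i, j, k). i + j + k + 3 = e} = (\<lambda>(i, j). (i, j, e - 3 - i - j)) ` {(i, j). i + j < e - 2}"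
    using False by (auto simp: image_iff)
  moreover have "inj_on (\<lambda>(i, j). (i, j, e - 3 - i - j)) {(i, j). i + j < e - 2}"
    by (auto simp: inj_on_def)
  ultimately have "2 * card {(i, j, k). i + j + k + 3 = e} = (e - 2) * (e - 2 + 1)"
    by (simp add: card_image card_pairs_less)
  moreover have "e - 1 = Suc (e - 2)" using False by simp
  ultimately show ?thesis by (simp add: choose_two)
qed


section \<open>Dimension of spaces of polynomial vector fields\<close>

definition tscale :: "complex \<Rightarrow> triple \<Rightarrow> triple" where
  "tscale c v = smul (C3 c) v"

interpretation T3: vector_space tscale
proof
  fix a b :: complex and x y :: triple
  show "tscale a (x + y) = tscale a x + tscale a y" "tscale (a + b) x = tscale a x + tscale b x"
    "tscale a (tscale b x) = tscale (a * b) x" "tscale 1 x = x"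
    by (cases x; cases y; simp add: tscale_def rhomD [OF rhom_C3] algebra_simps)+
qed

text \<open>
  An upper bound for the dimension that includes finite-dimensionality.
\<close>

definition span_bound :: "triple set \<Rightarrow> nat \<Rightarrow> bool" where
  "span_bound V n \<longleftrightarrow> (\<exists>B. finite B \<and> card B \<le> n \<and> V \<subseteq> T3.span B)"

definition linear_functional :: "(triple \<Rightarrow> complex) \<Rightarrow> bool" where
  "linear_functional \<phi> \<longleftrightarrow> (\<forall>x y. \<phi> (x + y) = \<phi> x + \<phi> y) \<and> (\<forall>c x. \<phi> (tscale c x) = c * \<phi> x)"

lemma linear_functionalD:
  assumes "linear_functional \<phi>"
  shows "\<phi> (x + y) = \<phi> x + \<phi> y" "\<phi> (tscale c x) = c * \<phi> x"
  using assms unfolding linear_functional_def by blast+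

lemma linear_functional_0: "linear_functional \<phi> \<Longrightarrow> \<phi> 0 = 0"
  unfolding linear_functional_def using T3.scale_zero_left [of 0] by (metis mult_zero_left)

lemma subspace_kernel:
  assumes "T3.subspace V" "linear_functional \<phi>"
  shows "T3.subspace {v \<in> V. \<phi> v = 0}"
  using assms linear_functional_0 [OF assms(2)]
  by (auto simp: T3.subspace_def linear_functional_def)

lemma span_bound_functional:
  assumes V: "T3.subspace V" and \<phi>: "linear_functional \<phi>" and b: "span_bound {v \<in> V. \<phi> v = 0} n"
  shows "span_bound V (Suc n)"
proof (cases "\<exists>w\<in>V. \<phi> w \<noteq> 0")
  case False
  then have "{v \<in> V. \<phi> v = 0} = V" by auto
  then show ?thesis using b by (force simp: span_bound_def)
next
  case True
  then obtain w where w: "w \<in> V" "\<phi> w \<noteq> 0" by blast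
  obtain B where B: "finite B" "card B \<le> n" "{v \<in> V. \<phi> v = 0} \<subseteq> T3.span B"
    using b by (auto simp: span_bound_def)
  have "V \<subseteq> T3.span (insert w B)"
  proof
    fix v assume v: "v \<in> V"
    define c where "c = \<phi> v / \<phi> w"
    have e: "v - tscale c w = v + tscale (- c) w" by (simp add: T3.scale_minus_left)
    have "v - tscale c w \<in> V" using v w V by (intro T3.subspace_diff T3.subspace_scale)
    moreover have "\<phi> (v - tscale c w) = 0"
      unfolding e linear_functionalD [OF \<phi>] using w(2) by (simp add: c_def)
    ultimately have "v - tscale c w \<in> T3.span B" using B(3) by blast
    then show "v \<in> T3.span (insert w B)" unfolding T3.span_insert by blast
  qed
  moreover have "card (insert w B) \<le> Suc n" using B by (simp add: card_insert_if)
  ultimately show ?thesis using B(1) unfolding span_bound_def by blast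
qed

lemma span_bound_functionals:
  assumes "finite J" "T3.subspace V" "\<And>t. t \<in> J \<Longrightarrow> linear_functional (\<phi> t)"
    and "span_bound {v \<in> V. \<forall>t\<in>J. \<phi> t v = 0} n"
  shows "span_bound V (n + card J)"
  using assms
proof (induction J arbitrary: V)
  case (insert t J)
  have "{v \<in> {v \<in> V. \<phi> t v = 0}. \<forall>t\<in>J. \<phi> t v = 0} = {v \<in> V. \<forall>t\<in>insert t J. \<phi> t v = 0}" by auto
  then have "span_bound {v \<in> V. \<phi> t v = 0} (n + card J)"
    using insert.prems by (intro insert.IH subspace_kernel) auto
  then have "span_bound V (Suc (n + card J))"
    using insert.prems by (intro span_bound_functional) auto
  then show ?case using insert.hyps by simp
qed simp

text \<open>
  Linear independence is required of the family rather than of its range, so that members of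
  different kinds need not be told apart beforehand.
\<close>

lemma card_le_if_span_bound:
  assumes "span_bound V n" "finite J" "fam ` J \<subseteq> V"
    and ind: "\<And>c x. (\<Sum>x\<in>J. tscale (c x) (fam x)) = 0 \<Longrightarrow> x \<in> J \<Longrightarrow> c x = 0"
  shows "card J \<le> n"
proof -
  obtain B where B: "finite B" "card B \<le> n" "V \<subseteq> T3.span B" using assms(1) by (auto simp: span_bound_def)
  have inj: "inj_on fam J"
  proof (rule inj_onI, rule ccontr)
    fix x y assume xy: "x \<in> J" "y \<in> J" "fam x = fam y" "x \<noteq> y"
    let ?c = "\<lambda>z. if z = x then 1 else if z = y then - 1 else (0::complex)"
    have "(\<Sum>z\<in>J. tscale (?c z) (fam z)) = (\<Sum>z\<in>{x, y}. tscale (?c z) (fam z))"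
      using xy assms(2) by (intro sum.mono_neutral_right) auto
    also have "\<dots> = 0" using xy by simp
    finally have "?c x = 0" by (rule ind) (rule xy)
    then show False by simp
  qed
  have "T3.independent (fam ` J)"
  proof (rule T3.independent_if_scalars_zero)
    fix f v assume *: "(\<Sum>v\<in>fam ` J. tscale (f v) v) = 0" "v \<in> fam ` J"
    then have "(\<Sum>x\<in>J. tscale (f (fam x)) (fam x)) = 0" using inj by (simp add: sum.reindex)
    then show "f v = 0" using ind [of "\<lambda>x. f (fam x)"] *(2) by auto
  qed (use assms in auto)
  then have "card (fam ` J) \<le> card B"
    using T3.independent_span_bound [OF B(1)] assms(3) B(3) by blast
  then show ?thesis using B(2) inj by (simp add: card_image)
qed


section \<open>Vector fields tangent to lines\<close>

text \<open>
  The condition \<open>hg 3 d\<close> means degree \<open>d - 3\<close>.  For \<open>d < 3\<close> it leaves only the zero field, which is where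
  the induction on the number of lines starts.
\<close>

definition tangent_fields :: "(nat \<Rightarrow> complex \<times> complex \<times> complex) \<Rightarrow> nat \<Rightarrow> nat \<Rightarrow> triple set" where
  "tangent_fields \<nu> k d = {(a, b, c). hg 3 d a \<and> hg 3 d b \<and> hg 3 d c \<and>
     (\<forall>i<k. lin (\<nu> i) dvd dot (vmap C3 (\<nu> i)) (a, b, c))}"

lemma vmap_C3: "vmap C3 (smul c P) = smul (C3 c) (vmap C3 P)"
  by (simp add: vmap_hom [OF rhom_C3])

lemma dot_tscale: "dot l (tscale c v) = C3 c * dot l v"
  by (simp add: tscale_def dot_linear)

lemma subspace_tangent_fields: "T3.subspace (tangent_fields \<nu> k d)"
proof (rule T3.subspaceI)
  fix x y :: triple and c
  have "dot v (0, 0, 0) = 0" for v :: triple by (cases v) simp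
  then show "0 \<in> tangent_fields \<nu> k d" by (simp add: tangent_fields_def zero_triple)
  assume x: "x \<in> tangent_fields \<nu> k d"
  obtain a1 b1 c1 where [simp]: "x = (a1, b1, c1)" by (cases x)
  show "tscale c x \<in> tangent_fields \<nu> k d"
    using x dot_tscale [of _ c x] by (auto simp: tangent_fields_def tscale_def hg_C3_mult)
  assume y: "y \<in> tangent_fields \<nu> k d"
  obtain a2 b2 c2 where [simp]: "y = (a2, b2, c2)" by (cases y)
  show "x + y \<in> tangent_fields \<nu> k d"
    using x y dot_linear(5) [of _ x y] by (auto simp: tangent_fields_def intro: hg_add dvd_add)
qed

text \<open>
  The affine line \<open>a + t b\<close> misses only the point \<open>b\<close> of the projective line \<open>l = 0\<close>.  All but finitely
  many vectors \<open>b + c a\<close> are admissible directions.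
\<close>

lemma line_parametrisation:
  fixes \<nu> :: "nat \<Rightarrow> complex \<times> complex \<times> complex"
  assumes l: "l \<noteq> 0" and ne: "\<And>i. i < k \<Longrightarrow> cross l (\<nu> i) \<noteq> 0"
  shows "\<exists>a b. cross a b = l \<and> (\<forall>i<k. dot (\<nu> i) b \<noteq> 0)"
proof -
  obtain a b where ab: "cross a b = l" using exists_cross_eq [OF l] by blast
  let ?bad = "(\<lambda>i. - dot (\<nu> i) b / dot (\<nu> i) a) ` {..<k}"
  obtain c :: complex where c: "c \<notin> ?bad"
    using ex_new_if_finite [OF infinite_UNIV_char_0, of ?bad] by blast
  have "dot (\<nu> i) (b + smul c a) \<noteq> 0" if "i < k" for i
  proof
    assume "dot (\<nu> i) (b + smul c a) = 0"
    then have 0: "dot (\<nu> i) b + c * dot (\<nu> i) a = 0" by (simp add: dot_linear)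
    show False
    proof (cases "dot (\<nu> i) a = 0")
      case True
      then show False using 0 ne [OF that] cross_cross_left [of a b "\<nu> i"] by (simp add: ab)
    next
      case False
      then have "c = - dot (\<nu> i) b / dot (\<nu> i) a" using 0 by (simp add: field_simps eq_neg_iff_add_eq_0)
      then show False using c that by blast
    qed
  qed
  moreover have "cross a (b + smul c a) = l" unfolding ab [symmetric]
    by (cases a; cases b; simp add: algebra_simps)
  ultimately show ?thesis by blast
qed

definition to_line :: "complex \<times> complex \<times> complex \<Rightarrow> complex \<times> complex \<times> complex \<Rightarrow> poly3 \<Rightarrow> complex poly" where
  "to_line a b f = (case (a, b) of ((a1, a2, a3), (b1, b2, b3)) \<Rightarrow>
     subst3 (\<lambda>c. [:c:]) f [:a1, b1:] [:a2, b2:] [:a3, b3:])"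

lemma rhom_to_line: "rhom (to_line a b)"
  unfolding to_line_def by (cases a; cases b) (simp add: rhom_subst3 rhom_const_poly)

lemma poly_to_line: "poly (to_line a b f) t = ev (a + smul t b) f"
proof (rule poly3_hom_eqI [where h = "\<lambda>f. poly (to_line a b f) t" and g = "ev (a + smul t b)"])
  have "rhom (\<lambda>p. poly p t)" by (simp add: rhom_def)
  then show "rhom (\<lambda>f. poly (to_line a b f) t)" by (rule rhom_comp [OF _ rhom_to_line])
  show "poly (to_line a b (C3 c)) t = ev (a + smul t b) (C3 c)" for c
    by (cases a; cases b; simp add: to_line_def subst3_simps rhom_const_poly)
  show "poly (to_line a b X3) t = ev (a + smul t b) X3"
    "poly (to_line a b Y3) t = ev (a + smul t b) Y3"
    "poly (to_line a b Z3) t = ev (a + smul t b) Z3"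
    by (cases a; cases b; simp add: to_line_def ev.simps subst3_simps rhom_const_poly rhom_id)+
qed (rule rhom_ev)

lemma degree_to_line:
  assumes "hg s d f"
  shows "degree (to_line a b f) \<le> d - s"
proof -
  obtain a1 a2 a3 b1 b2 b3 where [simp]: "a = (a1, a2, a3)" "b = (b1, b2, b3)" by (cases a; cases b)
  let ?m = "\<lambda>i j k. [:c3 f i j k:] * [:a3, b3:] ^ k * [:a2, b2:] ^ j * [:a1, b1:] ^ i"
  have "to_line a b f = (\<Sum>i\<le>degree f. \<Sum>j\<le>degree (coeff f i). \<Sum>k\<le>degree (coeff (coeff f i) j). ?m i j k)"
    by (simp add: to_line_def subst3_eq_sum sum_distrib_right del: mult_pCons_left mult_pCons_right)
  also have "degree \<dots> \<le> d - s"
  proof (intro degree_sum_le)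
    fix i j k
    show "degree (?m i j k) \<le> d - s"
    proof (cases "c3 f i j k = 0")
      case False
      then have "i + j + k + s = d" using assms by (simp add: hg_def)
      then have ij: "i + j + k = d - s" by simp
      have lin: "degree ([:p, q:] ^ n) \<le> n" for p q :: complex and n
        using degree_power_le [of "[:p, q:]" n] by (rule order_trans) (simp split: if_splits)
      have "degree (?m i j k) \<le> ((0 + k) + j) + i"
        by (intro order_trans [OF degree_mult_le] add_mono lin) simp
      then show ?thesis using ij by simp
    qed simp
  qed simp_all
  finally show ?thesis .
qed

lemma poly_eq_0_if_many_roots:
  fixes p :: "complex poly"
  assumes "finite A" "degree p < card A" "\<And>t. t \<in> A \<Longrightarrow> poly p t = 0"
  shows "p = 0"
proof (rule ccontr)
  assume "p \<noteq> 0"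
  then have "card {t. poly p t = 0} \<le> degree p" "finite {t. poly p t = 0}"
    by (simp_all add: card_poly_roots_bound poly_roots_finite)
  moreover have "A \<subseteq> {t. poly p t = 0}" using assms by auto
  ultimately show False using card_mono [of "{t. poly p t = 0}" A] assms(2) by simp
qed

lemma degree_dot_const:
  assumes "degree x \<le> q" "degree y \<le> q" "degree z \<le> q"
  shows "degree (dot (x, y, z) (vmap (\<lambda>c. [:c:]) m)) \<le> (q::nat)"
  using assms by (cases m) (auto intro!: degree_add_le order_trans [OF degree_smult_le])

text \<open>
  Adding a line to an arrangement.  Restrict a tangent field of degree \<open>k - 2\<close> to the new line,
  parametrised by \<open>a + t b\<close>, and write it as \<open>A(t) a + B(t) b\<close>.  The polynomial \<open>t A - B\<close> has degree
  at most \<open>k - 1\<close> and vanishes at the points where the new line meets the others, since the field is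
  tangent to two lines there.  If it also vanishes at enough further points to have \<open>k\<close> zeros, then
  \<open>B = t A\<close>, hence \<open>A\<close> has degree less than \<open>k - 2\<close>; if moreover \<open>A\<close> has \<open>k - 2\<close> zeros, the field
  vanishes on the new line, and division by its equation leaves a tangent field of the old lines.
\<close>

lemma tangent_fields_add_line:
  fixes \<nu> :: "nat \<Rightarrow> complex \<times> complex \<times> complex" and a b and k :: nat
  defines "S \<equiv> (\<lambda>i. - dot (\<nu> i) a / dot (\<nu> i) b) ` {..<k}"
  assumes k: "2 \<le> k" and l: "\<nu> k \<noteq> 0" and ne: "\<And>i. i < k \<Longrightarrow> cross (\<nu> i) (\<nu> k) \<noteq> 0"
    and ab: "cross a b = \<nu> k" and nb: "\<And>i. i < k \<Longrightarrow> dot (\<nu> i) b \<noteq> 0"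
    and bound: "span_bound (tangent_fields \<nu> k k) n"
  shows "span_bound (tangent_fields \<nu> (Suc k) (Suc k)) (n + (k - 2) + (k - card S))"
proof -
  let ?V = "tangent_fields \<nu> (Suc k) (Suc k)"
  let ?c = "vmap (\<lambda>c::complex. [:c:])"
  have finS: "finite S" and cardS: "card S \<le> k"
    unfolding S_def using card_image_le [of "{..<k}"] by auto
  obtain e where e: "dot (\<nu> k) e = 1" using exists_dot_eq_1 [OF l] by blast
  have abe: "det3 a b e = 1" using e ab by (simp add: det3_eq_dot_cross(1))
  have ma: "dot (\<nu> k) a = 0" and mb: "dot (\<nu> k) b = 0"
    unfolding ab [symmetric] by (rule dot_cross_self)+
  define P where "P t = a + smul t b" for t
  define Ae where "Ae t \<theta> = det3 (vmap (ev (P t)) \<theta>) b e" for t \<theta>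
  define Be where "Be t \<theta> = det3 a (vmap (ev (P t)) \<theta>) e" for t \<theta>
  define G where "G t \<theta> = t * Ae t \<theta> - Be t \<theta>" for t \<theta>
  have vt: "vmap (ev Q) (tscale c x) = smul c (vmap (ev Q) x)" for Q c x
    by (simp add: tscale_def vmap_hom [OF rhom_ev])
  have linA: "linear_functional (Ae t)" and linB: "linear_functional (Be t)" for t
    unfolding linear_functional_def Ae_def Be_def vt
    by (simp_all only: vmap_hom(5) [OF rhom_ev] det3_linear simp_thms)
  have linG: "linear_functional (G t)" for t
    unfolding linear_functional_def G_def linear_functionalD [OF linA] linear_functionalD [OF linB]
    by (auto simp: algebra_simps)
  obtain J1 where J1: "finite J1" "card J1 = k - card S" "J1 \<subseteq> UNIV - S"
    using infinite_arbitrarily_large [of "UNIV - S :: complex set" "k - card S"] finS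
      infinite_UNIV_char_0 by (metis Diff_infinite_finite)
  obtain J2 :: "complex set" where J2: "finite J2" "card J2 = k - 2"
    using infinite_arbitrarily_large [OF infinite_UNIV_char_0] by blast
  let ?V' = "{\<theta> \<in> {\<theta> \<in> ?V. \<forall>t\<in>J1. G t \<theta> = 0}. \<forall>t\<in>J2. Ae t \<theta> = 0}"
  have "\<exists>\<theta>'\<in>tangent_fields \<nu> k k. \<theta> = smul (lin (\<nu> k)) \<theta>'" if \<theta>: "\<theta> \<in> ?V'" for \<theta>
  proof -
    obtain x y z where xyz: "\<theta> = (x, y, z)" by (cases \<theta>)
    have hgs: "hg 3 (Suc k) x" "hg 3 (Suc k) y" "hg 3 (Suc k) z"
      and tang: "\<And>i. i < Suc k \<Longrightarrow> lin (\<nu> i) dvd dot (vmap C3 (\<nu> i)) \<theta>"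
      using \<theta> by (auto simp: tangent_fields_def xyz)
    have tang_ev: "dot (\<nu> i) (vmap (ev Q) \<theta>) = 0" if "i < Suc k" "dot (\<nu> i) Q = 0" for i Q
      using ev_eq_0_if_lin_dvd [OF tang that(2)] that(1) by (simp add: vmap_hom [OF rhom_ev])
    define W where "W = vmap (to_line a b) \<theta>"
    define Ap where "Ap = det3 W (?c b) (?c e)"
    define Bp where "Bp = det3 (?c a) W (?c e)"
    have pt: "rhom (\<lambda>p::complex poly. poly p t)" for t by (simp add: rhom_def)
    have Wt: "vmap (\<lambda>p. poly p t) W = vmap (ev (P t)) \<theta>" for t
      by (simp add: W_def xyz poly_to_line P_def)
    have ct: "vmap (\<lambda>p. poly p t) (?c u) = u" for u t by (cases u) simp
    have Apt: "poly Ap t = Ae t \<theta>" and Bpt: "poly Bp t = Be t \<theta>" for t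
      by (simp_all add: Ap_def Bp_def Ae_def Be_def vmap_hom(3) [OF pt] Wt ct)
    have decomp: "vmap (ev (P t)) \<theta> = smul (Ae t \<theta>) a + smul (Be t \<theta>) b" for t
    proof -
      have "dot (\<nu> k) (P t) = 0" by (simp add: P_def dot_linear ma mb)
      then have "det3 a b (vmap (ev (P t)) \<theta>) = 0"
        using tang_ev [of k] by (simp add: det3_eq_dot_cross(1) ab)
      then show ?thesis using cramer [of a b e "vmap (ev (P t)) \<theta>"]
        by (simp add: abe Ae_def Be_def) (cases "vmap (ev (P t)) \<theta>"; simp)
    qed
    have dW: "degree (to_line a b x) \<le> k - 2" "degree (to_line a b y) \<le> k - 2" "degree (to_line a b z) \<le> k - 2"
      using hgs [THEN degree_to_line, of a b] by simp_all
    have dA: "degree Ap \<le> k - 2" and dB: "degree Bp \<le> k - 2"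
      unfolding Ap_def Bp_def det3_cyclic [of "?c a"]
      unfolding det3_eq_dot_cross(2) vmap_hom(2) [OF rhom_const_poly, symmetric] W_def xyz vmap.simps
      by (intro degree_dot_const dW)+
    define Gp where "Gp = [:0, 1:] * Ap - Bp"
    have Gpt: "poly Gp t = G t \<theta>" for t by (simp add: Gp_def G_def Apt Bpt)
    \<comment> \<open>The zeros of \<open>Gp\<close> are the \<open>card S\<close> points of intersection and the \<open>k - card S\<close> points of \<open>J1\<close>.\<close>
    have "Gp = 0"
    proof (rule poly_eq_0_if_many_roots)
      show "finite (S \<union> J1)" using finS J1 by simp
      have "card (S \<union> J1) = k" using finS J1 cardS by (subst card_Un_disjoint) auto
      moreover have "degree ([:0, 1:] * Ap) \<le> k - 1"
        using dA k by (intro order_trans [OF degree_mult_le]) auto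
      then have "degree Gp \<le> k - 1" unfolding Gp_def using dB by (intro degree_diff_le) auto
      ultimately show "degree Gp < card (S \<union> J1)" using k by simp
      fix t assume "t \<in> S \<union> J1"
      then show "poly Gp t = 0"
      proof
        assume "t \<in> S"
        then obtain i where i: "i < k" "t = - dot (\<nu> i) a / dot (\<nu> i) b" by (auto simp: S_def)
        then have ti: "dot (\<nu> i) a = - t * dot (\<nu> i) b" using nb by (simp add: field_simps)
        then have "dot (\<nu> i) (P t) = 0" by (simp add: P_def dot_linear)
        then have "dot (\<nu> i) (vmap (ev (P t)) \<theta>) = 0" using i by (intro tang_ev) auto
        then have "(Be t \<theta> - t * Ae t \<theta>) * dot (\<nu> i) b = 0"
          unfolding decomp dot_linear ti by (simp add: algebra_simps)
        then show "poly Gp t = 0" using nb [OF i(1)] by (simp add: Gpt G_def)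
      qed (use \<theta> in \<open>simp add: Gpt\<close>)
    qed
    then have BA: "Bp = [:0, 1:] * Ap" by (simp add: Gp_def)
    have "Ap = 0"
    proof (rule ccontr)
      assume "Ap \<noteq> 0"
      then have "degree Bp = Suc (degree Ap)" unfolding BA by (simp add: degree_mult_eq)
      then have "degree Ap < card J2" using dB J2 by simp
      then have "Ap = 0" using J2 \<theta> by (intro poly_eq_0_if_many_roots [of J2]) (simp_all add: Apt)
      then show False using \<open>Ap \<noteq> 0\<close> by simp
    qed
    then have van: "vmap (ev (P t)) \<theta> = 0" for t
      using decomp [of t] BA Apt [of t] Bpt [of t] by simp
    have dvd: "lin (\<nu> k) dvd p" if p: "hg 3 (Suc k) p" "\<And>t. ev (P t) p = 0" for p
    proof -
      \<comment> \<open>The points of the new line with \<open>\<sigma> = 0\<close> are multiples of \<open>b\<close>, which the parametrisation misses.\<close>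
      define \<sigma> where "\<sigma> = cross b e"
      have "lin (\<nu> k) dvd lin \<sigma> * p"
      proof (rule lin_dvd_if_vanishes [OF l])
        fix Q assume Q: "dot (\<nu> k) Q = 0"
        define s where "s = dot \<sigma> Q"
        show "ev Q (lin \<sigma> * p) = 0"
        proof (cases "s = 0")
          case False
          have "det3 a b Q = 0" using Q by (simp add: det3_eq_dot_cross(1) ab)
          moreover have "det3 Q b e = s"
            unfolding s_def \<sigma>_def by (simp add: det3_eq_dot_cross(1) [of b] det3_cyclic [of Q])
          ultimately have "Q = smul s a + smul (det3 a Q e) b"
            using cramer [of a b e Q] abe by (cases Q) simp
          also have "\<dots> = smul s (P (det3 a Q e / s))"
            using False by (cases a; cases b; simp add: P_def algebra_simps)
          finally have "s ^ 3 * ev Q p = s ^ Suc k * ev (P (det3 a Q e / s)) p"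
            using ev_scale [OF p(1), of s] by metis
          then show ?thesis using False p(2) by simp
        qed (simp add: s_def)
      qed
      moreover have "\<not> lin (\<nu> k) dvd lin \<sigma>"
      proof
        assume "lin (\<nu> k) dvd lin \<sigma>"
        from ev_eq_0_if_lin_dvd [OF this ma] have "dot \<sigma> a = 0" by simp
        moreover have "dot \<sigma> a = det3 a b e"
          unfolding \<sigma>_def by (simp add: det3_eq_dot_cross(1) [of b] det3_cyclic [of a])
        ultimately show False using abe by simp
      qed
      ultimately show ?thesis using lin_dvd_mult_iff [OF l] by blast
    qed
    have "lin (\<nu> k) dvd x" "lin (\<nu> k) dvd y" "lin (\<nu> k) dvd z"
      using van by (intro dvd hgs; simp add: xyz zero_triple)+
    then obtain x' y' z' where xyz': "x = lin (\<nu> k) * x'" "y = lin (\<nu> k) * y'" "z = lin (\<nu> k) * z'"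
      by (auto elim!: dvdE)
    have \<theta>': "\<theta> = smul (lin (\<nu> k)) (x', y', z')" by (simp add: xyz xyz')
    have l0: "lin (\<nu> k) \<noteq> 0" using l by (simp add: lin_eq_0_iff)
    have hg': "hg 3 k p'" if "hg 3 (Suc k) (lin (\<nu> k) * p')" for p'
      using hg_cancel [OF hg_lin l0, of 3 k p'] that by simp
    have "lin (\<nu> i) dvd dot (vmap C3 (\<nu> i)) (x', y', z')" if i: "i < k" for i
    proof -
      have i0: "\<nu> i \<noteq> 0" using nb [OF i] by (auto simp: dot_linear)
      have "\<not> lin (\<nu> i) dvd lin (\<nu> k)" using ne [OF i] lin_dvd_lin_iff [OF i0] by simp
      moreover have "lin (\<nu> i) dvd lin (\<nu> k) * dot (vmap C3 (\<nu> i)) (x', y', z')"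
        using tang [of i] i unfolding \<theta>' dot_linear by simp
      ultimately show ?thesis using lin_dvd_mult_iff [OF i0] by blast
    qed
    then have "(x', y', z') \<in> tangent_fields \<nu> k k"
      using hgs hg' unfolding xyz' by (simp add: tangent_fields_def)
    then show ?thesis using \<theta>' by blast
  qed
  then have sub: "?V' \<subseteq> smul (lin (\<nu> k)) ` tangent_fields \<nu> k k" by blast
  obtain B where B: "finite B" "card B \<le> n" "tangent_fields \<nu> k k \<subseteq> T3.span B"
    using bound by (auto simp: span_bound_def)
  have "smul (lin (\<nu> k)) ` T3.span B \<subseteq> T3.span (smul (lin (\<nu> k)) ` B)"
  proof (rule image_subsetI)
    fix v assume "v \<in> T3.span B"
    then have "smul (lin (\<nu> k)) v \<in> T3.span (smul (lin (\<nu> k)) ` B)"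
    proof (induction rule: T3.span_induct_alt)
      case base
      then show ?case by (simp add: T3.span_zero)
    next
      case (step c u w)
      have "smul (lin (\<nu> k)) (tscale c u + w) = tscale c (smul (lin (\<nu> k)) u) + smul (lin (\<nu> k)) w"
        by (cases u; cases w; simp add: tscale_def algebra_simps)
      moreover have "tscale c (smul (lin (\<nu> k)) u) \<in> T3.span (smul (lin (\<nu> k)) ` B)"
        using step(1) by (intro T3.span_scale T3.span_base imageI)
      ultimately show ?case using step(2) T3.span_add by metis
    qed
    then show "smul (lin (\<nu> k)) v \<in> T3.span (smul (lin (\<nu> k)) ` B)" .
  qed
  then have "?V' \<subseteq> T3.span (smul (lin (\<nu> k)) ` B)" using sub B(3) by blast
  moreover have "card (smul (lin (\<nu> k)) ` B) \<le> n" using card_image_le [OF B(1)] B(2) order_trans by blast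
  ultimately have "span_bound ?V' n" using B(1) unfolding span_bound_def by blast
  moreover have sG: "T3.subspace {\<theta> \<in> ?V. \<forall>t\<in>J1. G t \<theta> = 0}"
    using subspace_tangent_fields [of \<nu> "Suc k" "Suc k"] linear_functional_0 [OF linG] linear_functionalD [OF linG]
    unfolding T3.subspace_def by auto
  ultimately have "span_bound {\<theta> \<in> ?V. \<forall>t\<in>J1. G t \<theta> = 0} (n + card J2)"
    using span_bound_functionals [where \<phi> = Ae, OF J2(1) sG linA] by blast
  then have "span_bound ?V (n + card J2 + card J1)"
    by (rule span_bound_functionals [where \<phi> = G, OF J1(1) subspace_tangent_fields linG])
  then show ?thesis using J1 J2 by simp
qed


lemma tangent_fields_trivial: "d < 3 \<Longrightarrow> span_bound (tangent_fields \<nu> k d) 0"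
  unfolding span_bound_def
  by (intro exI [of _ "{}"]) (auto simp: tangent_fields_def zero_triple dest!: hg_negative)

lemma span_of_line:
  assumes ab: "cross a b = l" and l: "l \<noteq> 0" and P: "dot l P = 0"
  shows "\<exists>\<alpha> \<beta>. P = smul \<alpha> a + smul \<beta> (b :: complex \<times> complex \<times> complex)"
proof -
  obtain e where e: "dot l e = 1" using exists_dot_eq_1 [OF l] by blast
  have "det3 a b e = 1" "det3 a b P = 0" using e ab P by (simp_all add: det3_eq_dot_cross(1))
  then have "P = smul (det3 P b e) a + smul (det3 a P e) b"
    using cramer [of a b e P] by (cases P) simp
  then show ?thesis by blast
qed

definition mult_upto :: "(nat \<Rightarrow> complex \<times> complex \<times> complex) \<Rightarrow> nat \<Rightarrow> proj_plane \<Rightarrow> nat" where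
  "mult_upto \<nu> k p = card {i. i < k \<and> vanishes_at (lin (\<nu> i)) p}"

lemma mult_upto_Suc:
  "mult_upto \<nu> (Suc k) p = mult_upto \<nu> k p + (if vanishes_at (lin (\<nu> k)) p then 1 else 0)"
proof -
  have "{i. i < Suc k \<and> vanishes_at (lin (\<nu> i)) p} = {i. i < k \<and> vanishes_at (lin (\<nu> i)) p}
      \<union> (if vanishes_at (lin (\<nu> k)) p then {k} else {})"
    by (auto simp: less_Suc_eq)
  then show ?thesis by (simp add: mult_upto_def)
qed

text \<open>
  A point of the new line on \<open>n \<ge> 1\<close> old lines contributes \<open>n\<^sup>2\<close> instead of \<open>(n - 1)\<^sup>2\<close>, which is
  \<open>2 * n - 1\<close> more.  There are \<open>card S\<close> such points, and their numbers \<open>n\<close> add up to \<open>k\<close> because every old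
  line meets the new one exactly once.
\<close>

lemma sum_mult_add_line:
  fixes \<nu> :: "nat \<Rightarrow> complex \<times> complex \<times> complex" and a b and k :: nat
  defines "S \<equiv> (\<lambda>i. - dot (\<nu> i) a / dot (\<nu> i) b) ` {..<k}"
  assumes X: "finite X" and l: "\<nu> k \<noteq> 0"
    and ab: "cross a b = \<nu> k" and nb: "\<And>i. i < k \<Longrightarrow> dot (\<nu> i) b \<noteq> 0"
    and inX: "\<And>P i. i < k \<Longrightarrow> P \<noteq> 0 \<Longrightarrow> dot (\<nu> i) P = 0 \<Longrightarrow> dot (\<nu> k) P = 0 \<Longrightarrow> point P \<in> X"
  shows "(\<Sum>p\<in>X. (mult_upto \<nu> (Suc k) p - 1)\<^sup>2) + card S = (\<Sum>p\<in>X. (mult_upto \<nu> k p - 1)\<^sup>2) + 2 * k"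
proof -
  define t where "t i = - dot (\<nu> i) a / dot (\<nu> i) b" for i
  have S: "S = t ` {..<k}" by (simp add: S_def t_def)
  define Q where "Q u = a + smul u b" for u
  have crossQ: "cross (Q u) (Q v) = smul (v - u) (\<nu> k)" for u v
    unfolding Q_def ab [symmetric] by (cases a; cases b; simp add: algebra_simps)
  have "cross (Q u) b = \<nu> k" for u
    unfolding Q_def ab [symmetric] by (cases a; cases b; simp add: algebra_simps)
  then have Q0: "Q u \<noteq> 0" for u using l by (metis smul_zero(1) cross_smul(1))
  define q where "q u = point (Q u)" for u
  have inj: "inj q"
    by (rule injI) (use crossQ l Q0 in \<open>auto simp: q_def point_eq_iff smul_eq_0_iff\<close>)
  have onk: "vanishes_at (lin (\<nu> k)) (q u)" for u
  proof -
    have "dot (\<nu> k) (Q u) = 0" unfolding Q_def ab [symmetric] by (simp add: dot_linear dot_cross_self)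
    then show ?thesis by (simp add: q_def vanishes_at_lin Q0)
  qed
  have oni: "vanishes_at (lin (\<nu> i)) (q u) \<longleftrightarrow> t i = u" if "i < k" for i u
  proof -
    have "dot (\<nu> i) (Q u) = (u - t i) * dot (\<nu> i) b"
      using nb [OF that] by (simp add: Q_def dot_linear t_def distrib_right)
    then show ?thesis using nb [OF that] by (auto simp: q_def vanishes_at_lin Q0)
  qed
  have mq: "mult_upto \<nu> k (q u) = card {i \<in> {..<k}. t i = u}" for u
    unfolding mult_upto_def using oni by (intro arg_cong [of _ _ card]) auto
  have pos: "mult_upto \<nu> k p \<ge> 1" if p: "p \<in> q ` S" for p
  proof -
    obtain i where i: "i < k" "p = q (t i)" using p by (auto simp: S)
    then have "{j \<in> {..<k}. t j = t i} \<noteq> {}" by auto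
    then have "card {j \<in> {..<k}. t j = t i} > 0" by (simp add: card_gt_0_iff)
    then show ?thesis unfolding i(2) mq by simp
  qed
  have sub: "q ` S \<subseteq> X"
  proof
    fix p assume "p \<in> q ` S"
    then obtain i where i: "i < k" "p = q (t i)" by (auto simp: S)
    then show "p \<in> X" using oni [of i "t i"] onk [of "t i"] inX [OF i(1) Q0 [of "t i"]]
      by (simp add: q_def vanishes_at_lin Q0)
  qed
  have rest: "mult_upto \<nu> (Suc k) p - 1 = mult_upto \<nu> k p - 1" if p: "p \<notin> q ` S" for p
  proof (cases "vanishes_at (lin (\<nu> k)) p")
    case True
    obtain P where P: "P \<noteq> 0" "p = point P" using point_cases by blast
    have no: "\<not> vanishes_at (lin (\<nu> i)) p" if i: "i < k" for i
    proof
      assume v: "vanishes_at (lin (\<nu> i)) p"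
      have Pk: "dot (\<nu> k) P = 0" and Pi: "dot (\<nu> i) P = 0" using True v P by (simp_all add: vanishes_at_lin)
      obtain \<alpha> \<beta> where PP: "P = smul \<alpha> a + smul \<beta> b" using span_of_line [OF ab l Pk] by blast
      have "\<alpha> \<noteq> 0"
      proof
        assume "\<alpha> = 0"
        then have "\<beta> = 0" using Pi nb [OF i] by (simp add: PP dot_linear)
        then show False using P \<open>\<alpha> = 0\<close> by (simp add: PP)
      qed
      then have "P = smul \<alpha> (Q (\<beta> / \<alpha>))"
        unfolding PP Q_def by (cases a; cases b; simp add: algebra_simps)
      then have "cross P (Q (\<beta> / \<alpha>)) = 0" by (simp add: cross_smul)
      then have pq: "p = q (\<beta> / \<alpha>)" using P Q0 by (simp add: q_def point_eq_iff)
      then have "t i = \<beta> / \<alpha>" using oni [OF i] v by simp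
      then have "p = q (t i)" using pq by simp
      then show False using p i unfolding S by blast
    qed
    have "mult_upto \<nu> k p = 0" unfolding mult_upto_def using no by auto
    then show ?thesis by (simp add: mult_upto_Suc)
  qed (simp add: mult_upto_Suc)
  have finS: "finite S" by (simp add: S)
  have "(\<Sum>p\<in>q ` S. mult_upto \<nu> k p) = (\<Sum>u\<in>S. \<Sum>i\<in>{i \<in> {..<k}. t i = u}. 1)"
    using inj by (simp add: sum.reindex inj_on_def mq)
  also have "\<dots> = k" using finS by (subst sum.group) (auto simp: S)
  finally have sk: "(\<Sum>p\<in>q ` S. mult_upto \<nu> k p) = k" .
  have "(mult_upto \<nu> (Suc k) p - 1)\<^sup>2 + 1 = (mult_upto \<nu> k p - 1)\<^sup>2 + 2 * mult_upto \<nu> k p" if p: "p \<in> q ` S" for p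
  proof -
    obtain m where "mult_upto \<nu> k p = Suc m" using pos [OF p] by (cases "mult_upto \<nu> k p") auto
    moreover have "vanishes_at (lin (\<nu> k)) p" using p onk by auto
    ultimately show ?thesis by (simp add: mult_upto_Suc power2_eq_square)
  qed
  then have "(\<Sum>p\<in>q ` S. (mult_upto \<nu> (Suc k) p - 1)\<^sup>2 + 1) = (\<Sum>p\<in>q ` S. (mult_upto \<nu> k p - 1)\<^sup>2 + 2 * mult_upto \<nu> k p)"
    by (rule sum.cong [OF refl])
  moreover have "card (q ` S) = card S" using inj by (simp add: card_image inj_on_def)
  ultimately have 1: "(\<Sum>p\<in>q ` S. (mult_upto \<nu> (Suc k) p - 1)\<^sup>2) + card S = (\<Sum>p\<in>q ` S. (mult_upto \<nu> k p - 1)\<^sup>2) + 2 * k"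
    unfolding sum.distrib sum_distrib_left [symmetric] sk by simp
  have split: "(\<Sum>p\<in>X. g p) = (\<Sum>p\<in>X - q ` S. g p) + (\<Sum>p\<in>q ` S. g p)" for g :: "proj_plane \<Rightarrow> nat"
    by (rule sum.subset_diff [OF sub X])
  have 2: "(\<Sum>p\<in>X - q ` S. (mult_upto \<nu> (Suc k) p - 1)\<^sup>2) = (\<Sum>p\<in>X - q ` S. (mult_upto \<nu> k p - 1)\<^sup>2)"
    by (rule sum.cong) (simp_all only: rest Diff_iff not_False_eq_True)
  show ?thesis using 1 2 split [of "\<lambda>p. (mult_upto \<nu> (Suc k) p - 1)\<^sup>2"] split [of "\<lambda>p. (mult_upto \<nu> k p - 1)\<^sup>2"]
    by linarith
qed

text \<open>
  When the line number \<open>k\<close> is added to \<open>k\<close> old ones, the bound for the dimension grows by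
  \<open>2 * k - 2 - card S\<close> and the sum of squares by \<open>2 * k - card S\<close>.  The difference of 2 per line is the
  term \<open>2 * d\<close>.
\<close>

lemma tangent_fields_bound:
  fixes \<nu> :: "nat \<Rightarrow> complex \<times> complex \<times> complex"
  assumes X: "finite X" and nz: "\<And>i. i < d \<Longrightarrow> \<nu> i \<noteq> 0"
    and ne: "\<And>i j. i < d \<Longrightarrow> j < d \<Longrightarrow> i \<noteq> j \<Longrightarrow> cross (\<nu> i) (\<nu> j) \<noteq> 0"
    and inX: "\<And>P i j. i < d \<Longrightarrow> j < d \<Longrightarrow> i \<noteq> j \<Longrightarrow> P \<noteq> 0 \<Longrightarrow> dot (\<nu> i) P = 0 \<Longrightarrow> dot (\<nu> j) P = 0 \<Longrightarrow> point P \<in> X"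
    and d: "1 \<le> d"
  shows "\<exists>n. span_bound (tangent_fields \<nu> d d) n \<and> n + 2 * d \<le> (\<Sum>p\<in>X. (mult_upto \<nu> d p - 1)\<^sup>2) + 3"
  using d nz ne inX
proof (induction d rule: nat_induct_at_least)
  case base
  show ?case using tangent_fields_trivial [of 1 \<nu> 1] by (intro exI [of _ 0]) simp
next
  case (Suc k)
  have "\<exists>n. span_bound (tangent_fields \<nu> k k) n \<and> n + 2 * k \<le> (\<Sum>p\<in>X. (mult_upto \<nu> k p - 1)\<^sup>2) + 3"
  proof (rule Suc.IH)
    fix P i j assume "i < k" "j < k" "i \<noteq> j" "P \<noteq> 0" "dot (\<nu> i) P = 0" "dot (\<nu> j) P = 0"
    then show "point P \<in> X" using Suc.prems(3) [of i j P] by simp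
  qed (use Suc.prems(1,2) in simp_all)
  then obtain n where n: "span_bound (tangent_fields \<nu> k k) n" "n + 2 * k \<le> (\<Sum>p\<in>X. (mult_upto \<nu> k p - 1)\<^sup>2) + 3"
    by blast
  have k0: "\<nu> k \<noteq> 0" using Suc.prems(1) [of k] by simp
  obtain a b where ab: "cross a b = \<nu> k" "\<And>i. i < k \<Longrightarrow> dot (\<nu> i) b \<noteq> 0"
    using line_parametrisation [OF k0, of k \<nu>] Suc.prems(2) by auto
  define S where "S = (\<lambda>i. - dot (\<nu> i) a / dot (\<nu> i) b) ` {..<k}"
  have T: "(\<Sum>p\<in>X. (mult_upto \<nu> (Suc k) p - 1)\<^sup>2) + card S = (\<Sum>p\<in>X. (mult_upto \<nu> k p - 1)\<^sup>2) + 2 * k"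
    unfolding S_def
  proof (rule sum_mult_add_line [where \<nu> = \<nu> and k = k and a = a and b = b])
    fix P i assume "i < k" "P \<noteq> 0" "dot (\<nu> i) P = 0" "dot (\<nu> k) P = 0"
    then show "point P \<in> X" using Suc.prems(3) [of i k P] by simp
  qed (use X k0 ab in simp_all)
  have S: "card S \<le> k" unfolding S_def using card_image_le [of "{..<k}"] by auto
  show ?case
  proof (cases "2 \<le> k")
    case True
    have "span_bound (tangent_fields \<nu> (Suc k) (Suc k)) (n + (k - 2) + (k - card S))"
      unfolding S_def
      by (rule tangent_fields_add_line [where \<nu> = \<nu> and k = k and a = a and b = b])
        (use True k0 ab n(1) Suc.prems(2) in simp_all)
    moreover have "n + (k - 2) + (k - card S) + 2 * Suc k \<le> (\<Sum>p\<in>X. (mult_upto \<nu> (Suc k) p - 1)\<^sup>2) + 3"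
    proof -
      have "n + (k - 2) + (k - s) + 2 * Suc k \<le> t' + 3"
        if "n + 2 * k \<le> t + 3" "t' + s = t + 2 * k" "s \<le> k" for s t t' :: nat
        using that True le_Suc_ex [OF that(3)] le_Suc_ex [OF True] by auto
      then show ?thesis using n(2) T S by blast
    qed
    ultimately show ?thesis by blast
  next
    case False
    then have "span_bound (tangent_fields \<nu> (Suc k) (Suc k)) 0" by (intro tangent_fields_trivial) simp
    moreover have "0 + 2 * Suc k \<le> (\<Sum>p\<in>X. (mult_upto \<nu> (Suc k) p - 1)\<^sup>2) + 3"
      using T S False Suc.hyps by simp
    ultimately show ?thesis by blast
  qed
qed

section \<open>Vector fields acting on polynomials\<close>

definition grad :: "poly3 \<Rightarrow> triple" where
  "grad f = (deriv_x f, deriv_y f, deriv_z f)"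

definition der :: "triple \<Rightarrow> poly3 \<Rightarrow> poly3" where
  "der \<theta> f = dot \<theta> (grad f)"

lemma derivations3: "derivation deriv_x" "derivation deriv_y" "derivation deriv_z"
  unfolding deriv_x_def [abs_def] deriv_y_def [abs_def] deriv_z_def [abs_def]
  by (intro derivation_pderiv derivation_map_poly)+

lemma derivation_der: "derivation (der \<theta>)"
  unfolding derivation_def der_def grad_def
  by (cases \<theta>) (simp add: derivations3 [THEN derivationD(1)] derivations3 [THEN derivationD(2)] algebra_simps)

lemma grad_lin: "grad (lin l) = vmap C3 l"
proof -
  obtain a b c where l: "l = (a, b, c)" by (cases l)
  have C: "deriv_x (C3 t) = 0" "deriv_y (C3 t) = 0" "deriv_z (C3 t) = 0" for t
    by (simp_all add: deriv_x_def deriv_y_def deriv_z_def C3_def map_poly_pCons pderiv_pCons)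
  have V: "deriv_x X3 = 1" "deriv_y X3 = 0" "deriv_z X3 = 0" "deriv_x Y3 = 0" "deriv_y Y3 = 1"
    "deriv_z Y3 = 0" "deriv_x Z3 = 0" "deriv_y Z3 = 0" "deriv_z Z3 = 1"
    by (simp_all add: deriv_x_def deriv_y_def deriv_z_def X3_def Y3_def Z3_def map_poly_pCons
        pderiv_pCons one_pCons pderiv_1)
  show ?thesis
    by (simp add: grad_def l lin_def Evec_def C V derivations3 [THEN derivationD(1)]
        derivations3 [THEN derivationD(2)])
qed

lemma der_lin: "der \<theta> (lin l) = dot (vmap C3 l) \<theta>"
  by (simp add: der_def grad_lin dot_commute)

lemma der_linear:
  "der (\<theta> + \<eta>) f = der \<theta> f + der \<eta> f" "der (\<theta> - \<eta>) f = der \<theta> f - der \<eta> f"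
  "der (smul s \<theta>) f = s * der \<theta> f" "der 0 f = 0"
  by (simp_all add: der_def dot_linear)

lemma AR_eq: "AR f = {\<theta>. der \<theta> f = 0}"
  by (auto simp: AR_def der_def grad_def)

fun hgv :: "nat \<Rightarrow> nat \<Rightarrow> triple \<Rightarrow> bool" where
  "hgv s d (a, b, c) \<longleftrightarrow> hg s d a \<and> hg s d b \<and> hg s d c"

lemma AR_graded_eq: "AR_graded f q = {\<theta>. der \<theta> f = 0 \<and> hgv 0 q \<theta>}"
  unfolding AR_graded_def AR_eq by (auto simp: homogeneous_iff_hg)

lemma hgv_dot: "hgv s d u \<Longrightarrow> hgv s' d' v \<Longrightarrow> hg (s + s') (d + d') (dot u v)"
  by (cases u; cases v; simp add: hg_add hg_mult)

lemma hgv_cross: "hgv s d u \<Longrightarrow> hgv s' d' v \<Longrightarrow> hgv (s + s') (d + d') (cross u v)"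
  by (cases u; cases v; simp add: hg_diff hg_mult)

lemma hgv_smul: "hg s d p \<Longrightarrow> hgv s' d' v \<Longrightarrow> hgv (s + s') (d + d') (smul p v)"
  by (cases v; simp add: hg_mult)

lemma hgv_diff: "hgv s d u \<Longrightarrow> hgv s d v \<Longrightarrow> hgv s d (u - v)"
  by (cases u; cases v; simp add: hg_diff)

lemma hgv_Evec: "hgv 0 1 Evec" and hgv_C3: "hgv 0 0 (vmap C3 P)"
  using hg_vars by (cases P; simp add: Evec_def hg_C3)+

lemma hgv_shift: "hgv (s + t) (d + t) v \<longleftrightarrow> hgv s d v"
  by (cases v) (simp add: hg_shift)

lemma tangent_fields_eq:
  "tangent_fields \<nu> k d = {\<theta>. hgv 3 d \<theta> \<and> (\<forall>i<k. lin (\<nu> i) dvd dot (vmap C3 (\<nu> i)) \<theta>)}"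
  by (auto simp: tangent_fields_def)

lemma det3_Evec_C3: "det3 Evec (vmap C3 P) (vmap C3 Q) = lin (cross P Q)"
  by (simp add: det3_def lin_def vmap_hom [OF rhom_C3] dot_commute)

lemma of_nat_eq_C3: "of_nat n = C3 (of_nat n)"
  by (simp add: C3_def of_nat_poly)


section \<open>Line arrangements\<close>

locale lines =
  fixes d :: nat and \<nu> :: "nat \<Rightarrow> complex \<times> complex \<times> complex"
  assumes nonzero: "i < d \<Longrightarrow> \<nu> i \<noteq> 0"
    and distinct: "i < d \<Longrightarrow> j < d \<Longrightarrow> i \<noteq> j \<Longrightarrow> cross (\<nu> i) (\<nu> j) \<noteq> 0"
    and d_pos: "1 \<le> d"
begin

definition f :: poly3 where "f = (\<Prod>i<d. lin (\<nu> i))"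

lemma prod_nonzero: "A \<subseteq> {..<d} \<Longrightarrow> (\<Prod>i\<in>A. lin (\<nu> i)) \<noteq> 0"
  using finite_subset [of A "{..<d}"] nonzero by (auto simp: lin_eq_0_iff)

lemma f_nonzero: "f \<noteq> 0"
  unfolding f_def by (rule prod_nonzero) simp

lemma hg_f: "hg 0 d f"
  using hg_prod_lin [of "{..<d}" \<nu>] by (simp add: f_def)

lemma der_prod: "finite A \<Longrightarrow> der \<theta> (\<Prod>i\<in>A. lin (\<nu> i)) = (\<Sum>i\<in>A. dot (vmap C3 (\<nu> i)) \<theta> * (\<Prod>j\<in>A - {i}. lin (\<nu> j)))"
  by (simp add: derivation_prod [OF derivation_der] der_lin)

lemma euler: "der Evec f = of_nat d * f"
proof -
  have "der Evec f = (\<Sum>i<d. lin (\<nu> i) * (\<Prod>j\<in>{..<d} - {i}. lin (\<nu> j)))"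
    unfolding f_def by (simp add: der_prod flip: lin_def)
  also have "\<dots> = (\<Sum>i<d. f)"
    unfolding f_def by (intro sum.cong) (auto simp: prod.remove)
  finally show ?thesis by simp
qed

text \<open>
  By the product rule, \<open>\<theta>(l)\<close> times the other lines is a multiple of \<open>l\<close>, and \<open>l\<close> is prime.
\<close>

lemma AR_tangent:
  assumes \<theta>: "der \<theta> f = 0" and i: "i < d"
  shows "lin (\<nu> i) dvd dot (vmap C3 (\<nu> i)) \<theta>"
proof -
  let ?g = "\<Prod>j\<in>{..<d} - {i}. lin (\<nu> j)"
  have f: "f = lin (\<nu> i) * ?g" unfolding f_def using i by (simp add: prod.remove)
  have "lin (\<nu> i) * der \<theta> ?g + ?g * dot (vmap C3 (\<nu> i)) \<theta> = 0"
    using \<theta> unfolding f derivationD(2) [OF derivation_der] der_lin .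
  then have "?g * dot (vmap C3 (\<nu> i)) \<theta> = lin (\<nu> i) * - der \<theta> ?g"
    by (simp add: eq_neg_iff_add_eq_0 add.commute)
  then have "lin (\<nu> i) dvd ?g * dot (vmap C3 (\<nu> i)) \<theta>" by simp
  moreover have "\<not> lin (\<nu> i) dvd ?g"
    using i nonzero distinct by (intro lin_not_dvd_prod) auto
  ultimately show ?thesis using lin_dvd_mult_iff nonzero i by blast
qed

text \<open>
  Each of the three fields maps the equation of a line to a multiple of it.  By \<open>dual_cramer\<close> the
  determinant is divisible by every line.
\<close>

lemma f_dvd_det:
  assumes "der \<theta> f = 0" "der \<eta> f = 0"
  shows "f dvd det3 Evec \<theta> \<eta>"
  unfolding f_def
proof (rule prod_lin_dvd)
  fix i assume "i \<in> {..<d}"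
  then have i: "i < d" by simp
  let ?l = "vmap C3 (\<nu> i)"
  obtain a b c where l: "\<nu> i = (a, b, c)" by (cases "\<nu> i")
  obtain x1 x2 x3 y1 y2 y3 z1 z2 z3 where
    xyz: "cross \<theta> \<eta> = (x1, x2, x3)" "cross \<eta> Evec = (y1, y2, y3)" "cross Evec \<theta> = (z1, z2, z3)"
    by (cases "cross \<theta> \<eta>"; cases "cross \<eta> Evec"; cases "cross Evec \<theta>")
  have "lin (\<nu> i) dvd dot ?l Evec" "lin (\<nu> i) dvd dot ?l \<theta>" "lin (\<nu> i) dvd dot ?l \<eta>"
    using AR_tangent i assms by (auto simp: lin_def)
  then have "lin (\<nu> i) dvd det3 Evec \<theta> \<eta> * C3 a" "lin (\<nu> i) dvd det3 Evec \<theta> \<eta> * C3 b"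
    "lin (\<nu> i) dvd det3 Evec \<theta> \<eta> * C3 c"
    using dual_cramer [of ?l Evec \<theta> \<eta>, symmetric] unfolding xyz l by (auto intro!: dvd_add dvd_mult2)
  moreover have "a \<noteq> 0 \<or> b \<noteq> 0 \<or> c \<noteq> 0" using nonzero [OF i] by (auto simp: l zero_triple)
  moreover have "lin (\<nu> i) dvd p" if "lin (\<nu> i) dvd p * C3 e" "e \<noteq> 0" for p e
  proof -
    have "p = p * C3 e * C3 (1 / e)" using that(2) by (simp add: mult.assoc rhomD [OF rhom_C3] flip: rhomD(3) [OF rhom_C3])
    then show ?thesis using that(1) by (metis dvd_mult2)
  qed
  ultimately show "lin (\<nu> i) dvd det3 Evec \<theta> \<eta>" by blast
qed (use nonzero distinct in auto)

text \<open>
  Saito's criterion.  The determinant is a multiple \<open>f * c\<close> of \<open>f\<close>, which bounds the degrees.  If the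
  degrees agree, \<open>c\<close> is a constant, and Cramer's rule expresses every syzygy by the Euler field, \<open>\<theta>\<close> and
  \<open>\<eta>\<close> with polynomial coefficients; the Euler field does not occur because it does not annihilate \<open>f\<close>.
\<close>

lemma saito:
  assumes \<theta>: "der \<theta> f = 0" "hgv 0 r \<theta>" and \<eta>: "der \<eta> f = 0" "hgv 0 s \<eta>"
    and det: "det3 Evec \<theta> \<eta> \<noteq> 0"
  shows "d \<le> 1 + r + s" "1 + r + s = d \<Longrightarrow> free_curve f"
proof -
  let ?D = "det3 Evec \<theta> \<eta>"
  obtain c where c: "?D = f * c" using f_dvd_det [OF \<theta>(1) \<eta>(1)] by (rule dvdE)
  have "hg 0 (1 + (r + s)) ?D"
    using hgv_dot [OF hgv_Evec hgv_cross [OF \<theta>(2) \<eta>(2)]] by (simp add: det3_def)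
  then have hD: "hg 0 (1 + (r + s)) (f * c)" by (simp add: c)
  show "d \<le> 1 + r + s"
  proof (rule ccontr)
    assume "\<not> d \<le> 1 + r + s"
    then have e: "1 + (r + s) + (d - (1 + r + s)) = d" by simp
    have "hg (0 + (d - (1 + r + s))) (d + 0) (f * c)"
      using hg_shift [of 0 "d - (1 + r + s)" "1 + (r + s)" "f * c"] hD unfolding e by simp
    then have "hg (d - (1 + r + s)) 0 c" by (rule hg_cancel [OF hg_f f_nonzero])
    then have "c = 0" using \<open>\<not> d \<le> 1 + r + s\<close> by (intro hg_negative) auto
    then show False using det c by simp
  qed
  assume deg: "1 + r + s = d"
  have "hg (0 + 0) (d + 0) (f * c)" using hD deg by simp
  then have "hg 0 0 c" by (rule hg_cancel [OF hg_f f_nonzero])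
  then obtain k where k: "c = C3 k" using hg_constant by blast
  have k0: "k \<noteq> 0" using det c k by (auto simp: rhomD [OF rhom_C3])
  have ne: "\<theta> \<noteq> \<eta>" using det by (auto simp: det3_linear)
  have scale: "scale3 = smul" by (intro ext) (auto split: prod.splits)
  have "{\<theta>, \<eta>} \<subseteq> (\<Union>q. AR_graded f q)" using \<theta> \<eta> by (auto simp: AR_graded_eq)
  moreover have "card {\<theta>, \<eta>} = 2" using ne by simp
  moreover have "S3.independent {\<theta>, \<eta>}"
  proof (rule notI)
    assume "S3.dependent {\<theta>, \<eta>}"
    then obtain u where u: "\<exists>v\<in>{\<theta>, \<eta>}. u v \<noteq> 0" "(\<Sum>v\<in>{\<theta>, \<eta>}. smul (u v) v) = 0"
      using S3.dependent_finite [of "{\<theta>, \<eta>}"] by (auto simp: scale)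
    then have z: "smul (u \<theta>) \<theta> + smul (u \<eta>) \<eta> = 0" using ne by simp
    have "det3 Evec (smul (u \<theta>) \<theta> + smul (u \<eta>) \<eta>) \<eta> = u \<theta> * ?D"
      "det3 Evec \<theta> (smul (u \<theta>) \<theta> + smul (u \<eta>) \<eta>) = u \<eta> * ?D"
      by (simp_all add: det3_linear)
    moreover have "det3 Evec 0 \<eta> = 0" "det3 Evec \<theta> 0 = 0"
      using det3_linear(4) [of Evec 0 \<theta> \<eta>] det3_linear(6) [of Evec \<theta> 0 \<eta>] by simp_all
    ultimately show False using z u(1) det by auto
  qed
  moreover have "S3.span {\<theta>, \<eta>} = AR f"
  proof
    have "S3.subspace (AR f)" unfolding AR_eq
      by (rule S3.subspaceI) (simp_all only: mem_Collect_eq scale der_linear add_0 mult_zero_right)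
    then show "S3.span {\<theta>, \<eta>} \<subseteq> AR f" by (rule S3.span_minimal [rotated]) (use \<theta> \<eta> in \<open>auto simp: AR_eq\<close>)
  next
    show "AR f \<subseteq> S3.span {\<theta>, \<eta>}"
    proof
      fix \<zeta> assume "\<zeta> \<in> AR f"
      then have \<zeta>: "der \<zeta> f = 0" by (simp add: AR_eq)
      obtain p q where pq: "det3 Evec \<zeta> \<eta> = f * p" "det3 Evec \<theta> \<zeta> = f * q"
        using f_dvd_det [OF \<zeta> \<eta>(1)] f_dvd_det [OF \<theta>(1) \<zeta>] unfolding dvd_def by blast
      have C: "smul ?D \<zeta> = smul (det3 \<zeta> \<theta> \<eta>) Evec + smul (f * p) \<theta> + smul (f * q) \<eta>"
        using cramer [of Evec \<theta> \<eta> \<zeta>] unfolding pq .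
      \<comment> \<open>Only the Euler term survives the application to \<open>f\<close>, so its coefficient vanishes.\<close>
      from arg_cong [OF this, of "\<lambda>v. der v f"] have "det3 \<zeta> \<theta> \<eta> * (of_nat d * f) = 0"
        by (simp add: der_linear \<theta> \<eta> \<zeta> euler)
      then have "det3 \<zeta> \<theta> \<eta> = 0" using f_nonzero d_pos by simp
      with C have "smul f (smul (C3 k) \<zeta> - (smul p \<theta> + smul q \<eta>)) = 0"
        unfolding c k by (cases \<zeta>; cases \<theta>; cases \<eta>; simp add: zero_triple algebra_simps)
      then have "smul (C3 k) \<zeta> = smul p \<theta> + smul q \<eta>"
        using f_nonzero by (simp add: smul_eq_0_iff)
      moreover have "smul (C3 (1 / k)) (smul (C3 k) \<zeta>) = \<zeta>"
        using k0 by (cases \<zeta>) (simp add: rhomD(1) [OF rhom_C3] flip: mult.assoc rhomD(3) [OF rhom_C3])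
      ultimately have e: "\<zeta> = scale3 (C3 (1 / k)) (scale3 p \<theta> + scale3 q \<eta>)" by (simp add: scale)
      show "\<zeta> \<in> S3.span {\<theta>, \<eta>}"
        by (subst e) (intro S3.span_scale S3.span_add; rule S3.span_base; simp)
    qed
  qed
  ultimately show "free_curve f" unfolding free_curve_def by blast
qed

subsection \<open>The syzygy of a point\<close>

definition through :: "complex \<times> complex \<times> complex \<Rightarrow> nat set" where
  "through P = {i \<in> {..<d}. dot (\<nu> i) P = 0}"

definition off_prod :: "complex \<times> complex \<times> complex \<Rightarrow> poly3" where
  "off_prod P = (\<Prod>i\<in>{..<d} - through P. lin (\<nu> i))"

text \<open>
  The derivative in the direction of \<open>P\<close>, times \<open>off_prod P\<close>, maps \<open>f\<close> to a multiple of \<open>f\<close>.  Subtraction of the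
  corresponding multiple of the Euler field turns it into a syzygy; the factor \<open>d\<close> clears the
  denominator from Euler's formula.
\<close>

definition point_syzygy :: "complex \<times> complex \<times> complex \<Rightarrow> triple" where
  "point_syzygy P = smul (of_nat d * off_prod P) (vmap C3 P) - smul (der (vmap C3 P) (off_prod P)) Evec"

lemma through_subset: "through P \<subseteq> {..<d}" and finite_through: "finite (through P)"
  by (auto simp: through_def)

lemma card_off: "card ({..<d} - through P) = d - card (through P)"
  using card_Diff_subset [OF finite_through through_subset] by simp

lemma card_through_le: "card (through P) \<le> d"
  using card_mono [OF _ through_subset] by simp

lemma dot_C3: "dot (vmap C3 l) (vmap C3 P) = C3 (dot l P)"
  by (simp add: vmap_hom [OF rhom_C3])

lemma point_syzygy_AR: "der (point_syzygy P) f = 0"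
proof -
  let ?G = "\<Prod>i\<in>through P. lin (\<nu> i)" and ?H = "off_prod P" and ?P = "vmap C3 P"
  have f: "f = ?H * ?G" unfolding f_def off_prod_def using through_subset by (intro prod.subset_diff) auto
  have "der ?P ?G = 0"
    unfolding der_prod [OF finite_through] dot_C3 by (rule sum.neutral) (simp add: through_def rhomD [OF rhom_C3])
  then have "der ?P f = ?G * der ?P ?H" by (simp add: f derivationD(2) [OF derivation_der])
  then show ?thesis unfolding point_syzygy_def der_linear euler by (simp add: f)
qed

lemma hg_off_prod: "hg 0 (d - card (through P)) (off_prod P)"
  unfolding off_prod_def card_off [symmetric] by (rule hg_prod_lin) simp

lemma off_prod_nonzero: "off_prod P \<noteq> 0"
  unfolding off_prod_def by (rule prod_nonzero) auto

lemma hgv_point_syzygy: "hgv 0 (d - card (through P)) (point_syzygy P)"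
proof -
  let ?A = "{..<d} - through P" and ?n = "d - card (through P)"
  have "hg 1 ?n (der (vmap C3 P) (off_prod P))"
    unfolding off_prod_def
  proof (subst der_prod, simp, rule hg_sum)
    fix i assume i: "i \<in> ?A"
    then have n: "?n = card (?A - {i}) + 1" using card_off [of P] card_Suc_Diff1 [of ?A i] by simp
    have "hg (0 + 1) (card (?A - {i}) + 1) (\<Prod>j\<in>?A - {i}. lin (\<nu> j))"
      unfolding hg_shift by (rule hg_prod_lin) simp
    then show "hg 1 ?n (dot (vmap C3 (\<nu> i)) (vmap C3 P) * (\<Prod>j\<in>?A - {i}. lin (\<nu> j)))"
      unfolding dot_C3 n by (intro hg_C3_mult) simp
  qed
  from hgv_smul [OF this hgv_Evec] have "hgv (0 + 1) (?n + 1) (smul (der (vmap C3 P) (off_prod P)) Evec)"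
    by simp
  then have 1: "hgv 0 ?n (smul (der (vmap C3 P) (off_prod P)) Evec)" by (simp only: hgv_shift)
  have 2: "hgv 0 ?n (smul (of_nat d * off_prod P) (vmap C3 P))"
    using hgv_smul [OF hg_C3_mult [OF hg_off_prod] hgv_C3] by (simp add: of_nat_eq_C3)
  show ?thesis unfolding point_syzygy_def by (rule hgv_diff [OF 2 1])
qed

lemma det_point_syzygy:
  "det3 Evec (point_syzygy P) v = of_nat d * off_prod P * det3 Evec (vmap C3 P) v"
  "det3 Evec v (point_syzygy P) = of_nat d * off_prod P * det3 Evec v (vmap C3 P)"
  unfolding point_syzygy_def by (simp_all add: det3_linear)

lemma det_point_syzygy_ne:
  assumes "cross P Q \<noteq> 0"
  shows "det3 Evec (point_syzygy P) (point_syzygy Q) \<noteq> 0"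
  using assms off_prod_nonzero d_pos by (simp add: det_point_syzygy det3_Evec_C3 lin_eq_0_iff)

lemma point_syzygy_nonzero:
  assumes "P \<noteq> 0"
  shows "point_syzygy P \<noteq> 0"
proof
  assume z: "point_syzygy P = 0"
  have "\<exists>Q. cross P Q \<noteq> 0"
  proof (rule ccontr)
    assume "\<nexists>Q. cross P Q \<noteq> 0"
    then have "cross P (1, 0, 0) = 0" "cross P (0, 1, 0) = 0" by blast+
    then show False using assms by (cases P) (auto simp: zero_triple)
  qed
  then obtain Q where "cross P Q \<noteq> 0" ..
  then have "det3 Evec (point_syzygy P) (point_syzygy Q) \<noteq> 0" by (rule det_point_syzygy_ne)
  moreover have "det3 Evec 0 (point_syzygy Q) = 0"
    using det3_linear(4) [of Evec 0 0 "point_syzygy Q"] by simp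
  ultimately show False using z by simp
qed

text \<open>
  If \<open>\<theta>\<close>, the Euler field \<open>E\<close> and \<open>P\<close> are dependent, then on a line that avoids \<open>P\<close> the field \<open>\<theta>\<close>,
  being tangent to the line, is proportional to \<open>E\<close>.  So every such line divides the components of
  \<open>E \<times> \<theta>\<close>.  Their degree \<open>r + 1\<close> is at most the number \<open>d - card (through P)\<close> of these lines, which makes
  \<open>E \<times> \<theta>\<close> the product of these lines with a constant vector \<open>c\<close>.  Since \<open>E \<times> \<theta>\<close> is orthogonal to \<open>E\<close>, the
  vector \<open>c\<close> vanishes.  Hence \<open>\<theta>\<close> is proportional to \<open>E\<close>, and a nonzero multiple of \<open>E\<close> does not annihilate \<open>f\<close>.
\<close>

lemma det_small_syzygy_ne:
  assumes \<theta>: "der \<theta> f = 0" "hgv 0 r \<theta>" "\<theta> \<noteq> 0" and r: "r < d - card (through P)"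
  shows "det3 Evec \<theta> (point_syzygy P) \<noteq> 0"
proof
  assume "det3 Evec \<theta> (point_syzygy P) = 0"
  then have det: "det3 Evec \<theta> (vmap C3 P) = 0" using off_prod_nonzero d_pos by (simp add: det_point_syzygy)
  define n where "n = d - card (through P)"
  obtain x1 x2 x3 where x: "cross Evec \<theta> = (x1, x2, x3)" by (cases "cross Evec \<theta>")
  have hx: "hg 0 (1 + r) x1" "hg 0 (1 + r) x2" "hg 0 (1 + r) x3"
    using hgv_cross [OF hgv_Evec \<theta>(2)] by (simp_all add: x)
  have dvd: "off_prod P dvd x1 \<and> off_prod P dvd x2 \<and> off_prod P dvd x3"
  proof -
    have lin_dvd: "lin (\<nu> i) dvd x1 \<and> lin (\<nu> i) dvd x2 \<and> lin (\<nu> i) dvd x3" if i: "i \<in> {..<d} - through P" for i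
    proof -
      let ?l = "vmap C3 (\<nu> i)" and ?c = "dot (\<nu> i) P"
      have c: "?c \<noteq> 0" using i by (simp add: through_def)
      obtain g where g: "dot ?l \<theta> = lin (\<nu> i) * g" using AR_tangent [OF \<theta>(1), of i] i by (auto elim!: dvdE)
      obtain y1 y2 y3 z1 z2 z3 where yz: "cross \<theta> (vmap C3 P) = (y1, y2, y3)" "cross (vmap C3 P) Evec = (z1, z2, z3)"
        by (cases "cross \<theta> (vmap C3 P)"; cases "cross (vmap C3 P) Evec")
      have "smul (lin (\<nu> i)) (y1, y2, y3) + smul (lin (\<nu> i) * g) (z1, z2, z3) + smul (C3 ?c) (x1, x2, x3) = 0"
        using dual_cramer [of ?l Evec \<theta> "vmap C3 P"] unfolding det yz x g dot_C3
        by (simp add: lin_def)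
      then have "C3 ?c * x1 = - (lin (\<nu> i) * (y1 + g * z1))" "C3 ?c * x2 = - (lin (\<nu> i) * (y2 + g * z2))"
        "C3 ?c * x3 = - (lin (\<nu> i) * (y3 + g * z3))"
        by (simp_all add: zero_triple eq_neg_iff_add_eq_0 algebra_simps)
      then have "lin (\<nu> i) dvd C3 ?c * x1" "lin (\<nu> i) dvd C3 ?c * x2" "lin (\<nu> i) dvd C3 ?c * x3" by simp_all
      moreover have "\<not> lin (\<nu> i) dvd C3 ?c"
      proof
        assume "lin (\<nu> i) dvd C3 ?c"
        from ev_eq_0_if_lin_dvd [OF this, of 0] c show False by (simp add: dot_linear)
      qed
      ultimately show ?thesis using lin_dvd_mult_iff [OF nonzero] i by auto
    qed
    show ?thesis unfolding off_prod_def
      by (intro conjI prod_lin_dvd) (use lin_dvd nonzero distinct in auto)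
  qed
  have const: "\<exists>c. x = off_prod P * C3 c" if h: "hg 0 (1 + r) x" and dv: "off_prod P dvd x" for x
  proof -
    obtain w where w: "x = off_prod P * w" using dv ..
    have e: "1 + r + (n - (1 + r)) = n + 0" using r by (simp add: n_def)
    have "hg (0 + (n - (1 + r))) (n + 0) (off_prod P * w)"
      using hg_shift [of 0 "n - (1 + r)" "1 + r" x] h unfolding e w by simp
    then have "hg (n - (1 + r)) 0 w" by (rule hg_cancel [OF hg_off_prod [of P, folded n_def] off_prod_nonzero])
    then have "hg 0 0 w" by (auto simp: hg_def)
    then show ?thesis using hg_constant w by blast
  qed
  obtain c1 c2 c3 where "x1 = off_prod P * C3 c1" "x2 = off_prod P * C3 c2" "x3 = off_prod P * C3 c3"
    using const hx dvd by metis
  then have xc: "cross Evec \<theta> = smul (off_prod P) (vmap C3 (c1, c2, c3))" by (simp add: x)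
  \<comment> \<open>A constant vector orthogonal to the Euler field is zero.\<close>
  have "dot Evec (cross Evec \<theta>) = 0"
    using det3_linear(10) [of Evec \<theta>] by (simp add: det3_def)
  then have "lin (c1, c2, c3) = 0"
    unfolding xc dot_linear using off_prod_nonzero by (simp add: lin_def dot_commute)
  then have "cross Evec \<theta> = 0" unfolding xc lin_eq_0_iff by (simp add: zero_triple rhomD [OF rhom_C3])
  moreover have "cross (grad f) (cross Evec \<theta>) = smul (dot \<theta> (grad f)) Evec - smul (dot Evec (grad f)) \<theta>"
    by (rule cross_cross)
  moreover have "cross (grad f) 0 = 0" by (cases "grad f") (simp add: zero_triple)
  ultimately have "smul (of_nat d * f) \<theta> = 0"
    using \<theta>(1) euler by (simp add: der_def)
  then show False using f_nonzero d_pos \<theta>(3) by (simp add: smul_eq_0_iff)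
qed


subsection \<open>The lower bound\<close>

lemma AR_tangent_fields:
  assumes \<theta>: "der \<theta> f = 0" "hgv 0 q \<theta>" and "i + j + k + q + 3 = d"
  shows "smul (mon3 i j k c) \<theta> \<in> tangent_fields \<nu> d d"
proof -
  have "hg 0 (i + j + k) (mon3 i j k c)" by (auto simp: hg_def c3_mon3)
  then have "hgv 0 (i + j + k + q) (smul (mon3 i j k c) \<theta>)" using hgv_smul \<theta>(2) by fastforce
  then have "hgv 3 d (smul (mon3 i j k c) \<theta>)"
    using hgv_shift [of 0 3 "i + j + k + q"] assms(3) by simp
  then show ?thesis using AR_tangent [OF \<theta>(1)] by (simp add: tangent_fields_eq dot_linear)
qed

lemma Evec_tangent_fields:
  assumes "i + j + k + 4 = d"
  shows "smul (mon3 i j k c) Evec \<in> tangent_fields \<nu> d d"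
proof -
  have "hg 0 (i + j + k) (mon3 i j k c)" by (auto simp: hg_def c3_mon3)
  then have "hgv 0 (i + j + k + 1) (smul (mon3 i j k c) Evec)" using hgv_smul hgv_Evec by fastforce
  then have "hgv 3 d (smul (mon3 i j k c) Evec)"
    using hgv_shift [of 0 3 "i + j + k + 1"] assms by (simp add: eval_nat_numeral)
  then show ?thesis by (simp add: tangent_fields_eq dot_linear flip: lin_def)
qed

text \<open>
  The multiples of \<open>E\<close>, \<open>\<theta>\<close> and \<open>\<eta>\<close> by monomials of the complementary degrees are linearly independent,
  because the determinant of the three fields is not zero.
\<close>

lemma tangent_fields_dim_ge:
  assumes \<theta>: "der \<theta> f = 0" "hgv 0 r \<theta>" and \<eta>: "der \<eta> f = 0" "hgv 0 s \<eta>"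
    and det: "det3 Evec \<theta> \<eta> \<noteq> 0" and N: "span_bound (tangent_fields \<nu> d d) N"
  shows "((d - 2) choose 2) + ((d - r - 1) choose 2) + ((d - s - 1) choose 2) \<le> N"
proof -
  define T where "T e = {(i, j, k). i + j + k + 3 = (e::nat)}" for e
  define mon where "mon = (\<lambda>(i, j, k). mon3 i j k)"
  define J where "J = T (d - 1) <+> (T (d - r) <+> T (d - s))"
  define fam where "fam = case_sum (\<lambda>x. smul (mon x 1) Evec)
    (case_sum (\<lambda>x. smul (mon x 1) \<theta>) (\<lambda>x. smul (mon x 1) \<eta>))"
  have fin: "finite (T e)" for e by (simp add: T_def)
  have "card J \<le> N"
  proof (rule card_le_if_span_bound [OF N])
    show "finite J" by (simp add: J_def fin)
    show "fam ` J \<subseteq> tangent_fields \<nu> d d"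
    proof (rule image_subsetI)
      fix x assume "x \<in> J"
      then consider i j k where "x = Inl (i, j, k)" "i + j + k + 3 = d - 1"
        | i j k where "x = Inr (Inl (i, j, k))" "i + j + k + 3 = d - r"
        | i j k where "x = Inr (Inr (i, j, k))" "i + j + k + 3 = d - s"
        by (auto simp: J_def T_def)
      then show "fam x \<in> tangent_fields \<nu> d d"
      proof cases
        case 1
        then have "i + j + k + 4 = d" by linarith
        then show ?thesis using 1 Evec_tangent_fields by (simp add: fam_def mon_def)
      next
        case 2
        then have "i + j + k + r + 3 = d" by linarith
        then show ?thesis using 2 AR_tangent_fields [OF \<theta>] by (simp add: fam_def mon_def)
      next
        case 3
        then have "i + j + k + s + 3 = d" by linarith
        then show ?thesis using 3 AR_tangent_fields [OF \<eta>] by (simp add: fam_def mon_def)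
      qed
    qed
    fix c x assume 0: "(\<Sum>x\<in>J. tscale (c x) (fam x)) = 0" and x: "x \<in> J"
    define U where "U \<iota> e = (\<Sum>x\<in>T e. mon x (c (\<iota> x)))" for \<iota> e
    have ts: "tscale u (smul (mon x 1) v) = smul (mon x u) v" for u x v
      by (cases x; cases v; simp add: tscale_def mon_def mon3_eq rhomD(1) [OF rhom_C3] mult.assoc)
    have "(\<Sum>x\<in>J. tscale (c x) (fam x)) =
        smul (U Inl (d - 1)) Evec + (smul (U (Inr \<circ> Inl) (d - r)) \<theta> + smul (U (Inr \<circ> Inr) (d - s)) \<eta>)"
      unfolding J_def U_def by (simp add: sum.Plus fin fam_def ts smul_sum)
    then have z: "smul (U Inl (d - 1)) Evec + (smul (U (Inr \<circ> Inl) (d - r)) \<theta> + smul (U (Inr \<circ> Inr) (d - s)) \<eta>) = 0"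
      (is "?z = 0") using 0 by simp
    have "det3 ?z \<theta> \<eta> = U Inl (d - 1) * det3 Evec \<theta> \<eta>" "det3 Evec ?z \<eta> = U (Inr \<circ> Inl) (d - r) * det3 Evec \<theta> \<eta>"
      "det3 Evec \<theta> ?z = U (Inr \<circ> Inr) (d - s) * det3 Evec \<theta> \<eta>"
      by (simp_all only: det3_linear mult_zero_right add_0 add_0_right)
    moreover have "det3 0 \<theta> \<eta> = 0" "det3 Evec 0 \<eta> = 0" "det3 Evec \<theta> 0 = 0"
      using det3_linear(2) [of 0 0 \<theta> \<eta>] det3_linear(4) [of Evec 0 0 \<eta>] det3_linear(6) [of Evec \<theta> 0 0] by simp_all
    ultimately have U0: "U Inl (d - 1) = 0" "U (Inr \<circ> Inl) (d - r) = 0" "U (Inr \<circ> Inr) (d - s) = 0"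
      unfolding z using det by simp_all
    have coeff: "c (\<iota> y) = 0" if "U \<iota> e = 0" "y \<in> T e" for \<iota> e y
    proof -
      obtain i j k where y: "y = (i, j, k)" by (cases y)
      have "c3 (U \<iota> e) i j k = (\<Sum>x\<in>T e. if x = y then c (\<iota> y) else 0)"
        unfolding U_def coeff_sum by (rule sum.cong) (auto simp: mon_def c3_mon3 y split: if_splits)
      also have "\<dots> = c (\<iota> y)" using that(2) fin by simp
      finally show ?thesis using that(1) by simp
    qed
    show "c x = 0" using x coeff [OF U0(1)] coeff [OF U0(2)] coeff [OF U0(3)] by (auto simp: J_def)
  qed
  moreover have "card J = card (T (d - 1)) + (card (T (d - r)) + card (T (d - s)))"
    unfolding J_def using fin by (simp add: card_Plus)
  ultimately show ?thesis unfolding T_def card_triples by (simp add: diff_diff_add numeral_2_eq_2)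
qed


subsection \<open>Singular points\<close>

lemma mult_upto_point: "P \<noteq> 0 \<Longrightarrow> mult_upto \<nu> d (point P) = card (through P)"
  unfolding mult_upto_def through_def by (intro arg_cong [of _ _ card]) (auto simp: vanishes_at_lin)

lemma point_in_curve_iff:
  assumes "P \<noteq> 0"
  shows "point P \<in> curve f \<longleftrightarrow> through P \<noteq> {}"
  unfolding curve_def using assms
  by (auto simp: vanishes_at_point f_def through_def dot_linear intro: exI [of _ 1])

lemma singular_if_two_lines:
  assumes P: "P \<noteq> 0" and ij: "i \<in> through P" "j \<in> through P" "i \<noteq> j"
  shows "point P \<in> singular_points f"
proof -
  have "vanishes_at (\<delta> f) (point P)" if \<delta>: "derivation \<delta>" for \<delta>
    unfolding vanishes_at_point [OF P]
  proof (intro allI impI)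
    fix c :: complex
    have key: "ev (smul c P) (\<delta> (lin (\<nu> k)) * (\<Prod>j\<in>{..<d} - {k}. lin (\<nu> j))) = 0" if "k < d" for k
    proof -
      have "\<exists>m\<in>{..<d} - {k}. dot (\<nu> m) P = 0" using ij that by (cases "k = i") (auto simp: through_def)
      then show ?thesis by (auto simp: dot_linear)
    qed
    show "ev (smul c P) (\<delta> f) = 0"
      unfolding f_def derivation_prod [OF \<delta> finite_lessThan] ev_hom(8)
      by (intro sum.neutral ballI key) simp
  qed
  then show ?thesis using point_in_curve_iff [OF P] ij derivations3
    by (auto simp: singular_points_def)
qed

text \<open>
  At a point on a single line, the derivative of \<open>f\<close> in a direction transversal to that line is the
  product of the values of the other lines.
\<close>

lemma two_lines_if_singular:
  assumes P: "P \<noteq> 0" and s: "point P \<in> singular_points f"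
  shows "\<exists>i\<in>through P. \<exists>j\<in>through P. i \<noteq> j"
proof (rule ccontr)
  assume no: "\<not> ?thesis"
  have "point P \<in> curve f" using s by (simp add: singular_points_def)
  then obtain i where i: "i \<in> through P" using point_in_curve_iff [OF P] by auto
  obtain e where e: "dot (\<nu> i) e = 1" using exists_dot_eq_1 [of "\<nu> i"] nonzero [of i] i through_subset by blast
  have v: "ev P (deriv_x f) = 0" "ev P (deriv_y f) = 0" "ev P (deriv_z f) = 0"
    using s P by (auto simp: singular_points_def vanishes_at_point dest!: spec [of _ "1::complex"]) (cases P; simp)+
  have "ev P (der (vmap C3 e) f) = 0"
    unfolding der_def grad_def by (cases e) (simp add: v)
  moreover have "ev P (der (vmap C3 e) f) = (\<Sum>k<d. if k = i then ev P (\<Prod>j\<in>{..<d} - {i}. lin (\<nu> j)) else 0)"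
    unfolding f_def der_prod [OF finite_lessThan] ev_hom(8) dot_C3
  proof (rule sum.cong [OF refl])
    fix k assume k: "k \<in> {..<d}"
    show "ev P (C3 (dot (\<nu> k) e) * (\<Prod>j\<in>{..<d} - {k}. lin (\<nu> j))) =
        (if k = i then ev P (\<Prod>j\<in>{..<d} - {i}. lin (\<nu> j)) else 0)"
    proof (cases "k = i")
      case False
      then have "\<exists>m\<in>{..<d} - {k}. dot (\<nu> m) P = 0" using i by (intro bexI [of _ i]) (auto simp: through_def)
      then show ?thesis using False by auto
    qed (simp add: e)
  qed
  moreover have "\<dots> = ev P (\<Prod>j\<in>{..<d} - {i}. lin (\<nu> j))" using i by (simp add: through_def)
  ultimately have "\<exists>m\<in>{..<d} - {i}. dot (\<nu> m) P = 0" by auto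
  then show False using no i by (auto simp: through_def)
qed

lemma finite_singular_points: "finite (singular_points f)"
proof (rule finite_subset)
  show "singular_points f \<subseteq> (\<lambda>(i, j). point (cross (\<nu> i) (\<nu> j))) ` ({..<d} \<times> {..<d})"
  proof
    fix p assume p: "p \<in> singular_points f"
    obtain P where P: "P \<noteq> 0" "p = point P" using point_cases by blast
    then obtain i j where ij: "i \<in> through P" "j \<in> through P" "i \<noteq> j" using two_lines_if_singular p by blast
    have "cross P (cross (\<nu> i) (\<nu> j)) = smul (dot (\<nu> j) P) (\<nu> i) - smul (dot (\<nu> i) P) (\<nu> j)"
      by (rule cross_cross)
    then have "cross P (cross (\<nu> i) (\<nu> j)) = 0" using ij by (simp add: through_def)
    then have "p = point (cross (\<nu> i) (\<nu> j))"
      using P ij distinct [of i j] by (simp add: point_eq_iff through_def)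
    then show "p \<in> (\<lambda>(i, j). point (cross (\<nu> i) (\<nu> j))) ` ({..<d} \<times> {..<d})"
      using ij by (auto simp: through_def)
  qed
qed simp

lemma global_tjurina_ge: "(\<Sum>p\<in>singular_points f. (mult_upto \<nu> d p - 1)\<^sup>2) \<le> global_tjurina f"
  unfolding global_tjurina_def
proof (rule sum_mono)
  fix p assume p: "p \<in> singular_points f"
  obtain P where P: "P \<noteq> 0" "p = point P" using point_cases by blast
  then obtain i j where ij: "i \<in> through P" "j \<in> through P" "i \<noteq> j" using two_lines_if_singular p by blast
  have "2 \<le> card (through P)" using card_mono [OF finite_through, of "{i, j}" P] ij by simp
  then show "(mult_upto \<nu> d p - 1)\<^sup>2 \<le> tjurina_number f p"
    using tjurina_number_ge [of P "{..<d}" \<nu>] P distinct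
    by (simp add: mult_upto_point f_def through_def)
qed

text \<open>
  Comparison of the two bounds for the dimension of the space of tangent fields of degree \<open>d - 3\<close>.
  Saito's criterion supplies \<open>n \<le> r\<close> for the multiplicity \<open>n\<close> of \<open>Q\<close>.
\<close>

lemma tjurina_bound:
  assumes nf: "\<not> free_curve f" and Q: "1 \<le> card (through Q)"
    and \<theta>: "der \<theta> f = 0" "hgv 0 r \<theta>" and det: "det3 Evec \<theta> (point_syzygy Q) \<noteq> 0"
    and r: "r + 1 \<le> d" and d2: "2 \<le> d"
  shows "int (global_tjurina f) \<ge> (int d - 1) * (int d - int r - 1) + int (r choose 2)
    + int (card (through Q) choose 2) + 1"
proof -
  define n where "n = card (through Q)"
  define s where "s = d - n"
  have nd: "n \<le> d" using card_through_le by (simp add: n_def)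
  note \<eta> = point_syzygy_AR [of Q] hgv_point_syzygy [of Q, folded n_def, folded s_def]
  have "d \<le> 1 + r + s" "1 + r + s \<noteq> d" using saito [OF \<theta> \<eta> det] nf by blast+
  then have nr: "n \<le> r" using nd by (simp add: s_def)
  have "\<exists>N. span_bound (tangent_fields \<nu> d d) N \<and>
      N + 2 * d \<le> (\<Sum>p\<in>singular_points f. (mult_upto \<nu> d p - 1)\<^sup>2) + 3"
  proof (rule tangent_fields_bound)
    fix P i j assume "i < d" "j < d" "i \<noteq> j" "P \<noteq> 0" "dot (\<nu> i) P = 0" "dot (\<nu> j) P = 0"
    then show "point P \<in> singular_points f" by (intro singular_if_two_lines [of P i j]) (auto simp: through_def)
  qed (use finite_singular_points nonzero distinct d_pos in auto)
  then obtain N where N: "span_bound (tangent_fields \<nu> d d) N" "N + 2 * d \<le> global_tjurina f + 3"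
    using global_tjurina_ge by (meson add_right_mono order_trans)
  have "((d - 2) choose 2) + ((d - r - 1) choose 2) + ((d - s - 1) choose 2) \<le> N"
    by (rule tangent_fields_dim_ge [OF \<theta> \<eta> det N(1)])
  moreover have "d - s - 1 = n - 1" using nd by (simp add: s_def)
  ultimately have le: "int ((d - 2) choose 2) + int ((d - r - 1) choose 2) + int ((n - 1) choose 2) \<le> int N"
    by (simp flip: of_nat_add)
  have ch: "2 * int (k choose 2) = int k * (int k - 1)" for k
  proof (cases k)
    case (Suc m)
    have "even (k * (k - 1))" by (simp add: Suc)
    then have "2 * (k choose 2) = k * (k - 1)" by (simp add: choose_two)
    then have "2 * int (k choose 2) = int k * int (k - 1)" by (metis of_nat_mult of_nat_numeral)
    then show ?thesis using Suc by simp
  qed simp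
  have n1: "1 \<le> n" using Q by (simp add: n_def)
  have c: "int (d - 2) = int d - 2" "int (d - r - 1) = int d - int r - 1" "int (n - 1) = int n - 1"
    using d2 r n1 by auto
  have T: "2 * int N + 4 * int d - 6 \<le> 2 * int (global_tjurina f)" using N(2) by linarith
  have dim: "(int d - 2) * (int d - 3) + (int d - int r - 1) * (int d - int r - 2) + (int n - 1) * (int n - 2)
      \<le> 2 * int N"
    using le ch [of "d - 2"] ch [of "d - r - 1"] ch [of "n - 1"] unfolding c by (simp add: algebra_simps)
  have id: "(int d - 2) * (int d - 3) + (int d - int r - 1) * (int d - int r - 2) + (int n - 1) * (int n - 2) + 4 * int d - 6
     = 2 * ((int d - 1) * (int d - int r - 1)) + int r * (int r - 1) + int n * (int n - 1) + 2 + 2 * (int r - int n)"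
    by (simp add: algebra_simps)
  \<comment> \<open>The slack is \<open>2 * (r - n)\<close>.\<close>
  have arith: "a + x + y + 1 \<le> t"
    if "2 * N' + 4 * d' - 6 \<le> 2 * t" "e \<le> 2 * N'" "e + 4 * d' - 6 = 2 * a + x' + y' + 2 + 2 * (r' - n')"
      "2 * x = x'" "2 * y = y'" "n' \<le> r'" for a x y x' y' t N' d' e r' n' :: int
    using that by presburger
  show ?thesis using arith [OF T dim id ch [of r] ch [of n]] nr by (simp add: n_def)
qed


subsection \<open>Points of large multiplicity\<close>

lemma two_points_on_curve: "\<exists>P Q. P \<noteq> 0 \<and> Q \<noteq> 0 \<and> point P \<noteq> point Q \<and> point P \<in> curve f \<and> point Q \<in> curve f"
proof -
  have i: "0 < d" using d_pos by simp
  obtain a b where ab: "cross a b = \<nu> 0" using exists_cross_eq nonzero [OF i] by blast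
  have ne: "cross a b \<noteq> 0" using ab nonzero [OF i] by simp
  have a: "a \<noteq> 0" and b: "b \<noteq> 0"
    using ne cross_smul(1) [of 0 a b] cross_smul(2) [of a 0 b] by auto
  have "dot (\<nu> 0) a = 0" "dot (\<nu> 0) b = 0"
    unfolding ab [symmetric] by (rule dot_cross_self)+
  then have "0 \<in> through a" "0 \<in> through b" using i by (simp_all add: through_def)
  then have "point a \<in> curve f" "point b \<in> curve f" using point_in_curve_iff a b by blast+
  moreover have "point a \<noteq> point b" using a b ne by (simp add: point_eq_iff)
  ultimately show ?thesis using a b by blast
qed

lemma mdr_le:
  assumes "P \<noteq> 0"
  shows "mdr f \<le> d - card (through P)"
proof -
  have "point_syzygy P \<in> AR_graded f (d - card (through P))"
    by (simp add: AR_graded_eq point_syzygy_AR hgv_point_syzygy)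
  then have "AR_graded f (d - card (through P)) \<noteq> {0}" using point_syzygy_nonzero [OF assms] by auto
  then show ?thesis unfolding mdr_def by (rule Least_le [where P = "\<lambda>m. AR_graded f m \<noteq> {0}"])
qed

text \<open>
  Some syzygy exists, for instance that of a point, so the minimum in \<open>mdr\<close> is attained.
\<close>

lemma minimal_syzygy_exists: "\<exists>\<theta>. der \<theta> f = 0 \<and> hgv 0 (mdr f) \<theta> \<and> \<theta> \<noteq> 0"
proof -
  obtain P :: "complex \<times> complex \<times> complex" where P: "P \<noteq> 0"
    using two_points_on_curve by (elim exE conjE)
  have "point_syzygy P \<in> AR_graded f (d - card (through P))"
    by (simp add: AR_graded_eq point_syzygy_AR hgv_point_syzygy)
  then have "AR_graded f (d - card (through P)) \<noteq> {0}" using point_syzygy_nonzero [OF P] by auto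
  then have ne: "AR_graded f (mdr f) \<noteq> {0}"
    unfolding mdr_def by (rule LeastI [where P = "\<lambda>m. AR_graded f m \<noteq> {0}"])
  have "hgv 0 (mdr f) 0" by (simp add: zero_triple)
  then have "0 \<in> AR_graded f (mdr f)" by (simp only: AR_graded_eq der_linear mem_Collect_eq simp_thms)
  with ne obtain \<theta> where "\<theta> \<in> AR_graded f (mdr f)" "\<theta> \<noteq> 0" by blast
  then show ?thesis unfolding AR_graded_eq by blast
qed

text \<open>
  Here the degree \<open>mdr f\<close> is less than the degree of the syzygy of \<open>P\<close>, which makes a minimal syzygy
  independent of it.
\<close>

lemma bound_at_point:
  assumes nf: "\<not> free_curve f" and P: "P \<noteq> 0" "point P \<in> curve f" and d2: "2 \<le> d"
    and r: "mdr f \<noteq> d - card (through P)"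
  shows "int (global_tjurina f) \<ge> (int d - 1) * (int d - int (mdr f) - 1) + int (mdr f choose 2)
    + int (card (through P) choose 2) + 1"
proof -
  obtain \<theta> where \<theta>: "der \<theta> f = 0" "hgv 0 (mdr f) \<theta>" "\<theta> \<noteq> 0" using minimal_syzygy_exists by blast
  have c: "1 \<le> card (through P)" using point_in_curve_iff [OF P(1)] P(2) finite_through by (simp add: Suc_le_eq card_gt_0_iff)
  have lt: "mdr f < d - card (through P)" using mdr_le [OF P(1)] r by simp
  show ?thesis
    by (rule tjurina_bound [OF nf c \<theta>(1,2) det_small_syzygy_ne [OF \<theta> lt] _ d2]) (use lt in simp)
qed

text \<open>
  Here the syzygy of \<open>P\<close> is itself of minimal degree.
\<close>

lemma bound_at_other_point:
  assumes nf: "\<not> free_curve f" and P: "P \<noteq> 0" "point P \<in> curve f" and d2: "2 \<le> d"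
    and r: "mdr f = d - card (through P)"
    and Q: "Q \<noteq> 0" "point Q \<in> curve f" "point Q \<noteq> point P"
  shows "int (global_tjurina f) \<ge> (int d - 1) * (int d - int (mdr f) - 1) + int (mdr f choose 2)
    + int (card (through Q) choose 2) + 1"
proof -
  have c: "1 \<le> card (through R)" if "R \<noteq> 0" "point R \<in> curve f" for R
    using point_in_curve_iff that finite_through by (simp add: Suc_le_eq card_gt_0_iff)
  have "cross P Q \<noteq> 0" using P Q by (metis point_eq_iff)
  then have det: "det3 Evec (point_syzygy P) (point_syzygy Q) \<noteq> 0" by (rule det_point_syzygy_ne)
  have rd: "mdr f + 1 \<le> d" using c [OF P] card_through_le [of P] unfolding r by simp
  have hg: "hgv 0 (mdr f) (point_syzygy P)" using hgv_point_syzygy unfolding r .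
  show ?thesis
    by (rule tjurina_bound [OF nf c [OF Q(1,2)] point_syzygy_AR hg det rd d2])
qed

end

theorem theorem1p3:
  fixes d r :: nat and L :: "nat \<Rightarrow> poly3" and f :: poly3
  assumes "d \<ge> 4"
    and "line_arrangement d L"
    and "f = arrangement_poly d L"
    and "\<not> free_curve f"
    and "r = mdr f"
    and "r \<ge> 2"
  shows "int (global_tjurina f) \<ge>
           (int d - 1) * (int d - int r - 1) + int (r choose 2) + int (second_mult d L choose 2) + 1
       \<and> (int r \<noteq> int d - int (max_mult d L) \<longrightarrow>
         int (global_tjurina f) \<ge>
           (int d - 1) * (int d - int r - 1) + int (r choose 2) + int (max_mult d L choose 2) + 1)"
proof -
  define \<nu> where "\<nu> i = (SOME l. L i = lin l)" for i
  have L: "L i = lin (\<nu> i)" if "i < d" for i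
  proof -
    have "homogeneous 1 (L i)" using assms(2) that by (simp add: line_arrangement_def)
    then show ?thesis unfolding \<nu>_def by (intro someI_ex [of "\<lambda>l. L i = lin l"] linear_form_exists)
  qed
  interpret A: lines d \<nu>
  proof
    fix i j assume i: "i < d"
    have "L i \<noteq> 0" using assms(2) i by (simp add: line_arrangement_def)
    then show nz: "\<nu> i \<noteq> 0" using L [OF i] by (simp add: lin_eq_0_iff)
    assume j: "j < d" "i \<noteq> j"
    have "L j \<noteq> 0" using assms(2) j by (simp add: line_arrangement_def)
    then have nzj: "\<nu> j \<noteq> 0" using L [OF j(1)] by (simp add: lin_eq_0_iff)
    show "cross (\<nu> i) (\<nu> j) \<noteq> 0"
    proof
      assume "cross (\<nu> i) (\<nu> j) = 0"
      then obtain c where "\<nu> i = smul c (\<nu> j)" using cross_eq_0_imp_proportional nzj by blast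
      then have "lin (\<nu> i) = [:[:[:c:]:]:] * lin (\<nu> j)"
        by (simp add: lin_def vmap_C3 dot_linear C3_def)
      then have "\<exists>c. L i = [:[:[:c:]:]:] * L j" unfolding L [OF i] L [OF j(1)] by (rule exI)
      then show False using assms(2) i j unfolding line_arrangement_def by blast
    qed
  qed (use assms(1) in simp)
  have f: "f = A.f" using L by (simp add: assms(3) arrangement_poly_def A.f_def)
  define \<mu> where "\<mu> = multiplicity_at d L"
  have mult: "\<mu> (point P) = card (A.through P)" if "P \<noteq> 0" for P
  proof -
    have "\<mu> (point P) = mult_upto \<nu> d (point P)"
      unfolding \<mu>_def multiplicity_at_def mult_upto_def using L by (intro arg_cong [of _ _ card]) auto
    then show ?thesis using A.mult_upto_point [OF that] by simp
  qed
  have "\<mu> p \<le> d" for p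
  proof -
    obtain P where "P \<noteq> 0" "p = point P" using point_cases [of p] by (elim exE conjE)
    then show ?thesis using A.card_through_le by (simp add: mult)
  qed
  then have fin: "finite (\<mu> ` C)" for C by (intro finite_subset [of "\<mu> ` C" "{..d}"]) auto
  obtain p1 p2 where p12: "p1 \<in> curve f" "p2 \<in> curve f" "p1 \<noteq> p2"
    using A.two_points_on_curve unfolding f by (elim exE conjE)
  define m where "m = max_mult d L"
  have m: "m = Max (\<mu> ` curve f)" by (simp add: m_def max_mult_def \<mu>_def assms(3))
  \<comment> \<open>The point that \<open>second_mult\<close> removes from the curve.\<close>
  define p where "p = (SOME p. p \<in> curve f \<and> \<mu> p = m)"
  have "m \<in> \<mu> ` curve f" unfolding m using p12 fin by (intro Max_in) auto
  then have p: "p \<in> curve f" "\<mu> p = m"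
    unfolding p_def using someI_ex [of "\<lambda>p. p \<in> curve f \<and> \<mu> p = m"] by auto
  define n where "n = second_mult d L"
  have n: "n = Max (\<mu> ` (curve f - {p}))"
    by (simp add: n_def second_mult_def \<mu>_def p_def m_def assms(3))
  have "n \<in> \<mu> ` (curve f - {p})" unfolding n using p12 fin by (intro Max_in) auto
  then obtain q where q: "q \<in> curve f" "q \<noteq> p" "\<mu> q = n" by blast
  have nm: "n \<le> m" unfolding m using q fin by (intro Max_ge) auto
  obtain P where P0: "P \<noteq> 0" "p = point P" using point_cases [of p] by (elim exE conjE)
  obtain Q where Q0: "Q \<noteq> 0" "q = point Q" using point_cases [of q] by (elim exE conjE)
  note PQ = P0 Q0
  have cards: "card (A.through P) = m" "card (A.through Q) = n" using mult PQ p q by auto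
  have md: "m \<le> d" using A.card_through_le [of P] cards by simp
  have nf: "\<not> free_curve A.f" and d2: "2 \<le> d" and r: "r = mdr A.f" using assms f by auto
  note P = PQ(1) p(1) [unfolded PQ(2) f] and Q = PQ(3) q(1) [unfolded PQ(4) f]
  let ?b = "\<lambda>k. (int d - 1) * (int d - int r - 1) + int (r choose 2) + int (k choose 2) + 1"
  have ii: "?b m \<le> int (global_tjurina f)" if "r \<noteq> d - m"
    using A.bound_at_point [OF nf P d2] that unfolding cards r f by blast
  have "?b n \<le> int (global_tjurina f)"
  proof (cases "r = d - m")
    case True
    have "point Q \<noteq> point P" using q PQ by simp
    then show ?thesis
      using A.bound_at_other_point [OF nf P d2 _ Q] True unfolding cards r f by blast
  next
    case False
    have "n choose 2 \<le> m choose 2" using nm by (rule binomial_right_mono)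
    then show ?thesis using ii [OF False] by linarith
  qed
  moreover have "?b m \<le> int (global_tjurina f)" if "int r \<noteq> int d - int m"
    using ii that md by (simp add: of_nat_diff)
  ultimately show ?thesis unfolding n_def m_def by blast
qed

end
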